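(* Let $\alpha>0$ and $0<\delta<1$, and for $c>0$ let $M_c(\delta)$ be the number of eigenvalues $\lambda_n^{(\alpha)}(c)$ of $\mathcal Q_c^{(\alpha)}$ which are not smaller than $\delta$. Then, as $c\to\infty$, $$\frac{\gamma_\alpha-\delta}{1-\delta}\,\frac{c}{2\pi}\Big(2^{2\alpha+1}B(\alpha+1,\alpha+1)\Big)^2+o(c)\leq M_c(\delta)\leq\frac1\delta\,\frac{c}{2\pi}\Big[2^{2\alpha+1}B(\alpha+1,\alpha+1)\Big]^2,$$ where $\gamma_\alpha=2^{4\alpha}\left(\frac{B(2\alpha+1,2\alpha+1)}{B(\alpha+1,\alpha+1)}\right)^2$ and $B(\cdot,\cdot)$ is the beta function (the upper bound holding for every $c>0$).
   Context: Let $c>0$, $\alpha>-1$, $\omega_\alpha(x)=(1-x^2)^\alpha$ on $I=[-1,1]$, $\mathcal F_c^{(\alpha)}f(x)=\int_{-1}^1e^{icxy}f(y)\omega_\alpha(y)\,dy$ on $L^2(I,\omega_\alpha)$, and $\mathcal Q_c^{(\alpha)}=\frac{c}{2\pi}(\mathcal F_c^{(\alpha)})^*\mathcal F_c^{(\alpha)}$, i.e. $\mathcal Q_c^{(\alpha)}g(x)=\int_{-1}^1\frac{c}{2\pi}\mathcal K_\alpha(c(x-y))g(y)\omega_\alpha(y)\,dy$ with $\mathcal K_\alpha(x)=\sqrt\pi\,2^{\alpha+1/2}\Gamma(\alpha+1)\frac{J_{\alpha+1/2}(x)}{x^{\alpha+1/2}}$. Its eigenvalues, in decreasing order, are $\lambda_0^{(\alpha)}(c)>\lambda_1^{(\alpha)}(c)>\cdots>0$.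 *)

theory Defs
  imports "HOL-Analysis.Analysis" "HOL-Library.Landau_Symbols"
begin

definition omega_w :: "real \<Rightarrow> real \<Rightarrow> real" where
  "omega_w \<alpha> x = (1 - x\<^sup>2) powr \<alpha>"

definition L2w :: "real \<Rightarrow> (real \<Rightarrow> complex) set" where
  "L2w \<alpha> = {g. g \<in> borel_measurable lborel \<and>
      set_integrable lborel {-1..1} (\<lambda>y. (cmod (g y))\<^sup>2 * omega_w \<alpha> y)}"

definition Fc :: "real \<Rightarrow> real \<Rightarrow> (real \<Rightarrow> complex) \<Rightarrow> real \<Rightarrow> complex" where
  "Fc c \<alpha> f x = (LINT y:{-1..1}|lborel. cis (c * x * y) * f y * of_real (omega_w \<alpha> y))"

definition Fc_adj :: "real \<Rightarrow> real \<Rightarrow> (real \<Rightarrow> complex) \<Rightarrow> real \<Rightarrow> complex" where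
  "Fc_adj c \<alpha> h y = (LINT x:{-1..1}|lborel. cnj (cis (c * x * y)) * h x * of_real (omega_w \<alpha> x))"

definition Qc :: "real \<Rightarrow> real \<Rightarrow> (real \<Rightarrow> complex) \<Rightarrow> real \<Rightarrow> complex" where
  "Qc c \<alpha> g x = of_real (c / (2 * pi)) * Fc_adj c \<alpha> (Fc c \<alpha> g) x"

definition is_eigenvalue_Q :: "real \<Rightarrow> real \<Rightarrow> real \<Rightarrow> bool" where
  "is_eigenvalue_Q c \<alpha> lam \<longleftrightarrow>
     (\<exists>g \<in> L2w \<alpha>. \<not> (AE x in lborel. x \<in> {-1..1} \<longrightarrow> g x = 0) \<and>
        (AE x in lborel. x \<in> {-1..1} \<longrightarrow> Qc c \<alpha> g x = of_real lam * g x))"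

text \<open>M_c(delta): number of eigenvalues lambda_n^(alpha)(c) with lambda_n >= delta
  (the eigenvalues are simple, lambda_0 > lambda_1 > ..., so this is the number of
  distinct eigenvalues >= delta).\<close>
definition M_count :: "real \<Rightarrow> real \<Rightarrow> real \<Rightarrow> nat" where
  "M_count c \<alpha> \<delta> = card {lam. is_eigenvalue_Q c \<alpha> lam \<and> \<delta> \<le> lam}"

end

theory Submission
  imports Defs "HOL-Probability.Probability" "HOL-Complex_Analysis.Complex_Analysis"
begin

text \<open>
  Write \<open>Q = (c / 2\<pi>) H\<^sup>2\<close> with the real symmetric Hartley-type transform
  \<open>H f(x) = \<integral> (cos cxy + sin cxy) f(y) \<omega>(y) dy\<close>; it commutes with
  \<open>L f = - (1 - x\<^sup>2) f'' + 2 (\<alpha> + 1) x f' + c\<^sup>2 x\<^sup>2 f\<close>, so \<open>L\<^sup>2(\<omega>)\<close> has an orthonormal basis of joint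
  eigenfunctions \<open>\<psi>\<close>, with \<open>H \<psi> = \<nu> \<psi>\<close> and with simple \<open>L\<close>-eigenvalues \<open>\<kappa>\<close>.

  Counting distinct eigenvalues of \<open>Q\<close> requires their simplicity. Let \<open>u, v\<close> belong to consecutive
  \<open>\<kappa> < \<kappa>'\<close>. If the Wronskian vanished at an interior point \<open>x\<^sub>0\<close>, multiples \<open>a\<close> and \<open>b\<close> of the cut-offs of
  \<open>v\<close> and \<open>u\<close> to \<open>[x\<^sub>0, 1]\<close> would satisfy \<open>(\<kappa>' - \<eta>) \<langle>a, \<psi>\<^sub>\<eta>\<rangle> = (\<kappa> - \<eta>) \<langle>b, \<psi>\<^sub>\<eta>\<rangle>\<close> and
  \<open>\<langle>a, b\<rangle> = 0\<close>, which Parseval's identity excludes. So \<open>W = u v' - u' v\<close> has a constant sign. With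
  \<open>P = \<langle>u', v\<rangle>\<close> and \<open>R = \<langle>v', u\<rangle>\<close>, both \<open>R - P = \<integral> W \<omega>\<close> and \<open>R + P = \<integral> (u v)' \<omega>\<close> have that
  sign, whence \<open>P\<^sup>2 < R\<^sup>2\<close>; differentiating \<open>H u\<close> under the integral turns this into \<open>\<nu>'\<^sup>2 < \<nu>\<^sup>2\<close>.

  The bounds now follow from \<open>0 \<le> Q \<le> 1\<close>: the trace \<open>\<Sum> \<lambda> \<le> (c / 2\<pi>) (\<integral> \<omega>)\<^sup>2\<close> gives the upper one, and
  \<open>\<Sum> \<lambda>\<^sup>2 - \<delta> \<Sum> \<lambda> \<le> (1 - \<delta>) M\<close> together with the Hilbert--Schmidt norm
  \<open>\<Sum> \<lambda>\<^sup>2 \<ge> (c / 2\<pi>) (\<integral> \<omega>\<^sup>2)\<^sup>2 - o(c)\<close> the lower one.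
\<close>

text \<open>The count runs over distinct numbers, so a coincidence of eigenvalues would lower it;
  that is the obstacle behind the strict monotonicity of \<open>\<nu>\<^sup>2\<close>. With cosine
  part \<open>C\<close> and sine part \<open>S\<close>, the adjoint of the transform times the
  transform is \<open>C\<^sup>2 + S\<^sup>2\<close>, which equals
  \<open>(C + S)\<^sup>2 = H\<^sup>2\<close> because parity kills the cross terms. No completed
  Hilbert space is formed: the spectral theory lives on bounded Borel functions with a semidefinite
  inner product. Eigen-equations first hold up to null functions and become pointwise after applying
  the smoothing \<open>H\<close>. Completeness reduces to moments: if the transforms of a bounded
  sequence tend to 0, their power series at small arguments send every moment to 0. Analyticity of
  \<open>H f\<close> also stands in for uniqueness theorems on differential equations, and Sturm
  comparison supplies consecutive \<kappa>. Both the bound \<open>Q \<le> 1\<close> and the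
  Plancherel inequality behind the Hilbert--Schmidt norm come from one identity: the average of
  \<open>(H f)\<^sup>2\<close> under a standard normal law is a Gaussian form in
  \<open>f\<close>.\<close>

section \<open>Bounded Borel functions and the weighted inner product\<close>

text \<open>
  Only the values on \<open>[-1, 1]\<close> matter; measurability is required on the whole line so that no
  restricted spaces occur in measurability proofs.
\<close>
definition Bd :: "(real \<Rightarrow> real) set" where
  "Bd = {f \<in> borel_measurable borel. \<exists>K. \<forall>x\<in>{-1..1}. \<bar>f x\<bar> \<le> K}"

lemma BdI: "f \<in> borel_measurable borel \<Longrightarrow> (\<And>x. x \<in> {-1..1} \<Longrightarrow> \<bar>f x\<bar> \<le> K) \<Longrightarrow> f \<in> Bd"
  unfolding Bd_def by blast

lemma Bd_measurable: "f \<in> Bd \<Longrightarrow> f \<in> borel_measurable borel"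
  by (auto simp: Bd_def)

lemma Bd_bound:
  assumes "f \<in> Bd" obtains K where "0 \<le> K" "\<And>x. x \<in> {-1..1} \<Longrightarrow> \<bar>f x\<bar> \<le> K"
proof -
  obtain K where "\<forall>x\<in>{-1..1}. \<bar>f x\<bar> \<le> K" using assms by (auto simp: Bd_def)
  then have "\<forall>x\<in>{-1..1}. \<bar>f x\<bar> \<le> max K 0" by force
  then show ?thesis using that[of "max K 0"] by auto
qed

lemma Bd_cont: "continuous_on UNIV f \<Longrightarrow> f \<in> Bd"
proof -
  assume f: "continuous_on UNIV f"
  have "bounded (f ` {-1..1})"
    by (intro compact_imp_bounded compact_continuous_image continuous_on_subset[OF f]) auto
  then obtain K where "\<forall>x\<in>{-1..1}. \<bar>f x\<bar> \<le> K" by (auto simp: bounded_iff)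
  moreover have "f \<in> borel_measurable borel" using f by (rule borel_measurable_continuous_onI)
  ultimately show ?thesis by (auto simp: Bd_def)
qed

lemma Bd_const [simp, intro]: "(\<lambda>x. k) \<in> Bd"
  by (rule Bd_cont) auto

lemma Bd_id [simp, intro]: "(\<lambda>x. x) \<in> Bd"
  by (rule Bd_cont) auto

lemma Bd_add [simp, intro]: "f \<in> Bd \<Longrightarrow> g \<in> Bd \<Longrightarrow> (\<lambda>x. f x + g x) \<in> Bd"
proof -
  assume f: "f \<in> Bd" and g: "g \<in> Bd"
  obtain K where K: "0 \<le> K" "\<And>x. x \<in> {-1..1} \<Longrightarrow> \<bar>f x\<bar> \<le> K" using Bd_bound[OF f] by blast
  obtain L where L: "0 \<le> L" "\<And>x. x \<in> {-1..1} \<Longrightarrow> \<bar>g x\<bar> \<le> L" using Bd_bound[OF g] by blast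
  show ?thesis
  proof (rule BdI)
    show "(\<lambda>x. f x + g x) \<in> borel_measurable borel" using f g by (auto dest!: Bd_measurable)
    show "\<bar>f x + g x\<bar> \<le> K + L" if "x \<in> {-1..1}" for x using K(2)[OF that] L(2)[OF that] by linarith
  qed
qed

lemma Bd_mult [simp, intro]: "f \<in> Bd \<Longrightarrow> g \<in> Bd \<Longrightarrow> (\<lambda>x. f x * g x) \<in> Bd"
proof -
  assume f: "f \<in> Bd" and g: "g \<in> Bd"
  obtain K where K: "0 \<le> K" "\<And>x. x \<in> {-1..1} \<Longrightarrow> \<bar>f x\<bar> \<le> K" using Bd_bound[OF f] by blast
  obtain L where L: "0 \<le> L" "\<And>x. x \<in> {-1..1} \<Longrightarrow> \<bar>g x\<bar> \<le> L" using Bd_bound[OF g] by blast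
  show ?thesis
  proof (rule BdI)
    show "(\<lambda>x. f x * g x) \<in> borel_measurable borel" using f g by (auto dest!: Bd_measurable)
    show "\<bar>f x * g x\<bar> \<le> K * L" if "x \<in> {-1..1}" for x
      unfolding abs_mult by (intro mult_mono K L that) auto
  qed
qed

lemma Bd_cmult [simp, intro]: "f \<in> Bd \<Longrightarrow> (\<lambda>x. k * f x) \<in> Bd"
  by (rule Bd_mult) auto

lemma Bd_minus [simp, intro]: "f \<in> Bd \<Longrightarrow> (\<lambda>x. - f x) \<in> Bd"
  using Bd_cmult[of f "-1"] by simp

lemma Bd_diff [simp, intro]: "f \<in> Bd \<Longrightarrow> g \<in> Bd \<Longrightarrow> (\<lambda>x. f x - g x) \<in> Bd"
  using Bd_add[of f "\<lambda>x. - g x"] by auto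

lemma Bd_power [simp, intro]: "f \<in> Bd \<Longrightarrow> (\<lambda>x. f x ^ n) \<in> Bd"
  by (induction n) auto

lemma Bd_sum [simp, intro]: "(\<And>i. i \<in> S \<Longrightarrow> f i \<in> Bd) \<Longrightarrow> (\<lambda>x. \<Sum>i\<in>S. f i x) \<in> Bd"
  by (induction S rule: infinite_finite_induct) auto

lemma Bd_reflect [simp, intro]: "f \<in> Bd \<Longrightarrow> (\<lambda>x. f (- x)) \<in> Bd"
proof -
  assume f: "f \<in> Bd"
  obtain K where K: "0 \<le> K" "\<And>x. x \<in> {-1..1} \<Longrightarrow> \<bar>f x\<bar> \<le> K" using Bd_bound[OF f] by blast
  show ?thesis
  proof (rule BdI)
    show "(\<lambda>x. f (- x)) \<in> borel_measurable borel"
      using Bd_measurable[OF f] by measurable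
    show "\<bar>f (- x)\<bar> \<le> K" if "x \<in> {-1..1}" for x using K(2)[of "- x"] that by simp
  qed
qed

lemma Bd_cutoff [simp, intro]: "f \<in> Bd \<Longrightarrow> (\<lambda>x. f x * indicator {a..} x) \<in> Bd"
proof -
  have "(indicator {a..} :: real \<Rightarrow> real) \<in> Bd"
    by (rule BdI[of _ 1]) (auto simp: indicator_def)
  then show "f \<in> Bd \<Longrightarrow> ?thesis" by (rule Bd_mult[rotated])
qed

section \<open>The weight and its measure\<close>

lemma omega_w_nonneg [simp]: "0 \<le> omega_w \<alpha> x"
  by (simp add: omega_w_def)

lemma omega_w_reflect [simp]: "omega_w \<alpha> (- x) = omega_w \<alpha> x"
  by (simp add: omega_w_def)

lemma omega_w_measurable [measurable]: "omega_w \<alpha> \<in> borel_measurable borel"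
  unfolding omega_w_def by measurable

lemma omega_w_le_1: "0 \<le> \<alpha> \<Longrightarrow> x \<in> {-1..1} \<Longrightarrow> omega_w \<alpha> x \<le> 1"
proof -
  assume "0 \<le> \<alpha>" "x \<in> {-1..1}"
  then have "x\<^sup>2 \<le> 1" by (auto simp: abs_square_le_1)
  then show ?thesis unfolding omega_w_def
    using \<open>0 \<le> \<alpha>\<close> powr_mono2[of \<alpha> "1 - x\<^sup>2" 1] by simp
qed

lemma omega_w_pos: "x \<in> {-1<..<1} \<Longrightarrow> 0 < omega_w \<alpha> x"
  unfolding omega_w_def using abs_square_less_1[of x] by (auto simp: abs_less_iff)

text \<open>The interval is the space of the measure rather than a factor of the integrand, so facts
  about [-1, 1] hold everywhere on \<open>space M\<close> and bounded functions are
  integrable.\<close>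

definition wmeas :: "real \<Rightarrow> real measure" where
  "wmeas \<alpha> = density (restrict_space lborel {-1..1}) (\<lambda>x. ennreal (omega_w \<alpha> x))"

lemma space_wmeas [simp]: "space (wmeas \<alpha>) = {-1..1}"
  by (simp add: wmeas_def space_restrict_space)

lemma borel_measurable_wmeas: "f \<in> measurable borel N \<Longrightarrow> f \<in> measurable (wmeas \<alpha>) N"
  unfolding wmeas_def measurable_density_eq1
  by (simp add: measurable_restrict_space1)

lemma id_wmeas: "(\<lambda>x. x) \<in> borel_measurable (wmeas \<alpha>)"
  by (rule borel_measurable_wmeas) simp

locale jacobi_weight =
  fixes \<alpha> :: real
  assumes alpha_pos: "0 < \<alpha>"
begin

abbreviation "\<omega> \<equiv> omega_w \<alpha>"
abbreviation "M \<equiv> wmeas \<alpha>"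

definition ip :: "(real \<Rightarrow> real) \<Rightarrow> (real \<Rightarrow> real) \<Rightarrow> real" where
  "ip f g = (LINT x|M. f x * g x)"

definition mass :: real where "mass = (LINT x|M. 1)"

lemma emeasure_wmeas: "emeasure M {-1..1} = (\<integral>\<^sup>+x. ennreal (\<omega> x) * indicator {-1..1} x \<partial>lborel)"
proof -
  have "emeasure M {-1..1} = (\<integral>\<^sup>+x. ennreal (\<omega> x) * indicator {-1..1} x \<partial>(restrict_space lborel {-1..1}))"
    unfolding wmeas_def by (subst emeasure_density) (auto simp: sets_restrict_space_iff measurable_restrict_space1)
  also have "\<dots> = (\<integral>\<^sup>+x. ennreal (\<omega> x) * indicator {-1..1} x * indicator {-1..1} x \<partial>lborel)"
    by (subst nn_integral_restrict_space) auto
  also have "\<dots> = (\<integral>\<^sup>+x. ennreal (\<omega> x) * indicator {-1..1} x \<partial>lborel)"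
    by (intro nn_integral_cong) (auto simp: indicator_def)
  finally show ?thesis .
qed

sublocale finite_measure M
proof
  have "(\<integral>\<^sup>+x. ennreal (\<omega> x) * indicator {-1..1} x \<partial>lborel) \<le> (\<integral>\<^sup>+x. indicator {-1..1::real} x \<partial>lborel)"
    using alpha_pos omega_w_le_1 by (intro nn_integral_mono) (auto simp: indicator_def)
  also have "\<dots> < \<infinity>" by simp
  finally show "emeasure M (space M) \<noteq> \<infinity>" by (simp add: emeasure_wmeas)
qed

sublocale MM: pair_sigma_finite M M ..
sublocale MMf: finite_measure "M \<Otimes>\<^sub>M M"
  by (rule finite_measure_pair_measure) unfold_locales

lemma Bd_integrable [simp, intro]: "f \<in> Bd \<Longrightarrow> integrable M f"
proof -
  assume f: "f \<in> Bd"
  obtain K where K: "0 \<le> K" "\<And>x. x \<in> {-1..1} \<Longrightarrow> \<bar>f x\<bar> \<le> K" using Bd_bound[OF f] by blast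
  show ?thesis
  proof (rule integrable_const_bound)
    show "AE x in M. norm (f x) \<le> K" using K by (intro AE_I2) auto
    show "f \<in> borel_measurable M" using Bd_measurable[OF f] by (rule borel_measurable_wmeas)
  qed
qed

lemma LINT_wmeas:
  fixes f :: "real \<Rightarrow> 'a::{banach,second_countable_topology}"
  assumes "f \<in> borel_measurable borel"
  shows "(LINT x|M. f x) = (LINT x:{-1..1}|lborel. \<omega> x *\<^sub>R f x)"
proof -
  have f: "f \<in> borel_measurable (restrict_space lborel {-1..1})"
    using assms by (simp add: measurable_restrict_space1)
  have "(LINT x|M. f x) = (LINT x|restrict_space lborel {-1..1}. \<omega> x *\<^sub>R f x)"
    unfolding wmeas_def by (rule integral_density) (auto simp: f measurable_restrict_space1)
  also have "\<dots> = (LINT x:{-1..1}|lborel. \<omega> x *\<^sub>R f x)"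
    unfolding set_lebesgue_integral_def
    by (subst integral_restrict_space) auto
  finally show ?thesis .
qed

lemma integrable_wmeas_iff:
  fixes f :: "real \<Rightarrow> 'a::{banach,second_countable_topology}"
  assumes "f \<in> borel_measurable borel"
  shows "integrable M f \<longleftrightarrow> set_integrable lborel {-1..1} (\<lambda>x. \<omega> x *\<^sub>R f x)"
proof -
  have f: "f \<in> borel_measurable (restrict_space lborel {-1..1})"
    using assms by (simp add: measurable_restrict_space1)
  have "integrable M f \<longleftrightarrow> integrable (restrict_space lborel {-1..1}) (\<lambda>x. \<omega> x *\<^sub>R f x)"
    unfolding wmeas_def by (rule integrable_density) (auto simp: f measurable_restrict_space1)
  also have "\<dots> = set_integrable lborel {-1..1} (\<lambda>x. \<omega> x *\<^sub>R f x)"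
    unfolding set_integrable_def
    by (subst integrable_restrict_space) auto
  finally show ?thesis .
qed

text \<open>On the interval the weight can vanish only at the two ends, so weighted and Lebesgue
  null sets agree. This links the definition of eigenvalues to the inner product.\<close>

lemma AE_wmeas_iff:
  assumes "Measurable.pred borel P"
  shows "(AE x in M. P x) \<longleftrightarrow> (AE x in lborel. x \<in> {-1..1} \<longrightarrow> P x)"
proof -
  have m: "(\<lambda>x. ennreal (\<omega> x)) \<in> borel_measurable (restrict_space lborel {-1..1})"
    by (simp add: measurable_restrict_space1)
  have "(AE x in M. P x) \<longleftrightarrow> (AE x in restrict_space lborel {-1..1}. 0 < ennreal (\<omega> x) \<longrightarrow> P x)"
    unfolding wmeas_def by (rule AE_density[OF m])
  also have "\<dots> \<longleftrightarrow> (AE x in lborel. x \<in> {-1..1} \<longrightarrow> 0 < ennreal (\<omega> x) \<longrightarrow> P x)"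
    by (subst AE_restrict_space_iff) auto
  also have "\<dots> \<longleftrightarrow> (AE x in lborel. x \<in> {-1..1} \<longrightarrow> P x)"
  proof
    assume *: "AE x in lborel. x \<in> {-1..1} \<longrightarrow> 0 < ennreal (\<omega> x) \<longrightarrow> P x"
    have "AE x in lborel. x \<noteq> (-1::real)" "AE x in lborel. x \<noteq> (1::real)"
      by (rule AE_lborel_singleton)+
    with * show "AE x in lborel. x \<in> {-1..1} \<longrightarrow> P x"
    proof eventually_elim
      case (elim x)
      then show ?case using omega_w_pos[of x \<alpha>] by auto
    qed
  next
    assume *: "AE x in lborel. x \<in> {-1..1} \<longrightarrow> P x"
    then show "AE x in lborel. x \<in> {-1..1} \<longrightarrow> 0 < ennreal (\<omega> x) \<longrightarrow> P x" by eventually_elim auto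
  qed
  finally show ?thesis .
qed

lemma ip_sym: "ip f g = ip g f"
  by (simp add: ip_def mult.commute)

lemma ip_add_left: "f \<in> Bd \<Longrightarrow> g \<in> Bd \<Longrightarrow> h \<in> Bd \<Longrightarrow> ip (\<lambda>x. f x + g x) h = ip f h + ip g h"
  unfolding ip_def by (simp add: algebra_simps Bochner_Integration.integral_add)

lemma ip_diff_left: "f \<in> Bd \<Longrightarrow> g \<in> Bd \<Longrightarrow> h \<in> Bd \<Longrightarrow> ip (\<lambda>x. f x - g x) h = ip f h - ip g h"
  unfolding ip_def by (simp add: algebra_simps Bochner_Integration.integral_diff)

lemma ip_scale_left [simp]: "ip (\<lambda>x. k * f x) g = k * ip f g"
  unfolding ip_def by (simp add: mult.assoc)

lemma ip_scale_right [simp]: "ip f (\<lambda>x. k * g x) = k * ip f g"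
  unfolding ip_def by (simp add: mult.left_commute)

lemma ip_add_right: "f \<in> Bd \<Longrightarrow> g \<in> Bd \<Longrightarrow> h \<in> Bd \<Longrightarrow> ip h (\<lambda>x. f x + g x) = ip h f + ip h g"
  by (simp add: ip_add_left ip_sym[of h])

lemma ip_diff_right: "f \<in> Bd \<Longrightarrow> g \<in> Bd \<Longrightarrow> h \<in> Bd \<Longrightarrow> ip h (\<lambda>x. f x - g x) = ip h f - ip h g"
  by (simp add: ip_diff_left ip_sym[of h])

lemma ip_sum_left:
  "(\<And>i. i \<in> S \<Longrightarrow> f i \<in> Bd) \<Longrightarrow> g \<in> Bd \<Longrightarrow> ip (\<lambda>x. \<Sum>i\<in>S. f i x) g = (\<Sum>i\<in>S. ip (f i) g)"
  unfolding ip_def by (simp add: sum_distrib_right Bochner_Integration.integral_sum)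

lemma ip_sum_right:
  "(\<And>i. i \<in> S \<Longrightarrow> f i \<in> Bd) \<Longrightarrow> g \<in> Bd \<Longrightarrow> ip g (\<lambda>x. \<Sum>i\<in>S. f i x) = (\<Sum>i\<in>S. ip g (f i))"
  by (simp add: ip_sum_left ip_sym[of g])

lemma ip_cong: "(\<And>x. x \<in> {-1..1} \<Longrightarrow> f x = f' x) \<Longrightarrow> (\<And>x. x \<in> {-1..1} \<Longrightarrow> g x = g' x) \<Longrightarrow> ip f g = ip f' g'"
  unfolding ip_def by (rule Bochner_Integration.integral_cong) auto

lemma ip_nonneg [simp]: "0 \<le> ip f f"
  unfolding ip_def by (rule integral_nonneg_AE) auto

lemma ip_mono:
  "f \<in> Bd \<Longrightarrow> g \<in> Bd \<Longrightarrow> (\<And>x. x \<in> {-1..1} \<Longrightarrow> \<bar>f x\<bar> \<le> \<bar>g x\<bar>) \<Longrightarrow> ip f f \<le> ip g g"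
  unfolding ip_def by (intro integral_mono) (auto simp: abs_le_square_iff power2_eq_square[symmetric])

lemma mass_nonneg: "0 \<le> mass"
  unfolding mass_def by simp

lemma ip_le_sup:
  assumes "f \<in> Bd" "\<And>x. x \<in> {-1..1} \<Longrightarrow> \<bar>f x\<bar> \<le> K" shows "ip f f \<le> K\<^sup>2 * mass"
proof -
  have "ip f f \<le> ip (\<lambda>x. K) (\<lambda>x. K)"
    using assms by (intro ip_mono) force+
  also have "\<dots> = K\<^sup>2 * mass" by (simp add: ip_def mass_def power2_eq_square)
  finally show ?thesis .
qed

lemma ip_affine_sq:
  assumes "f \<in> Bd" "g \<in> Bd"
  shows "ip (\<lambda>x. f x + t * g x) (\<lambda>x. f x + t * g x) = ip f f + 2 * t * ip f g + t\<^sup>2 * ip g g"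
  using assms by (simp add: ip_add_left ip_add_right algebra_simps power2_eq_square ip_sym[of g f])

lemma ip_diff_sq:
  assumes "f \<in> Bd" "g \<in> Bd"
  shows "ip (\<lambda>x. f x - g x) (\<lambda>x. f x - g x) = ip f f - 2 * ip f g + ip g g"
  using assms by (simp add: ip_diff_left ip_diff_right algebra_simps ip_sym[of g f])

end

lemma nonneg_quadratic_discriminant:
  fixes a b d :: real
  assumes "\<And>t. 0 \<le> a + 2 * t * b + t\<^sup>2 * d" "0 \<le> d"
  shows "b\<^sup>2 \<le> a * d"
proof (cases "d = 0")
  case True
  have "b = 0"
  proof (rule ccontr)
    assume "b \<noteq> 0"
    \<comment> \<open>With \<open>d = 0\<close> the polynomial is affine in \<open>t\<close>, and
      this \<open>t\<close> gives it the value -1.\<close>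
    have "0 \<le> a + 2 * (- (a + 1) / (2 * b)) * b" using assms(1)[of "- (a + 1) / (2 * b)"] True by simp
    also have "\<dots> = -1" using \<open>b \<noteq> 0\<close> by (simp add: field_simps)
    finally show False by simp
  qed
  then show ?thesis using True by simp
next
  case False
  then have d: "0 < d" using assms by simp
  \<comment> \<open>The minimiser of the quadratic.\<close>
  have "0 \<le> a + 2 * (- b / d) * b + (- b / d)\<^sup>2 * d" by (rule assms)
  also have "\<dots> = a - b\<^sup>2 / d" using d by (simp add: field_simps power2_eq_square)
  finally show ?thesis using d by (simp add: field_simps)
qed

context jacobi_weight begin

lemma ip_Cauchy_Schwarz: "f \<in> Bd \<Longrightarrow> g \<in> Bd \<Longrightarrow> (ip f g)\<^sup>2 \<le> ip f f * ip g g"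
  by (rule nonneg_quadratic_discriminant) (simp_all flip: ip_affine_sq)

lemma ip_abs_le: "f \<in> Bd \<Longrightarrow> g \<in> Bd \<Longrightarrow> \<bar>ip f g\<bar> \<le> sqrt (ip f f) * sqrt (ip g g)"
  using ip_Cauchy_Schwarz[of f g] by (metis real_sqrt_abs real_sqrt_le_iff real_sqrt_mult)

lemma ip_null_left: "f \<in> Bd \<Longrightarrow> g \<in> Bd \<Longrightarrow> ip f f = 0 \<Longrightarrow> ip f g = 0"
  using ip_Cauchy_Schwarz[of f g] by simp

lemma norm_triangle:
  assumes "f \<in> Bd" "g \<in> Bd"
  shows "sqrt (ip (\<lambda>x. f x + g x) (\<lambda>x. f x + g x)) \<le> sqrt (ip f f) + sqrt (ip g g)"
proof (rule real_le_lsqrt)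
  have "ip (\<lambda>x. f x + g x) (\<lambda>x. f x + g x) = ip f f + 2 * ip f g + ip g g"
    using ip_affine_sq[OF assms, of 1] by simp
  also have "\<dots> \<le> (sqrt (ip f f) + sqrt (ip g g))\<^sup>2"
    using ip_abs_le[OF assms] by (simp add: power2_sum)
  finally show "ip (\<lambda>x. f x + g x) (\<lambda>x. f x + g x) \<le> (sqrt (ip f f) + sqrt (ip g g))\<^sup>2" .
qed simp_all

section \<open>Orthonormal systems and projections\<close>

definition orthonormal_on :: "'i set \<Rightarrow> ('i \<Rightarrow> real \<Rightarrow> real) \<Rightarrow> bool" where
  "orthonormal_on S e \<longleftrightarrow> (\<forall>i\<in>S. e i \<in> Bd) \<and> (\<forall>i\<in>S. \<forall>j\<in>S. ip (e i) (e j) = (if i = j then 1 else 0))"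

text \<open>For finite \<open>S\<close>, what the orthogonal projection onto the span of
  \<open>e\<close> leaves of \<open>f\<close>.\<close>

definition residual :: "'i set \<Rightarrow> ('i \<Rightarrow> real \<Rightarrow> real) \<Rightarrow> (real \<Rightarrow> real) \<Rightarrow> real \<Rightarrow> real" where
  "residual S e f x = f x - (\<Sum>i\<in>S. ip f (e i) * e i x)"

lemma residual_Bd [simp, intro]: "orthonormal_on S e \<Longrightarrow> f \<in> Bd \<Longrightarrow> residual S e f \<in> Bd"
  unfolding residual_def[abs_def] orthonormal_on_def by (intro Bd_diff Bd_sum Bd_cmult) auto

lemma ip_residual:
  assumes "orthonormal_on S e" "f \<in> Bd" "g \<in> Bd"
  shows "ip (residual S e f) g = ip f g - (\<Sum>i\<in>S. ip f (e i) * ip g (e i))"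
proof -
  have B: "e i \<in> Bd" if "i \<in> S" for i using assms(1) that by (auto simp: orthonormal_on_def)
  have "ip (residual S e f) g = ip f g - ip (\<lambda>x. \<Sum>i\<in>S. ip f (e i) * e i x) g"
    unfolding residual_def[abs_def] using assms B by (intro ip_diff_left Bd_sum Bd_cmult) auto
  also have "ip (\<lambda>x. \<Sum>i\<in>S. ip f (e i) * e i x) g = (\<Sum>i\<in>S. ip f (e i) * ip g (e i))"
    using B assms by (subst ip_sum_left) (auto simp: ip_sym[of g])
  finally show ?thesis .
qed

lemma ip_residual_basis:
  assumes "orthonormal_on S e" "f \<in> Bd" "finite S" "j \<in> S"
  shows "ip (residual S e f) (e j) = 0"
proof -
  have "(\<Sum>i\<in>S. ip f (e i) * ip (e j) (e i)) = (\<Sum>i\<in>S. if i = j then ip f (e i) else 0)"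
    using assms by (intro sum.cong) (auto simp: orthonormal_on_def)
  then show ?thesis
    using assms by (subst ip_residual) (auto simp: orthonormal_on_def sum.delta)
qed

lemma residual_sq:
  assumes "orthonormal_on S e" "f \<in> Bd" "finite S"
  shows "ip (residual S e f) (residual S e f) = ip f f - (\<Sum>i\<in>S. (ip f (e i))\<^sup>2)"
proof -
  have "ip (residual S e f) (residual S e f) = ip f (residual S e f) - (\<Sum>i\<in>S. ip f (e i) * ip (residual S e f) (e i))"
    using assms by (intro ip_residual) auto
  also have "(\<Sum>i\<in>S. ip f (e i) * ip (residual S e f) (e i)) = 0"
    using assms by (intro sum.neutral) (auto simp: ip_residual_basis)
  also have "ip f (residual S e f) = ip f f - (\<Sum>i\<in>S. (ip f (e i))\<^sup>2)"
    using assms by (subst ip_sym, subst ip_residual) (auto simp: power2_eq_square)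
  finally show ?thesis by simp
qed

lemma Bessel:
  assumes "orthonormal_on S e" "f \<in> Bd" "finite S"
  shows "(\<Sum>i\<in>S. (ip f (e i))\<^sup>2) \<le> ip f f"
  using residual_sq[OF assms] ip_nonneg[of "residual S e f"] by linarith

text \<open>The derivative is required in the open interval only, because powers of
  \<open>1 - x\<^sup>2\<close> may fail to be differentiable at the ends.\<close>

lemma integral_wmeas_cutoff_FTC:
  assumes a: "a \<in> {-1..1}" and \<Phi>: "continuous_on {a..1} \<Phi>"
    and d: "\<And>x. x \<in> {a<..<1} \<Longrightarrow> (\<Phi> has_real_derivative \<phi> x * \<omega> x) (at x)"
    and B: "\<phi> \<in> Bd"
  shows "(LINT x|M. \<phi> x * indicator {a..} x) = \<Phi> 1 - \<Phi> a"
proof -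
  have "((\<lambda>x. \<phi> x * \<omega> x) has_integral (\<Phi> 1 - \<Phi> a)) {a..1}"
    using a d by (intro fundamental_theorem_of_calculus_interior \<Phi>)
      (auto simp: has_real_derivative_iff_has_vector_derivative)
  then have hk: "integral {a..1} (\<lambda>x. \<phi> x * \<omega> x) = \<Phi> 1 - \<Phi> a" by (rule integral_unique)
  have si: "set_integrable lborel {-1..1} (\<lambda>x. \<omega> x *\<^sub>R \<phi> x)"
    using integrable_wmeas_iff[of \<phi>] B Bd_measurable by auto
  have "set_integrable lborel {a..1} (\<lambda>x. \<omega> x *\<^sub>R \<phi> x)"
    by (rule set_integrable_subset[OF si]) (use a in auto)
  then have "(LINT x:{a..1}|lborel. \<omega> x *\<^sub>R \<phi> x) = \<Phi> 1 - \<Phi> a"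
    using set_borel_integral_eq_integral(2)[of "{a..1}" "\<lambda>x. \<omega> x *\<^sub>R \<phi> x"] hk by (simp add: mult.commute)
  moreover have "(LINT x|M. \<phi> x * indicator {a..} x) = (LINT x:{-1..1}|lborel. \<omega> x *\<^sub>R (\<phi> x * indicator {a..} x))"
    using Bd_measurable[OF Bd_cutoff[OF B]] by (rule LINT_wmeas)
  moreover have "\<dots> = (LINT x:{a..1}|lborel. \<omega> x *\<^sub>R \<phi> x)"
    unfolding set_lebesgue_integral_def using a
    by (intro Bochner_Integration.integral_cong) (auto simp: indicator_def)
  ultimately show ?thesis by simp
qed

lemma integral_wmeas_FTC:
  assumes "continuous_on {-1..1} \<Phi>"
    and "\<And>x. x \<in> {-1<..<1} \<Longrightarrow> (\<Phi> has_real_derivative \<phi> x * \<omega> x) (at x)"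
    and "\<phi> \<in> Bd"
  shows "(LINT x|M. \<phi> x) = \<Phi> 1 - \<Phi> (-1)"
proof -
  have "(LINT x|M. \<phi> x) = (LINT x|M. \<phi> x * indicator {-1..} x)"
    by (intro Bochner_Integration.integral_cong) auto
  also have "\<dots> = \<Phi> 1 - \<Phi> (-1)" using assms by (intro integral_wmeas_cutoff_FTC) auto
  finally show ?thesis .
qed

lemma integral_wmeas_reflect: "f \<in> Bd \<Longrightarrow> (LINT x|M. f (- x)) = (LINT x|M. f x)"
proof -
  assume f: "f \<in> Bd"
  have m: "f \<in> borel_measurable borel" using f by (rule Bd_measurable)
  have "(LINT x|M. f (- x)) = (LINT x|lborel. indicator {-1..1} x *\<^sub>R (\<omega> x *\<^sub>R f (- x)))"
    using m by (subst LINT_wmeas) (auto simp: set_lebesgue_integral_def)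
  also have "\<dots> = (LINT x|lborel. indicator {-1..1} (- x) *\<^sub>R (\<omega> (- x) *\<^sub>R f (- (- x))))"
    using lborel_integral_real_affine[of "-1" "\<lambda>x. indicator {-1..1} x *\<^sub>R (\<omega> x *\<^sub>R f (- x))" 0] by simp
  also have "\<dots> = (LINT x|M. f x)"
    using m by (subst LINT_wmeas) (auto simp: set_lebesgue_integral_def indicator_def intro!: Bochner_Integration.integral_cong)
  finally show ?thesis .
qed

lemma ip_reflect: "f \<in> Bd \<Longrightarrow> g \<in> Bd \<Longrightarrow> ip (\<lambda>x. f (- x)) g = ip f (\<lambda>x. g (- x))"
  using integral_wmeas_reflect[of "\<lambda>x. f (- x) * g x"] by (simp add: ip_def)

lemma wmeas_has_integral:
  assumes "f \<in> Bd" shows "((\<lambda>x. f x * \<omega> x) has_integral (LINT x|M. f x)) {-1..1}"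
proof -
  have si: "set_integrable lborel {-1..1} (\<lambda>x. \<omega> x *\<^sub>R f x)"
    using integrable_wmeas_iff[of f] assms Bd_measurable by auto
  have "(\<lambda>x. \<omega> x *\<^sub>R f x) integrable_on {-1..1}"
    "(LINT x:{-1..1}|lborel. \<omega> x *\<^sub>R f x) = integral {-1..1} (\<lambda>x. \<omega> x *\<^sub>R f x)"
    using set_borel_integral_eq_integral[OF si] by auto
  then show ?thesis
    using LINT_wmeas[OF Bd_measurable[OF assms]] by (simp add: mult.commute has_integral_integral)
qed

text \<open>The zero set is closed, and a closed set that contains almost every point of an open
  interval contains the interval.\<close>

lemma AE_zero_imp_zero:
  assumes "continuous_on UNIV f" "AE x in M. x \<in> {l<..<r} \<longrightarrow> f x = 0" "x \<in> {l<..<r}" "-1 \<le> l" "r \<le> 1"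
  shows "f x = (0::real)"
proof -
  have m: "f \<in> borel_measurable borel" using assms(1) by (rule borel_measurable_continuous_onI)
  have "AE x in lborel. x \<in> {-1..1} \<longrightarrow> x \<in> {l<..<r} \<longrightarrow> f x = 0"
    using assms(2) m by (subst (asm) AE_wmeas_iff) auto
  then have "AE x in lborel. x \<in> {l<..<r} \<longrightarrow> x \<in> {x. f x = 0}"
    by (rule AE_mp) (use assms(4,5) in \<open>auto intro!: AE_I2\<close>)
  then have "AE x in lebesgue. x \<in> {l<..<r} \<longrightarrow> x \<in> {x. f x = 0}"
    using AE_completion by blast
  moreover have "closed {x. f x = 0}"
    using assms(1) by (intro closed_Collect_eq) auto
  ultimately have "x \<in> {x. f x = 0}"
    using mem_closed_if_AE_lebesgue_open[of "{l<..<r}" "{x. f x = 0}"] assms(3) by auto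
  then show ?thesis by simp
qed

lemma ip_zero_AE:
  assumes "f \<in> Bd" "ip f f = 0" shows "AE x in M. f x = 0"
proof -
  have "AE x in M. f x * f x = 0"
    using assms integral_nonneg_eq_0_iff_AE[of M "\<lambda>x. f x * f x"] by (auto simp: ip_def)
  then show ?thesis by eventually_elim simp
qed

lemma integral_wmeas_pos:
  fixes f :: "real \<Rightarrow> real"
  assumes f: "continuous_on UNIV f" and pos: "\<And>x. x \<in> {-1<..<1} \<Longrightarrow> 0 < f x"
  shows "0 < (LINT x|M. f x)"
proof -
  have nn: "0 \<le> f x" if "x \<in> {-1..1}" for x
  proof -
    have "x \<in> closure {-1<..<1}" using that by simp
    moreover have "closure {-1<..<1::real} \<subseteq> {x. 0 \<le> f x}"
    proof (rule closure_minimal)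
      show "closed {x. 0 \<le> f x}" using f by (intro closed_Collect_le) auto
    qed (use pos in \<open>auto intro: less_imp_le\<close>)
    ultimately show ?thesis by auto
  qed
  have "(LINT x|M. f x) \<noteq> 0"
  proof
    assume "(LINT x|M. f x) = 0"
    then have "AE x in M. f x = 0"
      using nn f by (subst (asm) integral_nonneg_eq_0_iff_AE) (auto simp: Bd_cont)
    then have "f 0 = 0" using f by (intro AE_zero_imp_zero[where l = "-1" and r = 1]) auto
    with pos[of 0] show False by simp
  qed
  moreover have "0 \<le> (LINT x|M. f x)" using nn by (intro integral_nonneg_AE AE_I2) auto
  ultimately show ?thesis by simp
qed

end

section \<open>The Hartley transform\<close>

text \<open>The Hartley kernel: \<open>cas (c * x * y)\<close> is real and symmetric in
  \<open>x\<close> and \<open>y\<close>, so the transform is symmetric for a real inner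
  product.\<close>

definition cas :: "real \<Rightarrow> real" where "cas t = cos t + sin t"

text \<open>Differentiation reflects the argument, which is the source of the arguments
  \<open>- x\<close> in derivatives of \<open>H f\<close>.\<close>

lemma cas_derivative: "(cas has_real_derivative cas (- t)) (at t within S)"
  unfolding cas_def by (auto intro!: derivative_eq_intros)

lemma cas_minus: "cas (- t) = cos t - sin t"
  by (simp add: cas_def)

lemma abs_cas_le: "\<bar>cas t\<bar> \<le> 2"
  unfolding cas_def using abs_cos_le_one[of t] abs_sin_le_one[of t] by linarith

lemma cas_continuous [continuous_intros]:
  fixes f :: "real \<Rightarrow> real"
  shows "continuous_on S f \<Longrightarrow> continuous_on S (\<lambda>x. cas (f x))"
  unfolding cas_def by (intro continuous_intros)

lemma cas_measurable [measurable]: "cas \<in> borel_measurable borel"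
  unfolding cas_def by measurable

lemma cas_Lipschitz: "\<bar>cas a - cas b\<bar> \<le> 2 * \<bar>a - b\<bar>"
  using field_differentiable_bound[of UNIV cas "\<lambda>t. cas (- t)" 2 a b] cas_derivative abs_cas_le by auto

lemma cas_Taylor_1: "\<bar>cas (t + s) - cas t - s * cas (- t)\<bar> \<le> 2 * s\<^sup>2"
proof -
  define f where "f r = cas (t + r) - cas t - r * cas (- t)" for r
  have d: "(f has_real_derivative (cas (- t - r) - cas (- t))) (at r within S)" for r S
  proof -
    have "- t - r = - (t + r)" by simp
    then have "cas (- t - r) = cas (- (t + r))" by (simp only:)
    then show ?thesis
      unfolding f_def cas_minus unfolding cas_def by (auto intro!: derivative_eq_intros simp: algebra_simps)
  qed
  have "norm (f s - f 0) \<le> (2 * \<bar>s\<bar>) * norm (s - 0)"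
  proof (rule field_differentiable_bound[of "{-\<bar>s\<bar>..\<bar>s\<bar>}" f "\<lambda>r. cas (- (t + r)) - cas (- t)"])
    show "norm (cas (- (t + z)) - cas (- t)) \<le> 2 * \<bar>s\<bar>" if "z \<in> {- \<bar>s\<bar>..\<bar>s\<bar>}" for z
      using cas_Lipschitz[of "- (t + z)" "- t"] that by auto
  qed (use d in auto)
  then show ?thesis by (simp add: f_def power2_eq_square)
qed

text \<open>A quadratic error estimate survives integration, so this criterion allows
  differentiation under the integral without a limit theorem.\<close>

lemma DERIV_quadratic_bound:
  fixes f :: "real \<Rightarrow> real"
  assumes "\<And>h. \<bar>f (x + h) - f x - h * D\<bar> \<le> C * h\<^sup>2"
  shows "(f has_real_derivative D) (at x)"
  unfolding DERIV_def
proof (rule LIM_zero_cancel, rule Lim_null_comparison)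
  show "\<forall>\<^sub>F h in at 0. norm ((f (x + h) - f x) / h - D) \<le> C * \<bar>h\<bar>"
  proof (rule eventually_at_filter[THEN iffD2], rule always_eventually, intro allI impI)
    fix h :: real assume h: "h \<noteq> 0"
    have "(f (x + h) - f x) / h - D = (f (x + h) - f x - h * D) / h" using h by (simp add: field_simps)
    also have "norm \<dots> \<le> C * h\<^sup>2 / \<bar>h\<bar>"
      using assms[of h] by (simp add: divide_right_mono)
    also have "\<dots> = C * \<bar>h\<bar>" using h by (auto simp: power2_eq_square abs_if)
    finally show "norm ((f (x + h) - f x) / h - D) \<le> C * \<bar>h\<bar>" .
  qed
  show "((\<lambda>h. C * \<bar>h\<bar>) \<longlongrightarrow> 0) (at 0)"
    by (auto intro!: tendsto_eq_intros)
qed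

text \<open>The signs 1, 1, -1, -1 with period 4: the Taylor coefficients of
  \<open>cos + sin\<close> up to the factorial, read off from \<open>exp (i t)\<close>.\<close>

definition cas_coeff :: "nat \<Rightarrow> real" where
  "cas_coeff k = Re (\<i> ^ k) + Im (\<i> ^ k)"

lemma abs_cas_coeff: "\<bar>cas_coeff k\<bar> = 1"
proof -
  have "k mod 4 < 4" by simp
  then consider "k mod 4 = 0" | "k mod 4 = 1" | "k mod 4 = 2" | "k mod 4 = 3" by linarith
  moreover have "\<i> ^ k = \<i> ^ (k mod 4)"
  proof -
    have "\<i> ^ k = \<i> ^ (4 * (k div 4) + k mod 4)" by simp
    also have "\<dots> = (\<i> ^ 4) ^ (k div 4) * \<i> ^ (k mod 4)" by (simp only: power_add power_mult)
    finally show ?thesis by simp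
  qed
  ultimately show ?thesis unfolding cas_coeff_def by cases (simp_all add: power2_eq_square power3_eq_cube)
qed

text \<open>Real plus imaginary part of the Taylor estimate for \<open>exp (i t)\<close>, hence the
  factor 2.\<close>

lemma cas_Taylor: "\<bar>cas t - (\<Sum>k\<le>n. cas_coeff k * t ^ k / fact k)\<bar> \<le> 2 * \<bar>t\<bar> ^ Suc n / fact (Suc n)"
proof -
  define z where "z = iexp t - (\<Sum>k\<le>n. (\<i> * t) ^ k / fact k)"
  have 1: "Re ((\<i> * t) ^ k / fact k) + Im ((\<i> * t) ^ k / fact k) = cas_coeff k * t ^ k / fact k" for k
  proof -
    have ri: "Re (of_real r * w) = r * Re w" "Im (of_real r * w) = r * Im w" for r w by simp_all
    have "(\<i> * t) ^ k / fact k = of_real (t ^ k / fact k) * \<i> ^ k" by (simp add: power_mult_distrib)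
    then have "Re ((\<i> * t) ^ k / fact k) + Im ((\<i> * t) ^ k / fact k)
        = t ^ k / fact k * Re (\<i> ^ k) + t ^ k / fact k * Im (\<i> ^ k)" by (simp only: ri)
    also have "\<dots> = cas_coeff k * t ^ k / fact k"
      unfolding cas_coeff_def by (simp only: ring_distribs add_divide_distrib times_divide_eq_left times_divide_eq_right mult.commute)
    finally show ?thesis .
  qed
  have "iexp t = cis t" by (simp add: cis_conv_exp)
  then have "Re z + Im z = cas t - (\<Sum>k\<le>n. Re ((\<i> * t) ^ k / fact k) + Im ((\<i> * t) ^ k / fact k))"
    unfolding z_def cas_def by (simp only: minus_complex.simps cis.sel Re_sum Im_sum sum.distrib)
  then have "cas t - (\<Sum>k\<le>n. cas_coeff k * t ^ k / fact k) = Re z + Im z" by (simp only: 1)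
  also have "\<bar>\<dots>\<bar> \<le> 2 * cmod z" using abs_Re_le_cmod[of z] abs_Im_le_cmod[of z] by linarith
  also have "cmod z \<le> \<bar>t\<bar> ^ Suc n / fact (Suc n)" unfolding z_def by (rule iexp_approx1)
  finally show ?thesis by simp
qed

context jacobi_weight begin

lemma pair_wmeas_measurable:
  "F \<in> measurable (borel \<Otimes>\<^sub>M borel) N \<Longrightarrow> F \<in> measurable (M \<Otimes>\<^sub>M M) N"
proof -
  have "(\<lambda>p. (fst p, snd p)) \<in> measurable (M \<Otimes>\<^sub>M M) (borel \<Otimes>\<^sub>M borel)"
    by (rule measurable_Pair[OF measurable_compose[OF measurable_fst id_wmeas] measurable_compose[OF measurable_snd id_wmeas]])
  then have "(\<lambda>p. p) \<in> measurable (M \<Otimes>\<^sub>M M) (borel \<Otimes>\<^sub>M borel)"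
    by (simp only: prod.collapse)
  then show "F \<in> measurable (borel \<Otimes>\<^sub>M borel) N \<Longrightarrow> F \<in> measurable (M \<Otimes>\<^sub>M M) N"
    by (rule measurable_compose)
qed

lemma pair_wmeas_integrable:
  fixes F :: "real \<Rightarrow> real \<Rightarrow> real"
  assumes "(\<lambda>(x, y). F x y) \<in> borel_measurable (borel \<Otimes>\<^sub>M borel)"
    and "\<And>x y. x \<in> {-1..1} \<Longrightarrow> y \<in> {-1..1} \<Longrightarrow> \<bar>F x y\<bar> \<le> K"
  shows "integrable (M \<Otimes>\<^sub>M M) (\<lambda>(x, y). F x y)"
  by (rule MMf.integrable_const_bound[where B = K])
    (use assms in \<open>auto simp: space_pair_measure intro!: AE_I2 pair_wmeas_measurable\<close>)

lemma pair_wmeas_Fubini: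
  fixes F :: "real \<Rightarrow> real \<Rightarrow> real"
  assumes "(\<lambda>(x, y). F x y) \<in> borel_measurable (borel \<Otimes>\<^sub>M borel)"
    and "\<And>x y. x \<in> {-1..1} \<Longrightarrow> y \<in> {-1..1} \<Longrightarrow> \<bar>F x y\<bar> \<le> K"
  shows "(LINT x|M. LINT y|M. F x y) = (LINT y|M. LINT x|M. F x y)"
  using MM.Fubini_integral[OF pair_wmeas_integrable[OF assms]] by simp

end

locale hartley = jacobi_weight +
  fixes c :: real
  assumes c_pos: "0 < c"
begin

definition H :: "(real \<Rightarrow> real) \<Rightarrow> real \<Rightarrow> real" where
  "H f x = (LINT y|M. cas (c * x * y) * f y)"

lemma cas_Bd [simp, intro]: "(\<lambda>y. cas (k * y)) \<in> Bd"
  by (intro Bd_cont continuous_intros)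

lemma cas_neg_Bd [simp, intro]: "(\<lambda>y. cas (- (k * y))) \<in> Bd"
  using cas_Bd[of "- k"] by simp

lemma H_eq_ip: "H f x = ip (\<lambda>y. cas (c * x * y)) f"
  by (simp add: H_def ip_def)

lemma H_add: "f \<in> Bd \<Longrightarrow> g \<in> Bd \<Longrightarrow> H (\<lambda>y. f y + g y) x = H f x + H g x"
  by (simp add: H_eq_ip ip_add_right)

lemma H_diff: "f \<in> Bd \<Longrightarrow> g \<in> Bd \<Longrightarrow> H (\<lambda>y. f y - g y) x = H f x - H g x"
  by (simp add: H_eq_ip ip_diff_right)

lemma H_scale: "H (\<lambda>y. k * f y) x = k * H f x"
  by (simp add: H_eq_ip)

lemma H_cong: "(\<And>x. x \<in> {-1..1} \<Longrightarrow> f x = g x) \<Longrightarrow> H f x = H g x"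
  unfolding H_eq_ip by (rule ip_cong) auto

lemma H_null:
  assumes "f \<in> Bd" "ip f f = 0" shows "H f x = 0"
  unfolding H_eq_ip using assms by (subst ip_sym) (rule ip_null_left, auto)

lemma H_reflect: "f \<in> Bd \<Longrightarrow> H (\<lambda>y. f (- y)) x = H f (- x)"
proof -
  assume f: "f \<in> Bd"
  then have "(LINT y|M. (\<lambda>y. cas (c * (- x) * y) * f y) (- y)) = H f (- x)"
    unfolding H_def by (intro integral_wmeas_reflect Bd_mult cas_Bd)
  then show ?thesis by (simp add: H_def)
qed

lemma H_bound:
  assumes "f \<in> Bd" shows "\<bar>H f x\<bar> \<le> 2 * sqrt mass * sqrt (ip f f)"
proof -
  have "\<bar>H f x\<bar> \<le> sqrt (ip (\<lambda>y. cas (c * x * y)) (\<lambda>y. cas (c * x * y))) * sqrt (ip f f)"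
    unfolding H_eq_ip using assms by (intro ip_abs_le) auto
  also have "\<dots> \<le> sqrt (2\<^sup>2 * mass) * sqrt (ip f f)"
    by (intro mult_right_mono real_sqrt_le_mono ip_le_sup) (auto intro: abs_cas_le)
  finally show ?thesis by (simp add: real_sqrt_mult)
qed

lemma H_Lipschitz:
  assumes "f \<in> Bd" shows "\<bar>H f x - H f x'\<bar> \<le> 2 * c * sqrt mass * sqrt (ip f f) * \<bar>x - x'\<bar>"
proof -
  define g where "g = (\<lambda>y. cas (c * x * y) - cas (c * x' * y))"
  have gB: "g \<in> Bd" unfolding g_def by auto
  have "H f x - H f x' = ip g f"
    unfolding H_eq_ip g_def using assms by (simp add: ip_diff_left)
  also have "\<bar>\<dots>\<bar> \<le> sqrt (ip g g) * sqrt (ip f f)" using assms gB by (intro ip_abs_le)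
  also have "\<dots> \<le> sqrt ((2 * c * \<bar>x - x'\<bar>)\<^sup>2 * mass) * sqrt (ip f f)"
  proof (intro mult_right_mono real_sqrt_le_mono ip_le_sup gB)
    fix y :: real assume y: "y \<in> {-1..1}"
    have "\<bar>g y\<bar> \<le> 2 * \<bar>c * x * y - c * x' * y\<bar>" unfolding g_def by (rule cas_Lipschitz)
    also have "\<dots> = 2 * c * \<bar>x - x'\<bar> * \<bar>y\<bar>"
      using c_pos by (simp add: abs_mult flip: right_diff_distrib left_diff_distrib)
    also have "\<dots> \<le> 2 * c * \<bar>x - x'\<bar> * 1" using y c_pos by (intro mult_left_mono) auto
    finally show "\<bar>g y\<bar> \<le> 2 * c * \<bar>x - x'\<bar>" by simp
  qed simp
  finally show ?thesis using c_pos by (simp add: real_sqrt_mult mult_ac abs_mult)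
qed

lemma H_derivative:
  assumes f: "f \<in> Bd"
  shows "(H f has_real_derivative c * H (\<lambda>y. y * f y) (- x)) (at x)"
proof -
  obtain K where K: "0 \<le> K" "\<And>x. x \<in> {-1..1} \<Longrightarrow> \<bar>f x\<bar> \<le> K" using Bd_bound[OF f] by blast
  show ?thesis
  proof (rule DERIV_quadratic_bound)
    fix h
    define r where "r = (\<lambda>y. (cas (c * (x + h) * y) - cas (c * x * y) - (c * h * y) * cas (c * (- x) * y)) * f y)"
    have rB: "r \<in> Bd" unfolding r_def
      by (intro Bd_mult Bd_diff cas_Bd f Bd_id Bd_const)
    have "(LINT y|M. r y) = ip (\<lambda>y. (cas (c * (x + h) * y) - cas (c * x * y)) - (h * c) * (y * cas (c * (- x) * y))) f"
      unfolding ip_def r_def by (simp add: mult_ac)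
    also have "\<dots> = H f (x + h) - H f x - (h * c) * ip (\<lambda>y. y * cas (c * (- x) * y)) f"
      unfolding H_eq_ip using f
      by (simp add: ip_diff_left)
    also have "ip (\<lambda>y. y * cas (c * (- x) * y)) f = H (\<lambda>y. y * f y) (- x)"
      by (simp add: ip_def H_def mult_ac)
    finally have "H f (x + h) - H f x - h * (c * H (\<lambda>y. y * f y) (- x)) = (LINT y|M. r y)" by simp
    also have "\<bar>\<dots>\<bar> \<le> (LINT y|M. 2 * (c * h)\<^sup>2 * K)"
    proof (rule order_trans[OF integral_abs_bound integral_mono])
      fix y assume "y \<in> space M"
      then have y: "y \<in> {-1..1}" by simp
      have "\<bar>cas (c * x * y + c * h * y) - cas (c * x * y) - (c * h * y) * cas (- (c * x * y))\<bar> \<le> 2 * (c * h * y)\<^sup>2"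
        by (rule cas_Taylor_1)
      also have "\<dots> \<le> 2 * (c * h)\<^sup>2 * 1"
        unfolding power_mult_distrib[of _ y] mult.assoc[symmetric]
        using y by (intro mult_left_mono) (auto simp: abs_square_le_1)
      finally have "\<bar>cas (c * (x + h) * y) - cas (c * x * y) - (c * h * y) * cas (c * (- x) * y)\<bar> \<le> 2 * (c * h)\<^sup>2"
        by (simp add: algebra_simps)
      then show "\<bar>r y\<bar> \<le> 2 * (c * h)\<^sup>2 * K"
        unfolding r_def abs_mult using K(2)[OF y] by (intro mult_mono) auto
    qed (use rB in \<open>auto intro!: integrable_abs\<close>)
    also have "\<dots> = (2 * c\<^sup>2 * K * mass) * h\<^sup>2" by (simp add: mass_def power_mult_distrib)
    finally show "\<bar>H f (x + h) - H f x - h * (c * H (\<lambda>y. y * f y) (- x))\<bar> \<le> (2 * c\<^sup>2 * K * mass) * h\<^sup>2" .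
  qed
qed

lemma H_continuous: "f \<in> Bd \<Longrightarrow> continuous_on S (H f)"
  by (meson H_derivative DERIV_continuous continuous_at_imp_continuous_on)

lemma H_Bd [simp, intro]: "f \<in> Bd \<Longrightarrow> H f \<in> Bd"
  by (rule Bd_cont[OF H_continuous])

lemma H_symmetric:
  assumes f: "f \<in> Bd" and g: "g \<in> Bd" shows "ip (H f) g = ip f (H g)"
proof -
  obtain K where K: "0 \<le> K" "\<And>x. x \<in> {-1..1} \<Longrightarrow> \<bar>f x\<bar> \<le> K" using Bd_bound[OF f] by blast
  obtain L where L: "0 \<le> L" "\<And>x. x \<in> {-1..1} \<Longrightarrow> \<bar>g x\<bar> \<le> L" using Bd_bound[OF g] by blast
  note [measurable] = Bd_measurable[OF f] Bd_measurable[OF g]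
  have "ip (H f) g = (LINT x|M. LINT y|M. cas (c * x * y) * f y * g x)"
    by (simp add: ip_def H_def)
  also have "\<dots> = (LINT y|M. LINT x|M. cas (c * x * y) * f y * g x)"
  proof (rule pair_wmeas_Fubini)
    show "\<bar>cas (c * x * y) * f y * g x\<bar> \<le> 2 * K * L" if "x \<in> {-1..1}" "y \<in> {-1..1}" for x y
      unfolding abs_mult using K L that by (intro mult_mono abs_cas_le) auto
  qed measurable
  also have "\<dots> = ip f (H g)"
    unfolding ip_def H_def
    by (intro Bochner_Integration.integral_cong refl)
       (simp add: mult_ac flip: integral_mult_right_zero)
  finally show ?thesis .
qed

text \<open>Expanding the kernel makes the moments of \<open>f\<close> the power series coefficients
  of \<open>H f\<close>. It serves in both directions: for analyticity of \<open>H f\<close>, and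
  for recovering moments from values of \<open>H f\<close> near 0.\<close>

lemma H_Taylor:
  assumes f: "f \<in> Bd"
  shows "\<bar>H f x - (\<Sum>k\<le>n. cas_coeff k * (c * x) ^ k / fact k * ip f (\<lambda>y. y ^ k))\<bar>
    \<le> 2 * (sqrt mass * sqrt (ip f f)) * (\<bar>c * x\<bar> ^ Suc n / fact (Suc n))"
proof -
  define p where "p = (\<lambda>y. \<Sum>k\<le>n. cas_coeff k * (c * x) ^ k / fact k * y ^ k)"
  define r where "r = (\<lambda>y. cas (c * x * y) - p y)"
  define D where "D = 2 * (\<bar>c * x\<bar> ^ Suc n / fact (Suc n))"
  have pB: "p \<in> Bd" unfolding p_def by (intro Bd_sum Bd_cmult Bd_power Bd_id)
  have rB: "r \<in> Bd" unfolding r_def using pB by auto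
  have "ip p f = (\<Sum>k\<le>n. cas_coeff k * (c * x) ^ k / fact k * ip f (\<lambda>y. y ^ k))"
    unfolding p_def using f
    by (subst ip_sum_left, (intro Bd_cmult Bd_power Bd_id | assumption)+)
       (simp only: ip_scale_left ip_sym[of f])
  moreover have "H f x - ip p f = ip r f"
    unfolding H_eq_ip r_def using f pB by (simp add: ip_diff_left)
  moreover have "\<bar>ip r f\<bar> \<le> sqrt (ip r r) * sqrt (ip f f)" by (rule ip_abs_le[OF rB f])
  moreover have "ip r r \<le> D\<^sup>2 * mass"
  proof (rule ip_le_sup[OF rB])
    fix y :: real assume y: "y \<in> {-1..1}"
    have "\<bar>r y\<bar> \<le> 2 * \<bar>c * x * y\<bar> ^ Suc n / fact (Suc n)"
      using cas_Taylor[of "c * x * y" n] unfolding r_def p_def power_mult_distrib[of "c * x" y]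
      by (simp only: mult.assoc times_divide_eq_left)
    also have "\<dots> \<le> 2 * \<bar>c * x\<bar> ^ Suc n / fact (Suc n)"
    proof -
      have "\<bar>c * x * y\<bar> \<le> \<bar>c * x\<bar>" using y unfolding abs_mult[of _ y] by (intro mult_left_le) auto
      then have "\<bar>c * x * y\<bar> ^ Suc n \<le> \<bar>c * x\<bar> ^ Suc n" by (rule power_mono) simp
      then show ?thesis by (intro divide_right_mono mult_left_mono) auto
    qed
    finally show "\<bar>r y\<bar> \<le> D" by (simp add: D_def)
  qed
  then have "sqrt (ip r r) \<le> sqrt (D\<^sup>2 * mass)" by (rule real_sqrt_le_mono)
  then have "sqrt (ip r r) * sqrt (ip f f) \<le> (D * sqrt mass) * sqrt (ip f f)"
    by (intro mult_right_mono) (auto simp: real_sqrt_mult D_def)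
  ultimately have "\<bar>H f x - (\<Sum>k\<le>n. cas_coeff k * (c * x) ^ k / fact k * ip f (\<lambda>y. y ^ k))\<bar> \<le> (D * sqrt mass) * sqrt (ip f f)"
    by linarith
  then show ?thesis by (simp add: D_def mult_ac)
qed

text \<open>The moments are bounded, so the expansion converges for complex arguments and
  \<open>H f\<close> is the restriction of an entire function. Infinitely many zeros in a compact
  interval accumulate, and the identity theorem applies.\<close>

lemma H_zeros:
  assumes f: "f \<in> Bd" and inf: "infinite {x \<in> {-1..1}. H f x = 0}"
  shows "H f x = 0"
proof -
  define D where "D = sqrt mass * sqrt (ip f f)"
  define a where "a k = cas_coeff k * c ^ k / fact k * ip f (\<lambda>y. y ^ k)" for k
  have sums: "(\<lambda>k. a k * x ^ k) sums H f x" for x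
  proof -
    have "(\<lambda>n. (\<Sum>k\<le>n. a k * x ^ k)) \<longlonglongrightarrow> H f x"
    proof (rule LIM_zero_cancel, rule Lim_null_comparison)
      show "\<forall>\<^sub>F n in sequentially. norm ((\<Sum>k\<le>n. a k * x ^ k) - H f x) \<le> 2 * D * (inverse (fact (Suc n)) * \<bar>c * x\<bar> ^ Suc n)"
      proof (rule always_eventually, rule allI)
        fix n
        have "(\<Sum>k\<le>n. a k * x ^ k) = (\<Sum>k\<le>n. cas_coeff k * (c * x) ^ k / fact k * ip f (\<lambda>y. y ^ k))"
          by (intro sum.cong) (auto simp: a_def power_mult_distrib)
        then show "norm ((\<Sum>k\<le>n. a k * x ^ k) - H f x) \<le> 2 * D * (inverse (fact (Suc n)) * \<bar>c * x\<bar> ^ Suc n)"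
          using H_Taylor[OF f, of x n] by (simp add: D_def field_simps abs_minus_commute)
      qed
      have "(\<lambda>n. inverse (fact n) * \<bar>c * x\<bar> ^ n) \<longlonglongrightarrow> 0"
        by (rule summable_LIMSEQ_zero) (rule summable_exp)
      then have "(\<lambda>n. inverse (fact (Suc n)) * \<bar>c * x\<bar> ^ Suc n) \<longlonglongrightarrow> 0" by (rule LIMSEQ_Suc)
      then show "(\<lambda>n. 2 * D * (inverse (fact (Suc n)) * \<bar>c * x\<bar> ^ Suc n)) \<longlonglongrightarrow> 0"
        by (rule tendsto_mult_right_zero)
    qed
    then show ?thesis by (simp add: sums_def_le)
  qed
  have mom: "\<bar>ip f (\<lambda>y. y ^ k)\<bar> \<le> D" for k
  proof -
    have "\<bar>ip f (\<lambda>y. y ^ k)\<bar> \<le> sqrt (ip f f) * sqrt (ip (\<lambda>y. y ^ k) (\<lambda>y. y ^ k))"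
      using f by (intro ip_abs_le) auto
    also have "\<dots> \<le> sqrt (ip f f) * sqrt (1\<^sup>2 * mass)"
    proof (intro mult_left_mono real_sqrt_le_mono ip_le_sup)
      show "\<bar>y ^ k\<bar> \<le> 1" if "y \<in> {-1..1}" for y :: real
        using that by (auto simp: power_abs intro: power_le_one)
    qed auto
    finally show ?thesis by (simp add: D_def mult.commute)
  qed
  define U where "U z = (\<Sum>k. complex_of_real (a k) * z ^ k)" for z
  have summ: "summable (\<lambda>k. complex_of_real (a k) * z ^ k)" for z
  proof (rule summable_comparison_test')
    show "summable (\<lambda>k. D * (inverse (fact k) * (c * cmod z) ^ k))"
      by (intro summable_mult summable_exp)
    show "norm (complex_of_real (a k) * z ^ k) \<le> D * (inverse (fact k) * (c * cmod z) ^ k)" for k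
    proof -
      have "\<bar>a k\<bar> = c ^ k / fact k * \<bar>ip f (\<lambda>y. y ^ k)\<bar>"
        using c_pos by (simp add: a_def abs_mult abs_cas_coeff)
      also have "\<dots> \<le> c ^ k / fact k * (D)" using mom c_pos by (intro mult_left_mono) auto
      finally have "\<bar>a k\<bar> * cmod z ^ k \<le> c ^ k / fact k * (D) * cmod z ^ k" by (rule mult_right_mono) simp
      then show ?thesis by (simp add: norm_mult norm_power power_mult_distrib field_simps)
    qed
  qed
  have "U holomorphic_on ball 0 r" for r
    by (rule power_series_holomorphic[where a = "\<lambda>k. complex_of_real (a k)"])
      (use summ in \<open>auto simp: U_def\<close>)
  then have hol: "U holomorphic_on UNIV"
    unfolding holomorphic_on_def
  proof (intro ballI)
    fix z
    show "U field_differentiable at z"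
      by (rule holomorphic_on_imp_differentiable_at[OF \<open>U holomorphic_on ball 0 (norm z + 1)\<close>]) auto
  qed
  have UH: "U (complex_of_real x) = complex_of_real (H f x)" for x
  proof -
    have "(\<lambda>k. complex_of_real (a k * x ^ k)) sums complex_of_real (H f x)"
      using sums[of x] by (rule sums_of_real)
    then show ?thesis unfolding U_def by (simp add: sums_iff)
  qed
  obtain \<xi> where \<xi>: "\<xi> islimpt complex_of_real ` {x \<in> {-1..1}. H f x = 0}"
  proof -
    have "compact (complex_of_real ` {-1..1})"
      by (intro compact_continuous_image continuous_intros) auto
    moreover have "infinite (complex_of_real ` {x \<in> {-1..1}. H f x = 0})"
      using inf by (subst finite_image_iff) (auto simp: inj_on_def)
    moreover have "complex_of_real ` {x \<in> {-1..1}. H f x = 0} \<subseteq> complex_of_real ` {-1..1}" by blast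
    ultimately show ?thesis
      using that unfolding compact_eq_Bolzano_Weierstrass by metis
  qed
  have "U (complex_of_real x) = 0"
    by (rule analytic_continuation[OF hol _ _ _ _ \<xi>]) (auto simp: UH)
  then show ?thesis by (simp add: UH)
qed

end

section \<open>Extremal eigenvectors and compactness\<close>

context jacobi_weight begin

definition nrm :: "(real \<Rightarrow> real) \<Rightarrow> real" where "nrm f = sqrt (ip f f)"

lemma nrm_nonneg [simp]: "0 \<le> nrm f"
  by (simp add: nrm_def)

lemma nrm_sq: "(nrm f)\<^sup>2 = ip f f"
  by (simp add: nrm_def)

lemma nrm_scale: "nrm (\<lambda>x. k * f x) = \<bar>k\<bar> * nrm f"
  by (simp add: nrm_def real_sqrt_mult flip: mult.assoc)

lemma nrm_triangle: "f \<in> Bd \<Longrightarrow> g \<in> Bd \<Longrightarrow> nrm (\<lambda>x. f x + g x) \<le> nrm f + nrm g"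
  unfolding nrm_def by (rule norm_triangle)

lemma nrm_diff_triangle:
  assumes "f \<in> Bd" "g \<in> Bd" "h \<in> Bd"
  shows "nrm (\<lambda>x. f x - h x) \<le> nrm (\<lambda>x. f x - g x) + nrm (\<lambda>x. g x - h x)"
  using nrm_triangle[of "\<lambda>x. f x - g x" "\<lambda>x. g x - h x"] assms by simp

lemma nrm_diff_commute: "nrm (\<lambda>x. f x - g x) = nrm (\<lambda>x. g x - f x)"
  using nrm_scale[of "-1" "\<lambda>x. f x - g x"] by simp

lemma nrm_cong: "(\<And>x. x \<in> {-1..1} \<Longrightarrow> f x = g x) \<Longrightarrow> nrm f = nrm g"
  unfolding nrm_def using ip_cong[of f g f g] by simp

lemma ip_le_nrm: "f \<in> Bd \<Longrightarrow> g \<in> Bd \<Longrightarrow> \<bar>ip f g\<bar> \<le> nrm f * nrm g"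
  unfolding nrm_def by (rule ip_abs_le)

lemma ip_tendsto:
  assumes "\<And>n. F n \<in> Bd" "g \<in> Bd" "h \<in> Bd" "(\<lambda>n. nrm (\<lambda>x. F n x - g x)) \<longlonglongrightarrow> 0"
  shows "(\<lambda>n. ip (F n) h) \<longlonglongrightarrow> ip g h"
proof (rule LIM_zero_cancel, rule Lim_null_comparison)
  show "\<forall>\<^sub>F n in sequentially. norm (ip (F n) h - ip g h) \<le> nrm (\<lambda>x. F n x - g x) * nrm h"
    using assms ip_le_nrm[of "\<lambda>x. F _ x - g x" h]
    by (intro always_eventually allI) (simp add: ip_diff_left)
  show "(\<lambda>n. nrm (\<lambda>x. F n x - g x) * nrm h) \<longlonglongrightarrow> 0"
    by (rule tendsto_mult_left_zero[OF assms(4)])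
qed

text \<open>A variational existence proof on a space that need not be complete: images of unit
  sequences are only assumed to have subsequences converging within \<open>V\<close>. The
  eigen-equation comes out up to a null function. It is applied to \<open>H\<^sup>2\<close> on an
  orthogonal complement and to \<open>L + 1\<close> on an eigenspace of
  \<open>H\<^sup>2\<close>.\<close>

lemma max_eigenvector:
  assumes VB: "V \<subseteq> Bd"
    and lin: "\<And>f g k. f \<in> V \<Longrightarrow> g \<in> V \<Longrightarrow> (\<lambda>x. f x + k * g x) \<in> V"
    and BV: "\<And>f. f \<in> V \<Longrightarrow> B f \<in> V"
    and Blin: "\<And>f g k x. f \<in> V \<Longrightarrow> g \<in> V \<Longrightarrow> x \<in> {-1..1} \<Longrightarrow> B (\<lambda>x. f x + k * g x) x = B f x + k * B g x"
    and sym: "\<And>f g. f \<in> V \<Longrightarrow> g \<in> V \<Longrightarrow> ip (B f) g = ip f (B g)"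
    and pos: "\<And>f. f \<in> V \<Longrightarrow> 0 \<le> ip (B f) f"
    and bound: "\<And>f. f \<in> V \<Longrightarrow> ip (B f) f \<le> C * ip f f"
    and compact: "\<And>F. (\<And>n. F n \<in> V) \<Longrightarrow> (\<And>n. ip (F n) (F n) = 1) \<Longrightarrow>
      \<exists>g\<in>V. \<exists>r::nat \<Rightarrow> nat. strict_mono r \<and> (\<lambda>n. nrm (\<lambda>x. B (F (r n)) x - g x)) \<longlonglongrightarrow> 0"
    and f0: "f0 \<in> V" "0 < ip (B f0) f0"
  obtains g lam where "g \<in> V" "0 < ip g g" "ip (B f0) f0 \<le> lam * ip f0 f0" "0 < lam"
    "nrm (\<lambda>x. B g x - lam * g x) = 0"
proof -
  have inB: "f \<in> Bd" if "f \<in> V" for f using VB that by auto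
  have scaleV: "(\<lambda>x. s * f x) \<in> V" if "f \<in> V" for f s
  proof -
    have "(\<lambda>x. f x + (s - 1) * f x) \<in> V" by (rule lin[OF that that])
    then show ?thesis by (simp add: algebra_simps)
  qed
  have Bscale: "B (\<lambda>x. s * f x) x = s * B f x" if "f \<in> V" "x \<in> {-1..1}" for f s x
  proof -
    have "B (\<lambda>x. f x + (s - 1) * f x) x = B f x + (s - 1) * B f x" by (rule Blin) (use that in auto)
    then show ?thesis by (simp add: algebra_simps)
  qed
  have form_scale: "ip (B (\<lambda>x. s * f x)) (\<lambda>x. s * f x) = s\<^sup>2 * ip (B f) f" if "f \<in> V" for f s
  proof -
    have "ip (B (\<lambda>x. s * f x)) (\<lambda>x. s * f x) = ip (\<lambda>x. s * B f x) (\<lambda>x. s * f x)"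
      by (rule ip_cong) (use that Bscale in auto)
    then show ?thesis by (simp add: power2_eq_square)
  qed
  define Q where "Q = {ip (B f) f | f. f \<in> V \<and> ip f f = 1}"
  define lam where "lam = Sup Q"
  have "ip f0 f0 \<noteq> 0" using bound[OF f0(1)] f0(2) by auto
  then have n0: "0 < ip f0 f0" using ip_nonneg[of f0] by linarith
  have normalize: "ip (B f) f / ip f f \<in> Q" if "f \<in> V" "0 < ip f f" for f
  proof -
    define s where "s = 1 / sqrt (ip f f)"
    have s2: "s\<^sup>2 = 1 / ip f f" using that by (simp add: s_def power_divide)
    have "ip (\<lambda>x. s * f x) (\<lambda>x. s * f x) = s\<^sup>2 * ip f f" by (simp add: power2_eq_square)
    then have "ip (\<lambda>x. s * f x) (\<lambda>x. s * f x) = 1" using s2 that by simp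
    moreover have "ip (B (\<lambda>x. s * f x)) (\<lambda>x. s * f x) = ip (B f) f / ip f f"
      using form_scale[OF that(1), of s] s2 by simp
    ultimately show ?thesis unfolding Q_def using scaleV[OF that(1), of s] by force
  qed
  have bdd: "bdd_above Q"
    unfolding Q_def bdd_above_def using bound by (intro exI[of _ C]) force
  have le_lam: "ip (B f) f \<le> lam * ip f f" if "f \<in> V" for f
  proof (cases "ip f f = 0")
    case True then show ?thesis using bound[OF that] by simp
  next
    case False
    then have p: "0 < ip f f" using ip_nonneg[of f] by linarith
    have "ip (B f) f / ip f f \<le> lam" unfolding lam_def by (rule cSup_upper[OF normalize[OF that p] bdd])
    then show ?thesis using p by (simp add: field_simps)
  qed
  have lam_pos: "0 < lam" using le_lam[OF f0(1)] f0(2) n0 by (metis less_le_trans zero_less_mult_pos2)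
  \<comment> \<open>The positive form \<open>ip (B f) g\<close> has its own Cauchy--Schwarz
    inequality.\<close>
  have CS: "(ip (B f) g)\<^sup>2 \<le> ip (B f) f * ip (B g) g" if f: "f \<in> V" and g: "g \<in> V" for f g
  proof (rule nonneg_quadratic_discriminant)
    fix t
    have "0 \<le> ip (B (\<lambda>x. f x + t * g x)) (\<lambda>x. f x + t * g x)" by (rule pos[OF lin[OF f g]])
    also have "\<dots> = ip (\<lambda>x. B f x + t * B g x) (\<lambda>x. f x + t * g x)"
      by (rule ip_cong) (use Blin f g in auto)
    also have "\<dots> = ip (B f) f + 2 * t * ip (B f) g + t\<^sup>2 * ip (B g) g"
    proof -
      have "ip (B g) f = ip (B f) g" using sym[OF g f] by (simp add: ip_sym)
      then show ?thesis
        using inB BV f g by (simp add: ip_add_left ip_add_right algebra_simps power2_eq_square)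
    qed
    finally show "0 \<le> ip (B f) f + 2 * t * ip (B f) g + t\<^sup>2 * ip (B g) g" .
  qed (rule pos[OF g])
  \<comment> \<open>The form inequality for \<open>f\<close> and \<open>B f\<close>, together with
    the bound \<open>lam\<close> on the quotient of \<open>B f\<close>.\<close>
  have B_sq: "ip (B f) (B f) \<le> lam * ip (B f) f" if f: "f \<in> V" for f
  proof (cases "ip (B f) (B f) = 0")
    case True then show ?thesis using pos[OF f] lam_pos by simp
  next
    case False
    then have p: "0 < ip (B f) (B f)" using ip_nonneg[of "B f"] by linarith
    have "(ip (B f) (B f))\<^sup>2 \<le> ip (B f) f * ip (B (B f)) (B f)" by (rule CS[OF f BV[OF f]])
    also have "\<dots> \<le> ip (B f) f * (lam * ip (B f) (B f))"
      by (intro mult_left_mono le_lam BV f pos)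
    finally have "ip (B f) (B f) * ip (B f) (B f) \<le> (lam * ip (B f) f) * ip (B f) (B f)"
      by (simp add: power2_eq_square mult_ac)
    then show ?thesis using p by (rule mult_right_le_imp_le)
  qed
  have B_nrm: "nrm (B f) \<le> lam * nrm f" if f: "f \<in> V" for f
  proof -
    have "ip (B f) (B f) \<le> lam * (lam * ip f f)"
      using B_sq[OF f] le_lam[OF f] lam_pos by (meson mult_left_mono less_imp_le order_trans)
    then have "sqrt (ip (B f) (B f)) \<le> sqrt (lam\<^sup>2 * ip f f)" by (simp add: power2_eq_square mult_ac)
    then show ?thesis unfolding nrm_def using lam_pos by (simp add: real_sqrt_mult)
  qed
  have "\<exists>f. f \<in> V \<and> ip f f = 1 \<and> lam - 1 / real (Suc n) < ip (B f) f" for n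
  proof -
    have "Q \<noteq> {}" using normalize[OF f0(1) n0] by auto
    moreover have "lam - 1 / real (Suc n) < Sup Q" by (simp add: lam_def)
    ultimately obtain q where "q \<in> Q" "lam - 1 / real (Suc n) < q"
      using less_cSup_iff[OF _ bdd] by metis
    then show ?thesis unfolding Q_def by blast
  qed
  then obtain F where F: "\<And>n. F n \<in> V" "\<And>n. ip (F n) (F n) = 1"
    "\<And>n. lam - 1 / real (Suc n) < ip (B (F n)) (F n)" by metis
  obtain g r where g: "g \<in> V" and r: "strict_mono (r :: nat \<Rightarrow> nat)"
    and lim: "(\<lambda>n. nrm (\<lambda>x. B (F (r n)) x - g x)) \<longlonglongrightarrow> 0"
    using compact[of F] F by blast
  \<comment> \<open>Almost maximal quotients belong to almost eigenvectors: expanding the square and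
    using \<open>B_sq\<close> leaves \<open>lam\<close> times the distance of the quotient from its
    supremum.\<close>
  have defect: "nrm (\<lambda>x. B (F n) x - lam * F n x) \<le> sqrt (lam * (1 / real (Suc n)))" for n
  proof -
    have "ip (\<lambda>x. B (F n) x - lam * F n x) (\<lambda>x. B (F n) x - lam * F n x)
      = ip (B (F n)) (B (F n)) - 2 * ip (B (F n)) (\<lambda>x. lam * F n x) + ip (\<lambda>x. lam * F n x) (\<lambda>x. lam * F n x)"
      by (rule ip_diff_sq) (use inB BV F(1) in auto)
    also have "\<dots> = ip (B (F n)) (B (F n)) - 2 * lam * ip (B (F n)) (F n) + lam\<^sup>2"
      by (simp add: F(2) power2_eq_square)
    also have "\<dots> \<le> lam * (lam - ip (B (F n)) (F n))"
      using B_sq[OF F(1)[of n]] by (simp add: power2_eq_square algebra_simps)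
    also have "\<dots> \<le> lam * (1 / real (Suc n))" using F(3)[of n] lam_pos by (intro mult_left_mono) auto
    finally show ?thesis unfolding nrm_def by (rule real_sqrt_le_mono)
  qed
  have defect_lim: "(\<lambda>n. nrm (\<lambda>x. B (F (r n)) x - lam * F (r n) x)) \<longlonglongrightarrow> 0"
  proof (rule Lim_null_comparison)
    show "\<forall>\<^sub>F n in sequentially. norm (nrm (\<lambda>x. B (F (r n)) x - lam * F (r n) x)) \<le> sqrt (lam * (1 / real (Suc (r n))))"
      using defect by (intro always_eventually allI) simp
    have "(\<lambda>n. sqrt (lam * (1 / real (Suc n)))) \<longlonglongrightarrow> sqrt (lam * 0)"
      by (intro tendsto_intros LIMSEQ_Suc lim_1_over_n)
    then show "(\<lambda>n. sqrt (lam * (1 / real (Suc (r n))))) \<longlonglongrightarrow> 0"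
      using LIMSEQ_subseq_LIMSEQ[OF _ r] by (force simp: o_def)
  qed
  \<comment> \<open>Along the subsequence \<open>B (F (r n))\<close> tends to \<open>g\<close> and
    differs from \<open>lam * F (r n)\<close> by a null sequence.\<close>
  have conv: "(\<lambda>n. nrm (\<lambda>x. lam * F (r n) x - g x)) \<longlonglongrightarrow> 0"
  proof (rule Lim_null_comparison)
    show "\<forall>\<^sub>F n in sequentially. norm (nrm (\<lambda>x. lam * F (r n) x - g x))
      \<le> nrm (\<lambda>x. B (F (r n)) x - lam * F (r n) x) + nrm (\<lambda>x. B (F (r n)) x - g x)"
    proof (intro always_eventually allI)
      fix n
      show "norm (nrm (\<lambda>x. lam * F (r n) x - g x))
        \<le> nrm (\<lambda>x. B (F (r n)) x - lam * F (r n) x) + nrm (\<lambda>x. B (F (r n)) x - g x)"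
        using nrm_diff_triangle[of "\<lambda>x. lam * F (r n) x" "B (F (r n))" g] inB BV F(1) g
        by (simp add: nrm_diff_commute[of "B (F (r n))"])
    qed
    show "(\<lambda>n. nrm (\<lambda>x. B (F (r n)) x - lam * F (r n) x) + nrm (\<lambda>x. B (F (r n)) x - g x)) \<longlonglongrightarrow> 0"
      using tendsto_add[OF defect_lim lim] by simp
  qed
  have "nrm (\<lambda>x. B g x - lam * g x) = 0"
  proof -
    have "nrm (\<lambda>x. B g x - lam * g x) \<le> lam * nrm (\<lambda>x. lam * F (r n) x - g x) + lam * nrm (\<lambda>x. B (F (r n)) x - g x)" for n
    proof -
      have v: "(\<lambda>x. g x + (- lam) * F (r n) x) \<in> V" by (rule lin[OF g F(1)])
      have "nrm (\<lambda>x. B g x - lam * B (F (r n)) x) = nrm (B (\<lambda>x. g x + (- lam) * F (r n) x))"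
      proof (rule nrm_cong)
        fix x :: real assume "x \<in> {-1..1}"
        from Blin[OF g F(1) this] have "B (\<lambda>x. g x + (- lam) * F (r n) x) x = B g x + (- lam) * B (F (r n)) x" .
        then show "B g x - lam * B (F (r n)) x = B (\<lambda>x. g x + (- lam) * F (r n) x) x" by simp
      qed
      also have "\<dots> \<le> lam * nrm (\<lambda>x. g x + (- lam) * F (r n) x)" by (rule B_nrm[OF v])
      finally have 1: "nrm (\<lambda>x. B g x - lam * B (F (r n)) x) \<le> lam * nrm (\<lambda>x. lam * F (r n) x - g x)"
        by (simp add: nrm_diff_commute[of g])
      have 2: "nrm (\<lambda>x. lam * B (F (r n)) x - lam * g x) = lam * nrm (\<lambda>x. B (F (r n)) x - g x)"
        using nrm_scale[of lam "\<lambda>x. B (F (r n)) x - g x"] lam_pos by (simp add: right_diff_distrib)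
      show ?thesis
        using nrm_diff_triangle[of "B g" "\<lambda>x. lam * B (F (r n)) x" "\<lambda>x. lam * g x"] 1 2 inB BV F(1) g
        by simp
    qed
    moreover have "(\<lambda>n. lam * nrm (\<lambda>x. lam * F (r n) x - g x) + lam * nrm (\<lambda>x. B (F (r n)) x - g x)) \<longlonglongrightarrow> 0"
      using tendsto_add[OF tendsto_mult_right_zero[OF conv, of lam] tendsto_mult_right_zero[OF lim, of lam]] by simp
    ultimately have "nrm (\<lambda>x. B g x - lam * g x) \<le> 0"
      by (intro LIMSEQ_le_const) auto
    then show ?thesis using nrm_nonneg[of "\<lambda>x. B g x - lam * g x"] by linarith
  qed
  \<comment> \<open>Otherwise the vectors \<open>lam * F (r n)\<close>, all of norm
    \<open>lam > 0\<close>, would tend to a null vector.\<close>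
  moreover have "0 < ip g g"
  proof (rule ccontr)
    assume "\<not> 0 < ip g g"
    then have g0: "nrm g = 0" using ip_nonneg[of g] by (simp add: nrm_def)
    have "lam \<le> nrm (\<lambda>x. lam * F (r n) x - g x)" for n
    proof -
      have "nrm (\<lambda>x. lam * F (r n) x) = lam"
        using nrm_scale[of lam "F (r n)"] lam_pos by (simp add: nrm_def F(2))
      then show ?thesis
        using nrm_triangle[of "\<lambda>x. lam * F (r n) x - g x" g] inB F(1) g g0 by simp
    qed
    then have "lam \<le> 0" using conv by (intro LIMSEQ_le_const) auto
    then show False using lam_pos by simp
  qed
  ultimately show ?thesis using that[OF g] le_lam[OF f0(1)] lam_pos by blast
qed

end

context hartley begin

lemma H_pointwise_bound: "f \<in> Bd \<Longrightarrow> \<bar>H f x\<bar> \<le> 2 * sqrt mass * nrm f"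
  unfolding nrm_def by (rule H_bound)

lemma nrm_H_le:
  assumes "f \<in> Bd" shows "nrm (H f) \<le> 2 * mass * nrm f"
proof -
  have "ip (H f) (H f) \<le> (2 * sqrt mass * nrm f)\<^sup>2 * mass"
    by (rule ip_le_sup) (use assms H_pointwise_bound in auto)
  also have "\<dots> = (2 * mass * nrm f)\<^sup>2"
    using mass_nonneg by (simp add: power_mult_distrib power2_eq_square)
  finally have "sqrt (ip (H f) (H f)) \<le> sqrt ((2 * mass * nrm f)\<^sup>2)" by (rule real_sqrt_le_mono)
  then show ?thesis unfolding nrm_def[of "H f"] using mass_nonneg by simp
qed

lemma H_pointwise_tendsto:
  assumes "\<And>n. F n \<in> Bd" "g \<in> Bd" "(\<lambda>n. nrm (\<lambda>x. F n x - g x)) \<longlonglongrightarrow> 0"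
  shows "(\<lambda>n. H (F n) x) \<longlonglongrightarrow> H g x"
  unfolding H_eq_ip ip_sym[of "\<lambda>y. cas (c * x * y)"] using assms by (intro ip_tendsto) auto

lemma nrm_H_tendsto:
  assumes "\<And>n. F n \<in> Bd" "g \<in> Bd" "(\<lambda>n. nrm (\<lambda>x. F n x - g x)) \<longlonglongrightarrow> 0"
  shows "(\<lambda>n. nrm (\<lambda>x. H (F n) x - H g x)) \<longlonglongrightarrow> 0"
proof (rule Lim_null_comparison)
  show "\<forall>\<^sub>F n in sequentially. norm (nrm (\<lambda>x. H (F n) x - H g x)) \<le> 2 * mass * nrm (\<lambda>x. F n x - g x)"
  proof (intro always_eventually allI)
    fix n
    have "(\<lambda>x. H (F n) x - H g x) = H (\<lambda>x. F n x - g x)" using assms by (intro ext) (simp add: H_diff)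
    then show "norm (nrm (\<lambda>x. H (F n) x - H g x)) \<le> 2 * mass * nrm (\<lambda>x. F n x - g x)"
      using nrm_H_le[of "\<lambda>x. F n x - g x"] assms by simp
  qed
  show "(\<lambda>n. 2 * mass * nrm (\<lambda>x. F n x - g x)) \<longlonglongrightarrow> 0"
    by (rule tendsto_mult_right_zero[OF assms(3)])
qed

text \<open>The images of a bounded sequence are uniformly bounded and share a Lipschitz constant.
  Arzela--Ascoli gives uniform convergence along a subsequence, hence convergence in norm as the
  measure is finite.\<close>

lemma H_compact:
  assumes F: "\<And>n. F n \<in> Bd" and b: "\<And>n. nrm (F n) \<le> K"
  obtains h r where "h \<in> Bd" "strict_mono (r :: nat \<Rightarrow> nat)" "(\<lambda>n. nrm (\<lambda>x. H (F (r n)) x - h x)) \<longlonglongrightarrow> 0"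
proof -
  have K: "0 \<le> K" using b[of 0] nrm_nonneg[of "F 0"] by linarith
  \<comment> \<open>The added 1 makes \<open>L\<close> positive, so that \<open>e / L\<close> is a
    valid modulus of continuity.\<close>
  define L where "L = 2 * c * sqrt mass * K + 1"
  have L: "0 < L" unfolding L_def using c_pos mass_nonneg K by (intro add_nonneg_pos mult_nonneg_nonneg) auto
  have lip: "\<bar>H (F n) x - H (F n) y\<bar> \<le> L * \<bar>x - y\<bar>" for n x y
  proof -
    have "\<bar>H (F n) x - H (F n) y\<bar> \<le> 2 * c * sqrt mass * nrm (F n) * \<bar>x - y\<bar>"
      using H_Lipschitz[OF F] by (simp add: nrm_def)
    also have "\<dots> \<le> L * \<bar>x - y\<bar>"
    proof (rule mult_right_mono)
      have "2 * c * sqrt mass * nrm (F n) \<le> 2 * c * sqrt mass * K"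
        using c_pos mass_nonneg b by (intro mult_left_mono) auto
      then show "2 * c * sqrt mass * nrm (F n) \<le> L" by (simp add: L_def)
    qed simp
    finally show ?thesis .
  qed
  obtain g k where g: "continuous_on {-1..1} g" and k: "strict_mono (k :: nat \<Rightarrow> nat)"
    and u: "\<And>e. 0 < e \<Longrightarrow> \<exists>N. \<forall>n x. n \<ge> N \<and> x \<in> {-1..1} \<longrightarrow> norm (H (F (k n)) x - g x) < e"
  proof (rule Arzela_Ascoli[of "{-1..1::real}" "\<lambda>n. H (F n)" "2 * sqrt mass * K"])
    show "norm (H (F n) x) \<le> 2 * sqrt mass * K" for n x
    proof -
      have "\<bar>H (F n) x\<bar> \<le> 2 * sqrt mass * nrm (F n)" by (rule H_pointwise_bound[OF F])
      also have "\<dots> \<le> 2 * sqrt mass * K" using mass_nonneg b by (intro mult_left_mono) auto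
      finally show ?thesis by simp
    qed
    show "\<exists>d>0. \<forall>n y. y \<in> {-1..1} \<and> norm (x - y) < d \<longrightarrow> norm (H (F n) x - H (F n) y) < e" if "0 < e" for x e
    proof (intro exI[of _ "e / L"] conjI allI impI)
      show "0 < e / L" using that L by simp
      fix n y assume "y \<in> {-1..1} \<and> norm (x - y) < e / L"
      then have "L * \<bar>x - y\<bar> < e" using L by (simp add: field_simps)
      then show "norm (H (F n) x - H (F n) y) < e" using lip[of n x y] by simp
    qed
  qed auto
  \<comment> \<open>The limit is known on [-1, 1] only; clamping the argument extends it
    continuously, since \<open>Bd\<close> asks for measurability on the line.\<close>
  define h where "h x = g (max (-1) (min 1 x))" for x
  have "continuous_on UNIV (\<lambda>x::real. max (-1) (min 1 x))" by (intro continuous_intros)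
  then have "continuous_on UNIV h"
    unfolding h_def by (intro continuous_on_compose2[OF g]) auto
  then have hB: "h \<in> Bd" by (rule Bd_cont)
  have hg: "h x = g x" if "x \<in> {-1..1}" for x using that by (simp add: h_def)
  have "(\<lambda>n. nrm (\<lambda>x. H (F (k n)) x - h x)) \<longlonglongrightarrow> 0"
  proof (rule LIMSEQ_I)
    fix e :: real assume e: "0 < e"
    define d where "d = e / (sqrt mass + 1)"
    have sm: "0 < sqrt mass + 1" using mass_nonneg by (simp add: add_nonneg_pos)
    have d: "0 < d" using e sm by (simp add: d_def)
    obtain N where N: "\<And>n x. n \<ge> N \<Longrightarrow> x \<in> {-1..1} \<Longrightarrow> norm (H (F (k n)) x - g x) < d" using u[OF d] by blast
    have "norm (nrm (\<lambda>x. H (F (k n)) x - h x) - 0) < e" if n: "n \<ge> N" for n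
    proof -
      have "ip (\<lambda>x. H (F (k n)) x - h x) (\<lambda>x. H (F (k n)) x - h x) \<le> d\<^sup>2 * mass"
        by (rule ip_le_sup) (use F hB N[OF n] hg in \<open>auto intro: less_imp_le\<close>)
      then have "nrm (\<lambda>x. H (F (k n)) x - h x) \<le> sqrt (d\<^sup>2 * mass)" unfolding nrm_def by (rule real_sqrt_le_mono)
      also have "\<dots> = d * sqrt mass" using d by (simp add: real_sqrt_mult)
      also have "\<dots> < d * (sqrt mass + 1)" using d by simp
      also have "\<dots> = e" using sm by (simp add: d_def)
      finally show ?thesis by simp
    qed
    then show "\<exists>N. \<forall>n\<ge>N. norm (nrm (\<lambda>x. H (F (k n)) x - h x) - 0) < e" by blast
  qed
  then show ?thesis using that[OF hB k] by blast
qed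

end

section \<open>The commuting differential operator\<close>

text \<open>\<open>deriv\<close> is a choice operator, so differentiability is stated
  explicitly.\<close>

definition C2 :: "(real \<Rightarrow> real) set" where
  "C2 = {u. (\<forall>x. (u has_real_derivative deriv u x) (at x)) \<and>
     (\<forall>x. (deriv u has_real_derivative deriv (deriv u) x) (at x)) \<and> continuous_on UNIV (deriv (deriv u))}"

lemma C2I:
  assumes "\<And>x. (u has_real_derivative u1 x) (at x)" "\<And>x. (u1 has_real_derivative u2 x) (at x)"
    "continuous_on UNIV u2"
  shows "u \<in> C2" "deriv u = u1" "deriv (deriv u) = u2"
proof -
  show 1: "deriv u = u1" using assms(1) by (intro ext DERIV_imp_deriv)
  show 2: "deriv (deriv u) = u2" unfolding 1 using assms(2) by (intro ext DERIV_imp_deriv)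
  show "u \<in> C2" unfolding C2_def mem_Collect_eq 1 2[unfolded 1] using assms by blast
qed

lemma C2_deriv:
  assumes "u \<in> C2"
  shows "(u has_real_derivative deriv u x) (at x within S)"
    "(deriv u has_real_derivative deriv (deriv u) x) (at x within S)"
  using assms has_field_derivative_at_within unfolding C2_def by blast+

lemma C2_cont:
  assumes "u \<in> C2"
  shows "continuous_on S u" "continuous_on S (deriv u)" "continuous_on S (deriv (deriv u))"
  using assms C2_deriv[OF assms] DERIV_continuous_on continuous_on_subset[of UNIV _ S]
  unfolding C2_def by blast+

lemma C2_Bd [simp, intro]:
  assumes "u \<in> C2" shows "u \<in> Bd" "deriv u \<in> Bd" "deriv (deriv u) \<in> Bd"
  using C2_cont[OF assms, of UNIV] by (auto intro: Bd_cont)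

lemma square_less_1: "x \<in> {-1<..<1} \<Longrightarrow> x\<^sup>2 < (1::real)"
  by (auto simp: abs_square_less_1)

context hartley begin

text \<open>The coefficient of the Sturm--Liouville form
  \<open>\<omega> L f = - (p f')' + c\<^sup>2 x\<^sup>2 \<omega> f\<close>. Its vanishing at both
  ends removes the boundary terms there.\<close>

definition p :: "real \<Rightarrow> real" where "p x = (1 - x\<^sup>2) powr (\<alpha> + 1)"

lemma p_boundary [simp]: "p 1 = 0" "p (-1) = 0"
  by (simp_all add: p_def)

lemma p_pos: "x \<in> {-1<..<1} \<Longrightarrow> 0 < p x"
  unfolding p_def using abs_square_less_1[of x] by (auto simp: abs_less_iff)

lemma p_nonneg: "0 \<le> p x"
  by (simp add: p_def)

lemma p_eq: "x \<in> {-1..1} \<Longrightarrow> p x = (1 - x\<^sup>2) * \<omega> x"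
proof -
  assume "x \<in> {-1..1}"
  then have "0 \<le> 1 - x\<^sup>2" by (auto simp: abs_square_le_1)
  then show ?thesis by (simp add: p_def omega_w_def powr_add)
qed

lemma p_derivative:
  assumes "x \<in> {-1<..<1}" shows "(p has_real_derivative (- 2 * (\<alpha> + 1) * x * \<omega> x)) (at x)"
proof -
  have x: "0 < 1 - x\<^sup>2" using square_less_1[OF assms] by simp
  have "(p has_real_derivative ((1 - x\<^sup>2) powr (\<alpha> + 1) * (0 * ln (1 - x\<^sup>2) + (- 2 * x) * (\<alpha> + 1) / (1 - x\<^sup>2)))) (at x)"
    unfolding p_def[abs_def] using x
    by (intro DERIV_powr) (auto intro!: derivative_eq_intros)
  moreover have "(1 - x\<^sup>2) powr (\<alpha> + 1) * (0 * ln (1 - x\<^sup>2) + (- 2 * x) * (\<alpha> + 1) / (1 - x\<^sup>2)) = - 2 * (\<alpha> + 1) * x * \<omega> x"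
    using x by (simp add: omega_w_def powr_add) (simp add: algebra_simps)
  ultimately show ?thesis by simp
qed

lemma p_continuous: "continuous_on {-1..1} p"
  unfolding p_def[abs_def] using alpha_pos
  by (intro continuous_on_powr' continuous_intros) (auto simp: abs_square_le_1)

definition Lop :: "(real \<Rightarrow> real) \<Rightarrow> real \<Rightarrow> real" where
  "Lop f x = - (1 - x\<^sup>2) * deriv (deriv f) x + 2 * (\<alpha> + 1) * x * deriv f x + c\<^sup>2 * x\<^sup>2 * f x"

lemma Lop_continuous: "f \<in> C2 \<Longrightarrow> continuous_on S (Lop f)"
  unfolding Lop_def[abs_def] by (intro continuous_intros C2_cont)

lemma Lop_Bd [simp, intro]: "f \<in> C2 \<Longrightarrow> Lop f \<in> Bd"
  by (rule Bd_cont[OF Lop_continuous])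

definition wronskian :: "(real \<Rightarrow> real) \<Rightarrow> (real \<Rightarrow> real) \<Rightarrow> real \<Rightarrow> real" where
  "wronskian u v x = u x * deriv v x - deriv u x * v x"

lemma wronskian_continuous: "u \<in> C2 \<Longrightarrow> v \<in> C2 \<Longrightarrow> continuous_on S (wronskian u v)"
  unfolding wronskian_def[abs_def] by (intro continuous_intros C2_cont)

text \<open>Lagrange's identity: \<open>p'\<close> supplies exactly the first-order terms of
  \<open>L\<close>, and the potential cancels.\<close>

lemma wronskian_derivative:
  assumes u: "u \<in> C2" and v: "v \<in> C2" and x: "x \<in> {-1<..<1}"
  shows "((\<lambda>x. p x * wronskian u v x) has_real_derivative (Lop u x * v x - u x * Lop v x) * \<omega> x) (at x)"
proof -
  have "((\<lambda>x. p x * wronskian u v x) has_real_derivative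
      (- 2 * (\<alpha> + 1) * x * \<omega> x) * (u x * deriv v x - deriv u x * v x)
      + (u x * deriv (deriv v) x - deriv (deriv u) x * v x) * p x) (at x)"
    unfolding wronskian_def
    by (rule DERIV_mult'[OF p_derivative[OF x], THEN DERIV_cong])
       (auto intro!: derivative_eq_intros C2_deriv u v simp: algebra_simps)
  moreover have "(- 2 * (\<alpha> + 1) * x * \<omega> x) * (u x * deriv v x - deriv u x * v x)
      + (u x * deriv (deriv v) x - deriv (deriv u) x * v x) * p x
      = (Lop u x * v x - u x * Lop v x) * \<omega> x"
  proof -
    have px: "p x = (1 - x\<^sup>2) * \<omega> x" using x p_eq[of x] by auto
    show ?thesis unfolding Lop_def px by (simp add: algebra_simps)
  qed
  ultimately show ?thesis by simp
qed

text \<open>The boundary term at 1 vanishes with \<open>p\<close>, so only the one at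
  \<open>a\<close> survives. An interior \<open>a\<close> is what ties integrals over
  \<open>[a, 1]\<close> to the Wronskian at a point.\<close>

lemma Green:
  assumes u: "u \<in> C2" and v: "v \<in> C2" and a: "a \<in> {-1..1}"
  shows "(LINT x|M. (Lop u x * v x - u x * Lop v x) * indicator {a..} x) = - (p a * wronskian u v a)"
proof -
  have "(LINT x|M. (Lop u x * v x - u x * Lop v x) * indicator {a..} x)
    = p 1 * wronskian u v 1 - p a * wronskian u v a"
  proof (rule integral_wmeas_cutoff_FTC[OF a])
    show "continuous_on {a..1} (\<lambda>x. p x * wronskian u v x)"
      using u v a by (intro continuous_intros wronskian_continuous continuous_on_subset[OF p_continuous]) auto
  qed (use u v a wronskian_derivative in auto)
  then show ?thesis by simp
qed

lemma Lop_symmetric: "u \<in> C2 \<Longrightarrow> v \<in> C2 \<Longrightarrow> ip (Lop u) v = ip u (Lop v)"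
proof -
  assume u: "u \<in> C2" and v: "v \<in> C2"
  have "ip (Lop u) v - ip u (Lop v) = (LINT x|M. Lop u x * v x - u x * Lop v x)"
    unfolding ip_def using u v by (subst Bochner_Integration.integral_diff) auto
  also have "\<dots> = (LINT x|M. (Lop u x * v x - u x * Lop v x) * indicator {-1..} x)"
    by (intro Bochner_Integration.integral_cong) auto
  also have "\<dots> = 0" using Green[OF u v, of "-1"] by simp
  finally show ?thesis by simp
qed

text \<open>Integrating the derivative of \<open>p u' u\<close> turns the left side into the energy,
  the integral of \<open>((1 - x\<^sup>2) u'\<^sup>2 + c\<^sup>2 x\<^sup>2 u\<^sup>2)
  \<omega>\<close>.\<close>

lemma Lop_nonneg:
  assumes u: "u \<in> C2" shows "0 \<le> ip (Lop u) u"
proof -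
  define e where "e x = (1 - x\<^sup>2) * (deriv u x)\<^sup>2 + c\<^sup>2 * x\<^sup>2 * (u x)\<^sup>2" for x
  have eB: "e \<in> Bd" unfolding e_def[abs_def] using u by (intro Bd_cont continuous_intros C2_cont)
  have "(LINT x|M. e x - Lop u x * u x) = p 1 * (deriv u 1 * u 1) - p (-1) * (deriv u (-1) * u (-1))"
  proof (rule integral_wmeas_FTC)
    show "continuous_on {-1..1} (\<lambda>x. p x * (deriv u x * u x))"
      using u by (intro continuous_intros p_continuous C2_cont)
    fix x :: real assume x: "x \<in> {-1<..<1}"
    have "((\<lambda>x. p x * (deriv u x * u x)) has_real_derivative
        (- 2 * (\<alpha> + 1) * x * \<omega> x) * (deriv u x * u x)
        + (deriv (deriv u) x * u x + deriv u x * deriv u x) * p x) (at x)"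
      by (rule DERIV_mult'[OF p_derivative[OF x], THEN DERIV_cong])
         (auto intro!: derivative_eq_intros C2_deriv u simp: algebra_simps)
    moreover have "(- 2 * (\<alpha> + 1) * x * \<omega> x) * (deriv u x * u x)
        + (deriv (deriv u) x * u x + deriv u x * deriv u x) * p x = (e x - Lop u x * u x) * \<omega> x"
    proof -
      have px: "p x = (1 - x\<^sup>2) * \<omega> x" using x p_eq[of x] by auto
      show ?thesis unfolding e_def Lop_def px by (simp add: algebra_simps power2_eq_square)
    qed
    ultimately show "((\<lambda>x. p x * (deriv u x * u x)) has_real_derivative (e x - Lop u x * u x) * \<omega> x) (at x)" by simp
  qed (use u eB in auto)
  then have "ip (Lop u) u = (LINT x|M. e x)"
    unfolding ip_def using u eB by (subst (asm) Bochner_Integration.integral_diff) auto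
  also have "0 \<le> \<dots>"
  proof (rule integral_nonneg_AE, rule AE_I2)
    fix x assume "x \<in> space M"
    then have "x\<^sup>2 \<le> 1" by (auto simp: abs_square_le_1)
    then show "0 \<le> e x" by (simp add: e_def)
  qed
  finally show ?thesis .
qed

lemma H_C2:
  assumes g: "g \<in> Bd"
  shows "H g \<in> C2" "deriv (H g) = (\<lambda>x. c * H (\<lambda>y. y * g y) (- x))"
    "deriv (deriv (H g)) = (\<lambda>x. - (c\<^sup>2) * H (\<lambda>y. y * (y * g y)) x)"
proof -
  have 1: "(H g has_real_derivative c * H (\<lambda>y. y * g y) (- x)) (at x)" for x
    by (rule H_derivative[OF g])
  have 2: "((\<lambda>x. c * H (\<lambda>y. y * g y) (- x)) has_real_derivative - (c\<^sup>2) * H (\<lambda>y. y * (y * g y)) x) (at x)" for x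
  proof -
    have "(H (\<lambda>y. y * g y) has_real_derivative c * H (\<lambda>y. y * (y * g y)) x) (at (- x))"
      using H_derivative[of "\<lambda>y. y * g y" "- x"] g by auto
    then have "((\<lambda>x. H (\<lambda>y. y * g y) (- x)) has_real_derivative - (c * H (\<lambda>y. y * (y * g y)) x)) (at x)"
      by (simp add: DERIV_mirror)
    then show ?thesis
      by (rule DERIV_cmult[of _ _ _ _ c, THEN DERIV_cong]) (simp add: power2_eq_square)
  qed
  have 3: "continuous_on UNIV (\<lambda>x. - (c\<^sup>2) * H (\<lambda>y. y * (y * g y)) x)"
    using g by (intro continuous_intros H_continuous) auto
  show "H g \<in> C2" "deriv (H g) = (\<lambda>x. c * H (\<lambda>y. y * g y) (- x))"
    "deriv (deriv (H g)) = (\<lambda>x. - (c\<^sup>2) * H (\<lambda>y. y * (y * g y)) x)"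
    using C2I[OF 1 2 3] by auto
qed

lemma Lop_H:
  assumes g: "g \<in> Bd"
  shows "Lop (H g) x = c\<^sup>2 * (1 - x\<^sup>2) * H (\<lambda>y. y * (y * g y)) x
    + 2 * (\<alpha> + 1) * x * c * H (\<lambda>y. y * g y) (- x) + c\<^sup>2 * x\<^sup>2 * H g x"
  unfolding Lop_def H_C2(3)[OF g] unfolding H_C2(2)[OF g] by (simp add: algebra_simps)

text \<open>\<open>L\<close> is a differential operator, yet \<open>L\<close> after \<open>H\<close>
  is bounded: differentiating \<open>H g\<close> only multiplies \<open>g\<close> by
  \<open>c y\<close>, up to a reflection. On an eigenspace of \<open>H\<^sup>2\<close> this bounds
  \<open>L\<close> itself.\<close>

lemma nrm_Lop_H:
  obtains K where "0 \<le> K" "\<And>g. g \<in> Bd \<Longrightarrow> nrm (Lop (H g)) \<le> K * nrm g"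
proof -
  define K where "K = 2 * sqrt mass * (c\<^sup>2 + 2 * (\<alpha> + 1) * c + c\<^sup>2)"
  have K: "0 \<le> K" unfolding K_def using mass_nonneg alpha_pos c_pos
    by (intro mult_nonneg_nonneg add_nonneg_nonneg) auto
  have "nrm (Lop (H g)) \<le> (K * sqrt mass) * nrm g" if g: "g \<in> Bd" for g
  proof -
    have m: "nrm (\<lambda>y. y * f y) \<le> nrm f" if "f \<in> Bd" for f
      unfolding nrm_def
    proof (rule real_sqrt_le_mono, rule ip_mono)
      fix x :: real assume "x \<in> {-1..1}"
      then show "\<bar>x * f x\<bar> \<le> \<bar>f x\<bar>" unfolding abs_mult by (intro mult_left_le_one_le) auto
    qed (use that in auto)
    have B: "\<bar>H f x\<bar> \<le> 2 * sqrt mass * nrm g" if "f \<in> Bd" "nrm f \<le> nrm g" for f x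
      using H_pointwise_bound[OF that(1), of x] mult_left_mono[OF that(2), of "2 * sqrt mass"] mass_nonneg by simp
    have g1: "(\<lambda>y. y * g y) \<in> Bd" and g2: "(\<lambda>y. y * (y * g y)) \<in> Bd" using g by auto
    have n1: "nrm (\<lambda>y. y * g y) \<le> nrm g" using m[OF g] .
    have n2: "nrm (\<lambda>y. y * (y * g y)) \<le> nrm g" using m[OF g1] n1 by linarith
    have pt: "\<bar>Lop (H g) x\<bar> \<le> K * nrm g" if x: "x \<in> {-1..1}" for x
    proof -
      have x2: "x\<^sup>2 \<le> 1" using x by (auto simp: abs_square_le_1)
      define b where "b = 2 * sqrt mass * nrm g"
      have b: "0 \<le> b" unfolding b_def using mass_nonneg by simp
      have "\<bar>c\<^sup>2 * (1 - x\<^sup>2) * H (\<lambda>y. y * (y * g y)) x\<bar> \<le> c\<^sup>2 * b"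
        unfolding abs_mult
      proof (intro mult_mono)
        show "\<bar>c\<^sup>2\<bar> * \<bar>1 - x\<^sup>2\<bar> \<le> c\<^sup>2" using x2 by (simp add: mult_left_le)
      qed (use B[OF g2 n2] b in \<open>auto simp: b_def\<close>)
      moreover have "\<bar>2 * (\<alpha> + 1) * x * c * H (\<lambda>y. y * g y) (- x)\<bar> \<le> 2 * (\<alpha> + 1) * c * b"
      proof -
        have "\<bar>x\<bar> * \<bar>H (\<lambda>y. y * g y) (- x)\<bar> \<le> 1 * b"
          using x B[OF g1 n1] by (intro mult_mono) (auto simp: b_def)
        then have "2 * (\<alpha> + 1) * c * (\<bar>x\<bar> * \<bar>H (\<lambda>y. y * g y) (- x)\<bar>) \<le> 2 * (\<alpha> + 1) * c * (1 * b)"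
          using alpha_pos c_pos by (intro mult_left_mono) auto
        then show ?thesis using alpha_pos c_pos by (simp add: abs_mult mult_ac)
      qed
      moreover have "\<bar>c\<^sup>2 * x\<^sup>2 * H g x\<bar> \<le> c\<^sup>2 * b"
        unfolding abs_mult
      proof (intro mult_mono)
        show "\<bar>c\<^sup>2\<bar> * \<bar>x\<^sup>2\<bar> \<le> c\<^sup>2" using x2 by (simp add: mult_left_le)
      qed (use B[OF g order_refl] b in \<open>auto simp: b_def\<close>)
      ultimately have "\<bar>Lop (H g) x\<bar> \<le> c\<^sup>2 * b + 2 * (\<alpha> + 1) * c * b + c\<^sup>2 * b"
        unfolding Lop_H[OF g] by linarith
      also have "\<dots> = K * nrm g" by (simp add: K_def b_def algebra_simps)
      finally show ?thesis .
    qed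
    have "ip (Lop (H g)) (Lop (H g)) \<le> (K * nrm g)\<^sup>2 * mass"
      by (rule ip_le_sup) (use pt H_C2[OF g] in auto)
    then have "nrm (Lop (H g)) \<le> sqrt ((K * nrm g)\<^sup>2 * mass)" unfolding nrm_def[of "Lop (H g)"] by (rule real_sqrt_le_mono)
    also have "\<dots> = (K * sqrt mass) * nrm g" using K by (simp add: real_sqrt_mult)
    finally show ?thesis .
  qed
  then show ?thesis using that[of "K * sqrt mass"] K mass_nonneg by simp
qed

text \<open>By symmetry \<open>L\<close> moves onto the kernel. Applied in \<open>y\<close> it gives
  \<open>(c\<^sup>2 x\<^sup>2 + c\<^sup>2 y\<^sup>2 - c\<^sup>2 x\<^sup>2 y\<^sup>2) cas (c x y) + 2
  (\<alpha> + 1) c x y cas (- c x y)\<close>, which is symmetric in \<open>x\<close> and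
  \<open>y\<close>, so \<open>L\<close> in \<open>x\<close> gives the same.\<close>

lemma Lop_H_commute:
  assumes f: "f \<in> C2" shows "Lop (H f) x = H (Lop f) x"
proof -
  define e where "e = (\<lambda>y. cas (c * x * y))"
  have d1: "(e has_real_derivative c * x * cas (- (c * x * y))) (at y)" for y
    unfolding e_def cas_minus unfolding cas_def by (auto intro!: derivative_eq_intros simp: algebra_simps)
  have d2: "((\<lambda>y. c * x * cas (- (c * x * y))) has_real_derivative - ((c * x)\<^sup>2 * e y)) (at y)" for y
    unfolding e_def cas_minus unfolding cas_def by (auto intro!: derivative_eq_intros simp: algebra_simps power2_eq_square)
  have d3: "continuous_on UNIV (\<lambda>y. - ((c * x)\<^sup>2 * e y))"
    unfolding e_def by (intro continuous_intros)
  note e = C2I[OF d1 d2 d3]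
  have fB: "f \<in> Bd" using f by auto
  have eB: "e \<in> Bd" unfolding e_def by auto
  have "H (Lop f) x = ip (Lop e) f" using Lop_symmetric[OF e(1) f] by (simp add: H_eq_ip e_def)
  also have "\<dots> = ip (\<lambda>y. c\<^sup>2 * x\<^sup>2 * e y + (c\<^sup>2 * (1 - x\<^sup>2)) * (y * (y * e y)) + (2 * (\<alpha> + 1) * x * c) * (y * cas (- (c * x * y)))) f"
    unfolding Lop_def e(3) unfolding e(2) by (rule ip_cong) (simp_all add: algebra_simps power2_eq_square)
  also have "\<dots> = c\<^sup>2 * x\<^sup>2 * ip e f + (c\<^sup>2 * (1 - x\<^sup>2)) * ip (\<lambda>y. y * (y * e y)) f + (2 * (\<alpha> + 1) * x * c) * ip (\<lambda>y. y * cas (- (c * x * y))) f"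
    using eB fB by (simp only: ip_add_left ip_scale_left Bd_add Bd_mult Bd_cmult Bd_id cas_neg_Bd)
  also have "ip e f = H f x" by (simp add: H_eq_ip e_def)
  also have "ip (\<lambda>y. y * (y * e y)) f = H (\<lambda>y. y * (y * f y)) x" by (simp add: ip_def H_def e_def mult_ac)
  also have "ip (\<lambda>y. y * cas (- (c * x * y))) f = H (\<lambda>y. y * f y) (- x)" by (simp add: ip_def H_def mult_ac)
  finally show ?thesis unfolding Lop_H[OF fB] by simp
qed

lemma Lop_add_scale: "u \<in> C2 \<Longrightarrow> v \<in> C2 \<Longrightarrow> Lop (\<lambda>x. u x + k * v x) x = Lop u x + k * Lop v x"
proof -
  assume u: "u \<in> C2" and v: "v \<in> C2"
  have 1: "((\<lambda>x. u x + k * v x) has_real_derivative deriv u x + k * deriv v x) (at x)" for x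
    by (auto intro!: derivative_eq_intros C2_deriv u v)
  have 2: "((\<lambda>x. deriv u x + k * deriv v x) has_real_derivative deriv (deriv u) x + k * deriv (deriv v) x) (at x)" for x
    by (auto intro!: derivative_eq_intros C2_deriv u v)
  have 3: "continuous_on UNIV (\<lambda>x. deriv (deriv u) x + k * deriv (deriv v) x)"
    by (intro continuous_intros C2_cont u v)
  show ?thesis unfolding Lop_def C2I(3)[OF 1 2 3] unfolding C2I(2)[OF 1 2 3] by (simp add: algebra_simps)
qed

lemma Lop_reflect:
  assumes u: "u \<in> C2" shows "Lop (\<lambda>x. u (- x)) x = Lop u (- x)"
proof -
  have 1: "((\<lambda>x. u (- x)) has_real_derivative - deriv u (- x)) (at x)" for x
    using C2_deriv(1)[OF u, of "- x" UNIV] by (simp add: DERIV_mirror)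
  have 2: "((\<lambda>x. - deriv u (- x)) has_real_derivative deriv (deriv u) (- x)) (at x)" for x
    using C2_deriv(2)[OF u, of "- x" UNIV] DERIV_minus[of "\<lambda>x. deriv u (- x)" "- deriv (deriv u) (- x)" x UNIV]
    by (simp add: DERIV_mirror)
  have 3: "continuous_on UNIV (\<lambda>x. deriv (deriv u) (- x))"
    by (rule continuous_on_compose2[OF C2_cont(3)[OF u]]) (auto intro: continuous_intros)
  show ?thesis unfolding Lop_def C2I(3)[OF 1 2 3] unfolding C2I(2)[OF 1 2 3] by simp
qed

section \<open>Uniqueness and parity of joint eigenfunctions\<close>

lemma interval_nonzero:
  assumes g: "g \<in> Bd" and nz: "H g z \<noteq> 0" and lr: "-1 \<le> l" "l < r" "r \<le> 1"
  obtains l' r' where "l \<le> l'" "l' < r'" "r' \<le> r" "\<And>x. x \<in> {l'<..<r'} \<Longrightarrow> H g x \<noteq> 0"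
proof -
  have "\<exists>y\<in>{l<..<r}. H g y \<noteq> 0"
  proof (rule ccontr)
    assume "\<not> ?thesis"
    then have "{l<..<r} \<subseteq> {x \<in> {-1..1}. H g x = 0}" using lr by auto
    then have "infinite {x \<in> {-1..1}. H g x = 0}" using lr(2) infinite_Ioo infinite_super by blast
    then show False using H_zeros[OF g] nz by blast
  qed
  then obtain y where y: "y \<in> {l<..<r}" "H g y \<noteq> 0" by blast
  have "open ({l<..<r} \<inter> {x. H g x \<noteq> 0})"
    using H_continuous[OF g, of UNIV] by (intro open_Int open_Collect_neq) auto
  then obtain e where e: "0 < e" "ball y e \<subseteq> {l<..<r} \<inter> {x. H g x \<noteq> 0}"
    using y open_contains_ball by (metis (mono_tags, lifting) IntI mem_Collect_eq)
  have "ball y e = {y - e<..<y + e}" by (rule ball_eq_greaterThanLessThan)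
  then have sub: "{y - e<..<y + e} \<subseteq> {l<..<r} \<inter> {x. H g x \<noteq> 0}" using e(2) by simp
  define l' where "l' = y - e/2"
  define r' where "r' = y + e/2"
  have "l' \<in> {y - e<..<y + e}" "r' \<in> {y - e<..<y + e}" using e(1) by (auto simp: l'_def r'_def)
  then have "l \<le> l'" "r' \<le> r" using sub by force+
  moreover have "l' < r'" using e(1) by (simp add: l'_def r'_def)
  moreover have "H g x \<noteq> 0" if "x \<in> {l'<..<r'}" for x
  proof -
    have "x \<in> {y - e<..<y + e}" using that e(1) by (auto simp: l'_def r'_def field_simps)
    then show ?thesis using sub by auto
  qed
  ultimately show ?thesis using that by blast
qed

text \<open>For equal \<kappa> the Green integral from any interior \<open>a\<close> to 1 is 0,
  hence so is the Wronskian, and the quotient is constant on an interval where \<open>H g\<close>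
  has no zero. Analyticity spreads the proportionality to the whole line. Being smooth up to the
  singular point 1 is what replaces an initial condition.\<close>

lemma Lop_eigenfunction_unique:
  assumes f: "f \<in> Bd" and g: "g \<in> Bd"
    and u: "\<And>x. x \<in> {-1..1} \<Longrightarrow> Lop (H f) x = \<kappa> * H f x"
    and v: "\<And>x. x \<in> {-1..1} \<Longrightarrow> Lop (H g) x = \<kappa> * H g x"
    and nz: "H g z \<noteq> 0"
  obtains k where "\<And>x. H f x = k * H g x"
proof -
  obtain l r where lr: "-1 \<le> l" "l < r" "r \<le> 1" "\<And>x. x \<in> {l<..<r} \<Longrightarrow> H g x \<noteq> 0"
    using interval_nonzero[OF g nz, of "-1" 1] by auto
  have W: "deriv (H f) a * H g a - H f a * deriv (H g) a = 0" if a: "a \<in> {-1<..<1}" for a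
  proof -
    have "(LINT x|M. (Lop (H f) x * H g x - H f x * Lop (H g) x) * indicator {a..} x) = (LINT x|M. 0)"
      by (rule Bochner_Integration.integral_cong) (auto simp: u v)
    then have "p a * wronskian (H f) (H g) a = 0"
      using Green[OF H_C2(1)[OF f] H_C2(1)[OF g], of a] a by simp
    then show ?thesis using p_pos[OF a] by (simp add: wronskian_def)
  qed
  have "((\<lambda>x. H f x / H g x) has_real_derivative 0) (at x within {l<..<r})" if x: "x \<in> {l<..<r}" for x
  proof -
    have "((\<lambda>x. H f x / H g x) has_real_derivative (deriv (H f) x * H g x - H f x * deriv (H g) x) / (H g x * H g x)) (at x within {l<..<r})"
      by (intro DERIV_divide C2_deriv H_C2 f g lr(4) x)
    then show ?thesis using W[of x] x lr by simp
  qed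
  then obtain k where k: "\<And>x. x \<in> {l<..<r} \<Longrightarrow> H f x / H g x = k"
    using has_field_derivative_zero_constant[of "{l<..<r}" "\<lambda>x. H f x / H g x"] by auto
  define d where "d = (\<lambda>x. f x - k * g x)"
  have dB: "d \<in> Bd" unfolding d_def using f g by auto
  have Hd: "H d x = H f x - k * H g x" for x unfolding d_def using f g by (simp add: H_diff H_scale)
  have "{l<..<r} \<subseteq> {x \<in> {-1..1}. H d x = 0}"
  proof
    fix x assume x: "x \<in> {l<..<r}"
    then have "H f x = k * H g x" using k[OF x] lr(4)[OF x] by (simp add: field_simps)
    then show "x \<in> {x \<in> {-1..1}. H d x = 0}" using x lr by (auto simp: Hd)
  qed
  then have "infinite {x \<in> {-1..1}. H d x = 0}" using lr(2) infinite_Ioo infinite_super by blast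
  then have "H d x = 0" for x by (rule H_zeros[OF dB])
  then show ?thesis using that[of k] by (simp add: Hd)
qed

text \<open>The equations hold for all real \<open>x\<close>. As \<nu> is nonzero,
  \<open>\<psi>\<close> equals \<open>H (\<psi> / \<nu>)\<close>, hence is smooth enough for
  \<open>L\<close> and determined on the line by its values on the interval.\<close>

definition jeig :: "(real \<Rightarrow> real) \<Rightarrow> real \<Rightarrow> real \<Rightarrow> bool" where
  "jeig \<psi> \<kappa> \<nu> \<longleftrightarrow> \<psi> \<in> Bd \<and> \<nu> \<noteq> 0 \<and> (\<forall>x. H \<psi> x = \<nu> * \<psi> x) \<and> (\<forall>x. Lop \<psi> x = \<kappa> * \<psi> x) \<and> ip \<psi> \<psi> = 1"

lemma nonzero_of_ip:
  assumes "0 < ip f f" obtains z where "z \<in> {-1..1}" "f z \<noteq> 0"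
proof -
  have "\<exists>z\<in>{-1..1}. f z \<noteq> 0"
  proof (rule ccontr)
    assume "\<not> ?thesis"
    then have "ip f f = ip (\<lambda>x. 0) (\<lambda>x. 0)" by (intro ip_cong) auto
    also have "\<dots> = 0" by (simp add: ip_def)
    finally show False using assms by simp
  qed
  then show ?thesis using that by blast
qed

lemma jeigD:
  assumes "jeig \<psi> \<kappa> \<nu>"
  shows "\<psi> \<in> Bd" "\<nu> \<noteq> 0" "\<And>x. H \<psi> x = \<nu> * \<psi> x" "\<And>x. Lop \<psi> x = \<kappa> * \<psi> x" "ip \<psi> \<psi> = 1"
    "\<psi> = H (\<lambda>x. (1 / \<nu>) * \<psi> x)" "(\<lambda>x. (1 / \<nu>) * \<psi> x) \<in> Bd" "\<psi> \<in> C2"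
proof -
  show 1: "\<psi> \<in> Bd" "\<nu> \<noteq> 0" "\<And>x. H \<psi> x = \<nu> * \<psi> x" "\<And>x. Lop \<psi> x = \<kappa> * \<psi> x" "ip \<psi> \<psi> = 1"
    using assms by (auto simp: jeig_def)
  show 2: "\<psi> = H (\<lambda>x. (1 / \<nu>) * \<psi> x)" unfolding H_scale using 1 by (intro ext) simp
  show 3: "(\<lambda>x. (1 / \<nu>) * \<psi> x) \<in> Bd" using 1 by blast
  show "\<psi> \<in> C2" using H_C2(1)[OF 3] 2 by simp
qed

lemma jeig_nonzero:
  assumes "jeig \<psi> \<kappa> \<nu>" obtains z where "\<psi> z \<noteq> 0"
  using nonzero_of_ip[of \<psi>] jeigD(5)[OF assms] by auto

text \<open>Proportional functions have the same \<open>H\<close>-eigenvalue, so \<kappa> determines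
  \<nu>. The converse, for \<open>\<nu>\<^sup>2\<close>, is the hard part and comes with
  \<open>ev_strictly_decreasing\<close>.\<close>

lemma jeig_unique:
  assumes 1: "jeig \<psi> \<kappa> \<nu>" and 2: "jeig \<psi>' \<kappa> \<nu>'"
  obtains k where "k \<noteq> 0" "\<And>x. \<psi>' x = k * \<psi> x" "\<nu>' = \<nu>"
proof -
  obtain z where z: "\<psi> z \<noteq> 0" using jeig_nonzero[OF 1] .
  obtain z' where z': "\<psi>' z' \<noteq> 0" using jeig_nonzero[OF 2] .
  obtain k where k: "\<And>x. H (\<lambda>x. (1 / \<nu>') * \<psi>' x) x = k * H (\<lambda>x. (1 / \<nu>) * \<psi> x) x"
  proof (rule Lop_eigenfunction_unique[OF jeigD(7)[OF 2] jeigD(7)[OF 1]])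
    show "Lop (H (\<lambda>x. 1 / \<nu>' * \<psi>' x)) x = \<kappa> * H (\<lambda>x. 1 / \<nu>' * \<psi>' x) x" for x
      unfolding jeigD(6)[OF 2, symmetric] by (rule jeigD(4)[OF 2])
    show "Lop (H (\<lambda>x. 1 / \<nu> * \<psi> x)) x = \<kappa> * H (\<lambda>x. 1 / \<nu> * \<psi> x) x" for x
      unfolding jeigD(6)[OF 1, symmetric] by (rule jeigD(4)[OF 1])
    show "H (\<lambda>x. 1 / \<nu> * \<psi> x) z \<noteq> 0" unfolding jeigD(6)[OF 1, symmetric] by (rule z)
  qed blast
  have k': "\<psi>' x = k * \<psi> x" for x
    using k[of x] unfolding jeigD(6)[OF 1, symmetric] jeigD(6)[OF 2, symmetric] .
  have k0: "k \<noteq> 0" using k'[of z'] z' by auto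
  have "\<nu>' * (k * \<psi> z) = H \<psi>' z" using jeigD(3)[OF 2, of z] k' by simp
  also have "\<dots> = k * H \<psi> z" using H_scale[of k \<psi> z] k' by (simp add: H_cong[of \<psi>' "\<lambda>x. k * \<psi> x"])
  also have "\<dots> = \<nu> * (k * \<psi> z)" using jeigD(3)[OF 1] by simp
  finally have "\<nu>' = \<nu>" using k0 z by simp
  then show ?thesis using that k0 k' by blast
qed

lemma jeig_orthogonal:
  assumes 1: "jeig \<psi> \<kappa> \<nu>" and 2: "jeig \<psi>' \<kappa>' \<nu>'" and ne: "\<kappa> \<noteq> \<kappa>'"
  shows "ip \<psi> \<psi>' = 0"
proof -
  have "\<kappa> * ip \<psi> \<psi>' = ip (Lop \<psi>) \<psi>'"
    using jeigD(4)[OF 1] by (simp flip: ip_scale_left cong: ip_cong)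
  also have "\<dots> = ip \<psi> (Lop \<psi>')" by (rule Lop_symmetric[OF jeigD(8)[OF 1] jeigD(8)[OF 2]])
  also have "\<dots> = \<kappa>' * ip \<psi> \<psi>'"
    using jeigD(4)[OF 2] by (simp flip: ip_scale_right cong: ip_cong)
  finally show ?thesis using ne by simp
qed

text \<open>Reflection commutes with \<open>H\<close> and \<open>L\<close>, so it multiplies \<psi>
  by a constant; applying it twice shows that the constant squares to 1.\<close>

lemma jeig_parity:
  assumes 1: "jeig \<psi> \<kappa> \<nu>"
  obtains \<epsilon> where "\<epsilon>\<^sup>2 = (1::real)" "\<And>x. \<psi> (- x) = \<epsilon> * \<psi> x"
proof -
  obtain z where z: "\<psi> z \<noteq> 0" using jeig_nonzero[OF 1] .
  define g where "g = (\<lambda>x. (1 / \<nu>) * \<psi> x)"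
  have g: "g \<in> Bd" and Hg: "H g = \<psi>" using jeigD(6,7)[OF 1] by (auto simp: g_def)
  have R: "H (\<lambda>x. g (- x)) = (\<lambda>x. \<psi> (- x))"
    using H_reflect[OF g] Hg by auto
  have RB: "(\<lambda>x. g (- x)) \<in> Bd" using g by auto
  obtain k where k: "\<And>x. H (\<lambda>x. g (- x)) x = k * H g x"
  proof (rule Lop_eigenfunction_unique[OF RB g])
    show "Lop (H (\<lambda>x. g (- x))) x = \<kappa> * H (\<lambda>x. g (- x)) x" for x
      unfolding R Lop_reflect[OF jeigD(8)[OF 1]] by (rule jeigD(4)[OF 1])
    show "Lop (H g) x = \<kappa> * H g x" for x unfolding Hg by (rule jeigD(4)[OF 1])
    show "H g z \<noteq> 0" unfolding Hg by (rule z)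
  qed blast
  have k': "\<psi> (- x) = k * \<psi> x" for x using k[of x] by (simp add: R Hg)
  have "\<psi> z = k * (k * \<psi> z)" using k'[of z] k'[of "- z"] by simp
  then have "k\<^sup>2 = 1" using z by (simp add: power2_eq_square)
  then show ?thesis using that k' by blast
qed

text \<open>\<open>H\<close> preserves the one-dimensional eigenspaces of \<open>L\<close>, so an
  eigenfunction of \<open>L\<close> is one of \<open>H\<close>. The function is given as
  \<open>H g\<close> because uniqueness is available for transforms.\<close>

lemma jeig_from_Lop_eigenfunction:
  assumes g: "g \<in> Bd" and L: "\<And>x. Lop (H g) x = \<kappa> * H g x"
    and HH: "\<And>x. H (H (H g)) x = \<rho> * H g x" and \<rho>: "0 < \<rho>" and pos: "0 < ip (H g) (H g)"
  obtains s \<nu> where "\<nu>\<^sup>2 = \<rho>" "jeig (\<lambda>x. s * H g x) \<kappa> \<nu>"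
proof -
  obtain z where z: "H g z \<noteq> 0" using nonzero_of_ip[OF pos] .
  obtain k where k: "\<And>x. H (H g) x = k * H g x"
  proof (rule Lop_eigenfunction_unique[OF H_Bd[OF g] g])
    show "Lop (H (H g)) x = \<kappa> * H (H g) x" for x
    proof -
      have "Lop (H (H g)) x = H (Lop (H g)) x" by (rule Lop_H_commute[OF H_C2(1)[OF g]])
      also have "\<dots> = H (\<lambda>x. \<kappa> * H g x) x" by (rule H_cong) (rule L)
      finally show ?thesis by (simp add: H_scale)
    qed
  qed (use L z in auto)
  have "\<rho> * H g z = H (\<lambda>x. k * H g x) z" using HH[of z] H_cong[of "H (H g)" "\<lambda>x. k * H g x" z] k by simp
  also have "\<dots> = k * (k * H g z)" by (simp add: H_scale k)
  finally have k2: "k\<^sup>2 = \<rho>" using z by (simp add: power2_eq_square)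
  then have k0: "k \<noteq> 0" using \<rho> by auto
  define s where "s = 1 / sqrt (ip (H g) (H g))"
  have s: "s * (s * ip (H g) (H g)) = 1" using pos by (simp add: s_def flip: power2_eq_square mult.assoc)
  have sH: "(\<lambda>x. s * H g x) = H (\<lambda>x. s * g x)" by (intro ext) (simp add: H_scale)
  have "jeig (\<lambda>x. s * H g x) \<kappa> k"
    unfolding jeig_def
  proof (intro conjI allI)
    show "(\<lambda>x. s * H g x) \<in> Bd" using g by auto
    show "H (\<lambda>x. s * H g x) x = k * (s * H g x)" for x by (simp add: H_scale k)
    have "Lop (\<lambda>x. H g x + (s - 1) * H g x) x = s * Lop (H g) x" for x
      using Lop_add_scale[OF H_C2(1)[OF g] H_C2(1)[OF g], of "s - 1" x] by (simp add: algebra_simps)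
    then show "Lop (\<lambda>x. s * H g x) x = \<kappa> * (s * H g x)" for x
      using L[of x] by (simp add: algebra_simps)
    show "ip (\<lambda>x. s * H g x) (\<lambda>x. s * H g x) = 1" using s by simp
  qed (rule k0)
  then show ?thesis using that k2 by blast
qed

end

section \<open>Joint eigenfunctions and completeness\<close>

context hartley begin

definition spec :: "real set" where "spec = {\<kappa>. \<exists>\<psi> \<nu>. jeig \<psi> \<kappa> \<nu>}"

text \<open>The choice is unique up to sign, and meaningless outside \<open>spec\<close>.\<close>
definition efun :: "real \<Rightarrow> real \<Rightarrow> real" where "efun \<kappa> = (SOME \<psi>. \<exists>\<nu>. jeig \<psi> \<kappa> \<nu>)"

definition ev :: "real \<Rightarrow> real" where "ev \<kappa> = (SOME \<nu>. jeig (efun \<kappa>) \<kappa> \<nu>)"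

lemma efun: "\<kappa> \<in> spec \<Longrightarrow> jeig (efun \<kappa>) \<kappa> (ev \<kappa>)"
proof -
  assume "\<kappa> \<in> spec"
  then have "\<exists>\<nu>. jeig (efun \<kappa>) \<kappa> \<nu>" unfolding efun_def spec_def mem_Collect_eq by (rule someI_ex)
  then show ?thesis unfolding ev_def by (rule someI_ex)
qed

lemma efun_orthonormal: "S \<subseteq> spec \<Longrightarrow> orthonormal_on S efun"
  unfolding orthonormal_on_def
  using jeigD(1,5)[OF efun] jeig_orthogonal[OF efun efun] by (auto simp: subset_iff)

text \<open>The square of \<open>cas\<close> is 1 plus the sine of the double angle, and the sine is
  odd. All slices of the kernel thus have the same norm.\<close>

lemma ip_cas_cas: "ip (\<lambda>y. cas (k * y)) (\<lambda>y. cas (k * y)) = mass"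
proof -
  have sB: "(\<lambda>y. sin (2 * (k * y))) \<in> Bd" by (intro Bd_cont continuous_intros)
  have "(LINT y|M. sin (2 * (k * (- y)))) = (LINT y|M. sin (2 * (k * y)))"
    using integral_wmeas_reflect[OF sB] .
  then have "(LINT y|M. sin (2 * (k * y))) = 0" by simp
  moreover have "cas (k * y) * cas (k * y) = 1 + sin (2 * (k * y))" for y
    unfolding cas_def sin_double using sin_cos_squared_add[of "k * y"]
    by (simp add: power2_eq_square algebra_simps)
  ultimately show ?thesis
    unfolding ip_def using sB by (simp add: mass_def Bochner_Integration.integral_add)
qed

text \<open>At each \<open>x\<close> the summands are squared coefficients of one kernel slice, so
  Bessel bounds their sum by \<open>mass\<close>; then integrate. The system is arbitrary because
  the upper bound applies this to eigenfunctions of \<open>Q\<close> not known to be joint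
  ones.\<close>

lemma trace_bound:
  assumes "orthonormal_on S e" "finite S"
  shows "(\<Sum>i\<in>S. ip (H (e i)) (H (e i))) \<le> mass\<^sup>2"
proof -
  have B: "e i \<in> Bd" if "i \<in> S" for i using assms(1) that by (auto simp: orthonormal_on_def)
  have "(\<Sum>i\<in>S. ip (H (e i)) (H (e i))) = (LINT x|M. (\<Sum>i\<in>S. (ip (\<lambda>y. cas (c * x * y)) (e i))\<^sup>2))"
    unfolding ip_def[of "H _"] using B
    by (subst Bochner_Integration.integral_sum) (auto simp: power2_eq_square H_eq_ip[symmetric])
  also have "\<dots> \<le> (LINT x|M. mass)"
  proof (rule integral_mono)
    show "integrable M (\<lambda>x. \<Sum>i\<in>S. (ip (\<lambda>y. cas (c * x * y)) (e i))\<^sup>2)"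
      unfolding H_eq_ip[symmetric] using B by (intro Bd_integrable Bd_sum Bd_power) auto
    show "(\<Sum>i\<in>S. (ip (\<lambda>y. cas (c * x * y)) (e i))\<^sup>2) \<le> mass" for x
      using Bessel[OF assms(1) cas_Bd[of "c * x"] assms(2)] by (simp add: ip_cas_cas)
  qed auto
  also have "\<dots> = mass\<^sup>2" by (simp add: mass_def power2_eq_square)
  finally show ?thesis .
qed

section \<open>Spectral levels and the size of \<open>H\<close> beyond them\<close>

definition level :: "real \<Rightarrow> real set" where "level t = {\<kappa> \<in> spec. t \<le> (ev \<kappa>)\<^sup>2}"

lemma level_sub: "level t \<subseteq> spec"
  by (auto simp: level_def)

lemma ip_H_efun:
  assumes "\<kappa> \<in> spec" shows "ip (H (efun \<kappa>)) (H (efun \<kappa>)) = (ev \<kappa>)\<^sup>2"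
proof -
  have "H (efun \<kappa>) = (\<lambda>x. ev \<kappa> * efun \<kappa> x)" using jeigD(3)[OF efun[OF assms]] by auto
  then show ?thesis using jeigD(5)[OF efun[OF assms]] by (simp add: power2_eq_square)
qed

text \<open>Each member contributes at least \<open>t\<close> to a trace of at most
  \<open>mass\<^sup>2\<close>.\<close>

lemma finite_level:
  assumes t: "0 < t" shows "finite (level t)"
proof (rule finite_if_finite_subsets_card_bdd[THEN conjunct1])
    fix G assume G: "G \<subseteq> level t" "finite G"
    have "t * card G = (\<Sum>\<kappa>\<in>G. t)" by simp
    also have "\<dots> \<le> (\<Sum>\<kappa>\<in>G. (ev \<kappa>)\<^sup>2)" using G by (intro sum_mono) (auto simp: level_def)
    also have "\<dots> = (\<Sum>\<kappa>\<in>G. ip (H (efun \<kappa>)) (H (efun \<kappa>)))"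
      using G level_sub[of t] by (intro sum.cong refl) (simp add: ip_H_efun subset_iff)
    also have "\<dots> \<le> mass\<^sup>2" using G level_sub[of t] by (intro trace_bound efun_orthonormal) auto
    finally have "real (card G) \<le> mass\<^sup>2 / t" using t by (simp add: field_simps)
    then show "card G \<le> nat \<lfloor>mass\<^sup>2 / t\<rfloor>" by (simp add: le_nat_floor)
qed

lemma Lop_scale: "u \<in> C2 \<Longrightarrow> Lop (\<lambda>x. s * u x) x = s * Lop u x"
  using Lop_add_scale[of u u "s - 1" x] by (simp add: algebra_simps)

text \<open>The eigenspace of \<open>H\<^sup>2\<close> for \<open>lam\<close>, cut down by the
  orthogonality conditions, is invariant under \<open>L\<close>, and \<open>L\<close> is bounded and
  compact on it because its elements are transforms. So \<open>L\<close> has an eigenfunction there,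
  which is a joint one.\<close>

lemma joint_eigenfunction_exists:
  assumes S: "S \<subseteq> spec" and g: "g \<in> Bd" "0 < ip g g" and lam: "0 < lam"
    and HHg: "\<And>x. H (H g) x = lam * g x" and orth: "\<And>\<kappa>. \<kappa> \<in> S \<Longrightarrow> ip g (efun \<kappa>) = 0"
  obtains \<psi> \<kappa> \<nu> where "jeig \<psi> \<kappa> \<nu>" "\<nu>\<^sup>2 = lam" "\<And>\<kappa>. \<kappa> \<in> S \<Longrightarrow> ip \<psi> (efun \<kappa>) = 0"
proof -
  define E where "E = {f \<in> Bd. (\<forall>x. H (H f) x = lam * f x) \<and> (\<forall>\<kappa>\<in>S. ip f (efun \<kappa>) = 0)}"
  \<comment> \<open>Adding the identity makes the form at least \<open>ip f f\<close>, so any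
    \<open>g\<close> of positive norm can start the maximisation.\<close>
  define B where "B f = (\<lambda>x. Lop f x + 1 * f x)" for f
  have eB: "efun \<kappa> \<in> Bd" and eC: "efun \<kappa> \<in> C2" and eL: "\<And>x. Lop (efun \<kappa>) x = \<kappa> * efun \<kappa> x"
    if "\<kappa> \<in> S" for \<kappa>
    using jeigD[OF efun] S that by auto
  have EB: "f \<in> Bd" if "f \<in> E" for f using that by (simp add: E_def)
  have Eeq: "f = H (\<lambda>x. (1 / lam) * H f x)" if "f \<in> E" for f
    using that lam unfolding H_scale by (intro ext) (simp add: E_def)
  have EHB: "(\<lambda>x. (1 / lam) * H f x) \<in> Bd" if "f \<in> E" for f using EB[OF that] by blast
  have EC: "f \<in> C2" if "f \<in> E" for f using H_C2(1)[OF EHB[OF that]] Eeq[OF that] by simp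
  have lin: "(\<lambda>x. f x + k * h x) \<in> E" if f: "f \<in> E" and h: "h \<in> E" for f h k
  proof -
    have H1: "H (\<lambda>x. f x + k * h x) = (\<lambda>x. H f x + k * H h x)"
      using EB[OF f] EB[OF h] by (intro ext) (simp add: H_add H_scale)
    have "H (H (\<lambda>x. f x + k * h x)) x = lam * (f x + k * h x)" for x
      unfolding H1 using f h by (simp add: H_add H_scale E_def algebra_simps)
    then show ?thesis using f h eB by (simp add: E_def ip_add_left)
  qed
  have LE: "Lop f \<in> E" if f: "f \<in> E" for f
    unfolding E_def mem_Collect_eq
  proof (intro conjI allI ballI)
    show "Lop f \<in> Bd" using EC[OF f] by auto
    show "H (H (Lop f)) x = lam * Lop f x" for x
    proof -
      have "H (Lop f) = Lop (H f)" using Lop_H_commute[OF EC[OF f]] by auto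
      then have "H (H (Lop f)) x = Lop (H (H f)) x" using Lop_H_commute[OF H_C2(1)[OF EB[OF f]]] by simp
      also have "H (H f) = (\<lambda>x. lam * f x)" using f by (auto simp: E_def)
      also have "Lop (\<lambda>x. lam * f x) x = lam * Lop f x" by (rule Lop_scale[OF EC[OF f]])
      finally show ?thesis .
    qed
    fix \<kappa> assume k: "\<kappa> \<in> S"
    have "ip (Lop f) (efun \<kappa>) = ip f (Lop (efun \<kappa>))" by (rule Lop_symmetric[OF EC[OF f] eC[OF k]])
    also have "\<dots> = ip f (\<lambda>x. \<kappa> * efun \<kappa> x)" by (rule ip_cong) (auto simp: eL[OF k])
    also have "\<dots> = 0" using f k by (simp add: E_def)
    finally show "ip (Lop f) (efun \<kappa>) = 0" .
  qed
  have BE: "B f \<in> E" if "f \<in> E" for f unfolding B_def by (rule lin[OF LE[OF that] that])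
  obtain K where K: "0 \<le> K" "\<And>g. g \<in> Bd \<Longrightarrow> nrm (Lop (H g)) \<le> K * nrm g" using nrm_Lop_H by blast
  define C where "C = K * (1 / lam * (2 * mass)) + 1"
  have Bn: "nrm (B f) \<le> C * nrm f" if f: "f \<in> E" for f
  proof -
    have "nrm (Lop f) = nrm (Lop (H (\<lambda>x. (1 / lam) * H f x)))" using Eeq[OF f] by simp
    also have "\<dots> \<le> K * nrm (\<lambda>x. (1 / lam) * H f x)" by (rule K(2)[OF EHB[OF f]])
    also have "nrm (\<lambda>x. (1 / lam) * H f x) \<le> 1 / lam * (2 * mass * nrm f)"
      unfolding nrm_scale using lam nrm_H_le[OF EB[OF f]] by (simp add: divide_right_mono)
    then have "K * nrm (\<lambda>x. (1 / lam) * H f x) \<le> K * (1 / lam * (2 * mass * nrm f))"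
      using K(1) by (rule mult_left_mono)
    finally have "nrm (Lop f) \<le> K * (1 / lam * (2 * mass)) * nrm f" by (simp add: mult_ac)
    moreover have "nrm (B f) \<le> nrm (Lop f) + nrm f"
      unfolding B_def using nrm_triangle[of "Lop f" f] EC[OF f] by simp
    ultimately show ?thesis by (simp add: C_def algebra_simps)
  qed
  have gE: "g \<in> E" using g HHg orth by (simp add: E_def)
  have lower: "ip f f \<le> ip (B f) f" if f: "f \<in> E" for f
    unfolding B_def using Lop_nonneg[OF EC[OF f]] EC[OF f] by (simp add: ip_add_left)
  obtain h l where h: "h \<in> E" "0 < ip h h" and hl: "nrm (\<lambda>x. B h x - l * h x) = 0"
  proof (rule max_eigenvector[of E B C g])
    show "E \<subseteq> Bd" using EB by auto
    show "(\<lambda>x. f x + k * h x) \<in> E" if "f \<in> E" "h \<in> E" for f h k by (rule lin[OF that])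
    show "B f \<in> E" if "f \<in> E" for f by (rule BE[OF that])
    show "B (\<lambda>x. f x + k * h x) x = B f x + k * B h x" if "f \<in> E" "h \<in> E" for f h k x
      unfolding B_def using Lop_add_scale[OF EC[OF that(1)] EC[OF that(2)]] by (simp add: algebra_simps)
    show "ip (B f) h = ip f (B h)" if "f \<in> E" "h \<in> E" for f h
      unfolding B_def using Lop_symmetric[OF EC[OF that(1)] EC[OF that(2)]] EC[OF that(1)] EC[OF that(2)]
      by (simp add: ip_add_left ip_add_right)
    show "0 \<le> ip (B f) f" if "f \<in> E" for f using lower[OF that] ip_nonneg[of f] by linarith
    show "ip (B f) f \<le> C * ip f f" if f: "f \<in> E" for f
    proof -
      have "ip (B f) f \<le> nrm (B f) * nrm f" using ip_le_nrm[of "B f" f] EB[OF f] EB[OF BE[OF f]] by simp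
      also have "\<dots> \<le> C * nrm f * nrm f" by (rule mult_right_mono[OF Bn[OF f]]) simp
      finally show ?thesis using nrm_sq[of f] by (simp add: power2_eq_square mult.assoc)
    qed
    show "g \<in> E" by (rule gE)
    show "0 < ip (B g) g" using lower[OF gE] g(2) by linarith
    fix F :: "nat \<Rightarrow> real \<Rightarrow> real" assume F: "\<And>n. F n \<in> E" and F1: "\<And>n. ip (F n) (F n) = 1"
    define G where "G n = B (F n)" for n
    have GE: "G n \<in> E" for n unfolding G_def by (rule BE[OF F])
    have Gb: "nrm (G n) \<le> C" for n using Bn[OF F, of n] F1[of n] by (simp add: G_def nrm_def)
    obtain w r where w: "w \<in> Bd" and r: "strict_mono (r :: nat \<Rightarrow> nat)"
      and lim: "(\<lambda>n. nrm (\<lambda>x. H (G (r n)) x - w x)) \<longlonglongrightarrow> 0"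
      using H_compact[of G C] EB[OF GE] Gb by blast
    \<comment> \<open>\<open>G n\<close> equals \<open>H (H (G n)) / lam\<close> and
      \<open>H (G (r n))\<close> tends to \<open>w\<close>, so this is the limit of
      \<open>G (r n)\<close>, now inside the eigenspace.\<close>
    define u where "u = (\<lambda>x. (1 / lam) * H w x)"
    have uB: "u \<in> Bd" unfolding u_def using w by blast
    have GB: "G n \<in> Bd" for n by (rule EB[OF GE])
    have Geq: "G n x = (1 / lam) * H (H (G n)) x" for n x using GE[of n] lam by (simp add: E_def)
    have pt: "(\<lambda>n. H (H (G (r n))) x) \<longlonglongrightarrow> H w x" for x
      by (rule H_pointwise_tendsto[OF _ w lim]) (use GB in auto)
    have l2: "(\<lambda>n. nrm (\<lambda>x. H (H (G (r n))) x - H w x)) \<longlonglongrightarrow> 0"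
      by (rule nrm_H_tendsto[OF _ w lim]) (use GB in auto)
    have Gu: "(\<lambda>n. nrm (\<lambda>x. G (r n) x - u x)) \<longlonglongrightarrow> 0"
    proof -
      have "nrm (\<lambda>x. G (r n) x - u x) = \<bar>1 / lam\<bar> * nrm (\<lambda>x. H (H (G (r n))) x - H w x)" for n
        unfolding nrm_scale[symmetric] by (rule nrm_cong) (simp add: Geq[of "r n"] u_def right_diff_distrib diff_divide_distrib)
      then show ?thesis using tendsto_mult_right_zero[OF l2, of "\<bar>1 / lam\<bar>"] by simp
    qed
    have "u \<in> E"
      unfolding E_def mem_Collect_eq
    proof (intro conjI allI ballI uB)
      fix x
      have 1: "(\<lambda>n. nrm (\<lambda>x. H (G (r n)) x - H u x)) \<longlonglongrightarrow> 0"
        by (rule nrm_H_tendsto[OF _ uB Gu]) (rule GB)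
      have "(\<lambda>n. H (H (G (r n))) x) \<longlonglongrightarrow> H (H u) x"
        by (rule H_pointwise_tendsto[OF _ _ 1]) (use GB uB in auto)
      then have "H (H u) x = H w x" using pt LIMSEQ_unique by blast
      then show "H (H u) x = lam * u x" using lam by (simp add: u_def)
    next
      fix \<kappa> assume k: "\<kappa> \<in> S"
      have "(\<lambda>n. ip (G (r n)) (efun \<kappa>)) \<longlonglongrightarrow> ip u (efun \<kappa>)"
        by (rule ip_tendsto[OF _ uB eB[OF k] Gu]) (rule GB)
      moreover have "ip (G (r n)) (efun \<kappa>) = 0" for n using GE k by (simp add: E_def)
      ultimately show "ip u (efun \<kappa>) = 0" using LIMSEQ_unique[OF _ tendsto_const] by simp
    qed
    then show "\<exists>g\<in>E. \<exists>r::nat \<Rightarrow> nat. strict_mono r \<and> (\<lambda>n. nrm (\<lambda>x. B (F (r n)) x - g x)) \<longlonglongrightarrow> 0"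
      using r Gu unfolding G_def by blast
  qed blast
  define d where "d = (\<lambda>x. B h x + (- l) * h x)"
  have dE: "d \<in> E" unfolding d_def by (rule lin[OF BE[OF h(1)] h(1)])
  have "ip d d = 0" using hl by (simp add: d_def nrm_def)
  \<comment> \<open>\<open>H\<close> kills the null function \<open>d\<close>, and
    \<open>d = H (H d) / lam\<close> then vanishes at every point.\<close>
  then have "d x = 0" for x
  proof -
    have "H d y = 0" for y by (rule H_null[OF EB[OF dE] \<open>ip d d = 0\<close>])
    then have "H (H d) x = H (\<lambda>x. 0 * d x) x" by (intro H_cong) simp
    also have "\<dots> = 0" by (subst H_scale) simp
    finally show ?thesis using dE lam by (simp add: E_def)
  qed
  then have Lh: "Lop h x = (l - 1) * h x" for x by (simp add: d_def B_def algebra_simps)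
  define q where "q = (\<lambda>x. (1 / lam) * H h x)"
  have qB: "q \<in> Bd" and Hq: "H q = h" using EHB[OF h(1)] Eeq[OF h(1)] by (auto simp: q_def)
  obtain s \<nu> where "\<nu>\<^sup>2 = lam" "jeig (\<lambda>x. s * H q x) (l - 1) \<nu>"
  proof (rule jeig_from_Lop_eigenfunction[OF qB _ _ lam])
    show "Lop (H q) x = (l - 1) * H q x" for x unfolding Hq by (rule Lh)
    show "H (H (H q)) x = lam * H q x" for x unfolding Hq using h(1) by (simp add: E_def)
    show "0 < ip (H q) (H q)" unfolding Hq by (rule h(2))
  qed blast
  moreover have "ip (\<lambda>x. s * H q x) (efun \<kappa>) = 0" if "\<kappa> \<in> S" for \<kappa>
    using h(1) that by (simp add: Hq E_def)
  ultimately show ?thesis using that by blast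
qed

text \<open>Otherwise the largest eigenvalue of \<open>H\<^sup>2\<close> on the complement of the
  level set would exceed \<open>t\<close> and provide a joint eigenfunction that belongs to the
  level set and is orthogonal to all of it.\<close>

lemma H_bound_above_level:
  assumes t: "0 < t" and f: "f \<in> Bd" and orth: "\<And>\<kappa>. \<kappa> \<in> level t \<Longrightarrow> ip f (efun \<kappa>) = 0"
  shows "ip (H f) (H f) \<le> t * ip f f"
proof (rule ccontr)
  assume neg: "\<not> ?thesis"
  define V where "V = {f \<in> Bd. \<forall>\<kappa>\<in>level t. ip f (efun \<kappa>) = 0}"
  have eB: "efun \<kappa> \<in> Bd" and eH: "H (efun \<kappa>) = (\<lambda>x. ev \<kappa> * efun \<kappa> x)" if "\<kappa> \<in> level t" for \<kappa>
    using jeigD[OF efun] level_sub that by (auto simp: subset_iff)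
  have VB: "f \<in> Bd" if "f \<in> V" for f using that by (simp add: V_def)
  have HV: "H f \<in> V" if f: "f \<in> V" for f
    unfolding V_def mem_Collect_eq
  proof (intro conjI ballI)
    show "H f \<in> Bd" using VB[OF f] by blast
    fix \<kappa> assume k: "\<kappa> \<in> level t"
    show "ip (H f) (efun \<kappa>) = 0" using H_symmetric[OF VB[OF f] eB[OF k]] eH[OF k] f k by (simp add: V_def)
  qed
  obtain g lam where g: "g \<in> V" "0 < ip g g" and le: "ip (H (H f)) f \<le> lam * ip f f" and lam: "0 < lam"
    and gl: "nrm (\<lambda>x. H (H g) x - lam * g x) = 0"
  proof (rule max_eigenvector[of V "\<lambda>f. H (H f)" "(2 * mass)\<^sup>2" f])
    show "V \<subseteq> Bd" using VB by auto
    show "(\<lambda>x. f x + k * h x) \<in> V" if "f \<in> V" "h \<in> V" for f h k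
      using that eB by (simp add: V_def ip_add_left)
    show "H (H f) \<in> V" if "f \<in> V" for f using HV[OF HV[OF that]] .
    show "H (H (\<lambda>x. f x + k * h x)) x = H (H f) x + k * H (H h) x" if "f \<in> V" "h \<in> V" for f h k x
    proof -
      have H1: "H (\<lambda>x. f x + k * h x) = (\<lambda>x. H f x + k * H h x)"
        using VB that by (intro ext) (simp add: H_add H_scale)
      show ?thesis unfolding H1 using VB that by (simp add: H_add H_scale)
    qed
    show "ip (H (H f)) h = ip f (H (H h))" if "f \<in> V" "h \<in> V" for f h
      using VB that by (simp add: H_symmetric)
    show "0 \<le> ip (H (H f)) f" if "f \<in> V" for f
      using VB[OF that] by (subst H_symmetric) auto
    show "ip (H (H f)) f \<le> (2 * mass)\<^sup>2 * ip f f" if f: "f \<in> V" for f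
    proof -
      have "ip (H (H f)) f = (nrm (H f))\<^sup>2" using VB[OF f] by (subst H_symmetric) (auto simp: nrm_sq)
      also have "\<dots> \<le> (2 * mass * nrm f)\<^sup>2" by (intro power_mono nrm_H_le VB f) simp
      finally show ?thesis by (simp add: power_mult_distrib nrm_sq)
    qed
    show "f \<in> V" using f orth by (simp add: V_def)
    show "0 < ip (H (H f)) f"
    proof -
      have "0 \<le> t * ip f f" using t by simp
      then show ?thesis using neg f by (subst H_symmetric) auto
    qed
    fix F :: "nat \<Rightarrow> real \<Rightarrow> real" assume F: "\<And>n. F n \<in> V" and F1: "\<And>n. ip (F n) (F n) = 1"
    obtain w r where w: "w \<in> Bd" and r: "strict_mono (r :: nat \<Rightarrow> nat)"
      and lim: "(\<lambda>n. nrm (\<lambda>x. H (F (r n)) x - w x)) \<longlonglongrightarrow> 0"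
      using H_compact[of F 1] VB[OF F] F1 by (auto simp: nrm_def)
    have l2: "(\<lambda>n. nrm (\<lambda>x. H (H (F (r n))) x - H w x)) \<longlonglongrightarrow> 0"
      by (rule nrm_H_tendsto[OF _ w lim]) (use VB[OF F] in auto)
    have "H w \<in> V"
      unfolding V_def mem_Collect_eq
    proof (intro conjI ballI)
      show "H w \<in> Bd" using w by blast
      fix \<kappa> assume k: "\<kappa> \<in> level t"
      have "(\<lambda>n. ip (H (H (F (r n)))) (efun \<kappa>)) \<longlonglongrightarrow> ip (H w) (efun \<kappa>)"
        by (rule ip_tendsto[OF _ _ eB[OF k] l2]) (use VB[OF F] w in auto)
      moreover have "ip (H (H (F (r n)))) (efun \<kappa>) = 0" for n using HV[OF HV[OF F]] k by (simp add: V_def)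
      ultimately show "ip (H w) (efun \<kappa>) = 0" using LIMSEQ_unique[OF _ tendsto_const] by simp
    qed
    then show "\<exists>g\<in>V. \<exists>r::nat \<Rightarrow> nat. strict_mono r \<and> (\<lambda>n. nrm (\<lambda>x. H (H (F (r n))) x - g x)) \<longlonglongrightarrow> 0"
      using r l2 by blast
  qed blast
  have "t * ip f f < lam * ip f f" using le neg f by (simp add: H_symmetric)
  then have tl: "t < lam" using ip_nonneg[of f] by (metis mult_right_mono not_le)
  \<comment> \<open>\<open>g\<close> satisfies its equation only up to a null function;
    \<open>H (H g)\<close> satisfies it at every point.\<close>
  define G where "G = H (H g)"
  have gB: "g \<in> Bd" by (rule VB[OF g(1)])
  have nul: "ip (\<lambda>x. H (H g) x - lam * g x) (\<lambda>x. H (H g) x - lam * g x) = 0"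
    using gl by (simp add: nrm_def)
  have H1: "H (H (H g)) x = lam * H g x" for x
  proof -
    have "H (\<lambda>x. H (H g) x - lam * g x) x = 0" by (rule H_null[OF _ nul]) (use gB in auto)
    then show ?thesis using gB by (simp add: H_diff H_scale)
  qed
  have HHG: "H (H G) x = lam * G x" for x
  proof -
    have "H (H G) x = H (\<lambda>x. lam * H g x) x" unfolding G_def by (rule H_cong) (rule H1)
    then show ?thesis unfolding H_scale G_def using H1
      by (metis H_scale)
  qed
  have "ip G G = lam\<^sup>2 * ip g g"
  proof -
    have "nrm G = lam * nrm g"
    proof -
      have "nrm G \<le> lam * nrm g" "lam * nrm g \<le> nrm G"
        using nrm_triangle[of "\<lambda>x. G x - lam * g x" "\<lambda>x. lam * g x"] gB gl nrm_scale[of lam g] lam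
          nrm_triangle[of "\<lambda>x. lam * g x - G x" G] nrm_diff_commute[of G "\<lambda>x. lam * g x"]
        by (simp_all add: G_def)
      then show ?thesis by simp
    qed
    then show ?thesis using nrm_sq[of G] nrm_sq[of g] by (simp add: power_mult_distrib)
  qed
  then have Gpos: "0 < ip G G" using g(2) lam by simp
  have GV: "G \<in> V" unfolding G_def by (rule HV[OF HV[OF g(1)]])
  obtain \<psi> \<kappa> \<nu> where j: "jeig \<psi> \<kappa> \<nu>" and nu: "\<nu>\<^sup>2 = lam" and o: "\<And>\<kappa>. \<kappa> \<in> level t \<Longrightarrow> ip \<psi> (efun \<kappa>) = 0"
    using joint_eigenfunction_exists[OF level_sub[of t] VB[OF GV] Gpos lam HHG] GV unfolding V_def by blast
  have ks: "\<kappa> \<in> spec" using j by (auto simp: spec_def)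
  obtain k where k: "k \<noteq> 0" "\<And>x. \<psi> x = k * efun \<kappa> x" "\<nu> = ev \<kappa>"
    using jeig_unique[OF efun[OF ks] j] by blast
  have "\<kappa> \<in> level t" using ks nu k tl by (simp add: level_def)
  then have "ip \<psi> (efun \<kappa>) = 0" by (rule o)
  moreover have "ip \<psi> (efun \<kappa>) = k * ip (efun \<kappa>) (efun \<kappa>)"
    unfolding ip_scale_left[symmetric] by (rule ip_cong) (simp_all add: k(2))
  ultimately show False using k(1) jeigD(5)[OF efun[OF ks]] by simp
qed

section \<open>Completeness of the joint eigenfunctions\<close>

definition approximable :: "(real \<Rightarrow> real) \<Rightarrow> bool" where
  "approximable f \<longleftrightarrow> f \<in> Bd \<and> (\<forall>\<epsilon>>0. \<exists>(a::nat \<Rightarrow> real) n. nrm (\<lambda>x. f x - (\<Sum>k\<le>n. a k * x ^ k)) < \<epsilon>)"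

text \<open>Once the lower moments tend to 0, the expansion of \<open>H (F n)\<close> at a small
  \<open>x\<close> is governed by the moment of order \<open>k\<close>, with an error of order
  \<open>x ^ (k + 1)\<close> uniform in \<open>n\<close>. Hence pointwise decay of the transforms
  near 0 forces decay of each moment.\<close>

lemma moments_tendsto_zero:
  assumes F: "\<And>n. F n \<in> Bd" and b: "\<And>n. nrm (F n) \<le> K"
    and pt: "\<And>x. x \<in> {0<..<1} \<Longrightarrow> (\<lambda>n. H (F n) x) \<longlonglongrightarrow> 0"
  shows "(\<lambda>n. ip (F n) (\<lambda>y. y ^ k)) \<longlonglongrightarrow> 0"
proof (induction k rule: less_induct)
  case (less k)
  have K: "0 \<le> K" using b[of 0] nrm_nonneg[of "F 0"] by linarith
  define D where "D = 2 * (sqrt mass * K)"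
  have D: "0 \<le> D" unfolding D_def using K mass_nonneg by simp
  show ?case
  proof (rule LIMSEQ_I)
    fix e :: real assume e: "0 < e"
    \<comment> \<open>Small enough that the Taylor remainder, at most \<open>D * c * x\<close> times
      the factor \<open>q\<close> of the moment, is at most \<open>e / 2 * q\<close>.\<close>
    define x where "x = min (1 / 2) (e / (2 * (D * c + 1)))"
    have Dc: "0 < D * c + 1" using D c_pos by (intro add_nonneg_pos) auto
    have x: "0 < x" "x < 1" unfolding x_def using e Dc by auto
    have xe: "D * c * x \<le> e / 2"
    proof -
      have "D * c * x \<le> (D * c + 1) * x" using x by (simp add: algebra_simps)
      also have "\<dots> \<le> (D * c + 1) * (e / (2 * (D * c + 1)))" using Dc by (intro mult_left_mono) (auto simp: x_def)
      also have "\<dots> = e / 2" using Dc by (simp add: field_simps)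
      finally show ?thesis .
    qed
    define R where "R n = \<bar>H (F n) x - (\<Sum>j<k. cas_coeff j * (c * x) ^ j / fact j * ip (F n) (\<lambda>y. y ^ j))\<bar>" for n
    have "(\<lambda>n. H (F n) x - (\<Sum>j<k. cas_coeff j * (c * x) ^ j / fact j * ip (F n) (\<lambda>y. y ^ j))) \<longlonglongrightarrow> 0 - (\<Sum>j<k. cas_coeff j * (c * x) ^ j / fact j * 0)"
      using x by (intro tendsto_diff tendsto_sum tendsto_mult tendsto_const less.IH pt) auto
    then have "R \<longlonglongrightarrow> 0" unfolding R_def by (intro tendsto_rabs_zero) simp
    moreover have "0 < e / 2 * ((c * x) ^ k / fact k)" using e x c_pos by simp
    ultimately have "\<forall>\<^sub>F n in sequentially. R n < e / 2 * ((c * x) ^ k / fact k)" by (rule order_tendstoD(2))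
    then obtain N where N: "\<And>n. n \<ge> N \<Longrightarrow> R n < e / 2 * ((c * x) ^ k / fact k)"
      unfolding eventually_sequentially by blast
    have "norm (ip (F n) (\<lambda>y. y ^ k) - 0) < e" if n: "n \<ge> N" for n
    proof -
      define m where "m = ip (F n) (\<lambda>y. y ^ k)"
      define q where "q = (c * x) ^ k / fact k"
      have q: "0 < q" unfolding q_def using x c_pos by simp
      have "\<bar>H (F n) x - (\<Sum>j\<le>k. cas_coeff j * (c * x) ^ j / fact j * ip (F n) (\<lambda>y. y ^ j))\<bar>
        \<le> 2 * (sqrt mass * sqrt (ip (F n) (F n))) * (\<bar>c * x\<bar> ^ Suc k / fact (Suc k))"
        by (rule H_Taylor[OF F])
      also have "\<dots> \<le> D * (\<bar>c * x\<bar> ^ Suc k / fact (Suc k))"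
        unfolding D_def using b[of n] mass_nonneg
        by (intro mult_right_mono mult_left_mono) (auto simp: nrm_def)
      also have "\<dots> = D * (c * x) * q / real (Suc k)"
        using x c_pos by (simp add: q_def field_simps)
      also have "\<dots> \<le> D * (c * x) * q"
      proof -
        have "0 \<le> D * (c * x) * q" using D x c_pos q by (intro mult_nonneg_nonneg) auto
        then have "D * (c * x) * q / real (Suc k) \<le> D * (c * x) * q / 1" by (intro divide_left_mono) auto
        then show ?thesis by simp
      qed
      also have "\<dots> \<le> e / 2 * q" using xe q by (intro mult_right_mono) (auto simp: mult.assoc)
      finally have 1: "\<bar>H (F n) x - (\<Sum>j\<le>k. cas_coeff j * (c * x) ^ j / fact j * ip (F n) (\<lambda>y. y ^ j))\<bar> \<le> e / 2 * q" .
      have "(\<Sum>j\<le>k. cas_coeff j * (c * x) ^ j / fact j * ip (F n) (\<lambda>y. y ^ j))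
        = (\<Sum>j<k. cas_coeff j * (c * x) ^ j / fact j * ip (F n) (\<lambda>y. y ^ j)) + cas_coeff k * q * m"
        by (simp add: q_def m_def flip: lessThan_Suc_atMost)
      with 1 N[OF n] have "\<bar>cas_coeff k * q * m\<bar> < e / 2 * q + e / 2 * q"
        unfolding R_def q_def[symmetric] by linarith
      then have "q * \<bar>m\<bar> < q * e" using q by (simp add: abs_mult abs_cas_coeff mult_ac)
      then show ?thesis using q by (simp add: m_def)
    qed
    then show "\<exists>N. \<forall>n\<ge>N. norm (ip (F n) (\<lambda>y. y ^ k) - 0) < e" by blast
  qed
qed

text \<open>The transforms share a Lipschitz constant, so the value at \<open>x\<close> is close to
  the mean over \<open>{x..x + d}\<close>, and the mean is controlled by the norm.\<close>

lemma H_pointwise_of_nrm: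
  assumes F: "\<And>n. F n \<in> Bd" and b: "\<And>n. nrm (F n) \<le> K"
    and lim: "(\<lambda>n. nrm (H (F n))) \<longlonglongrightarrow> 0" and x: "x \<in> {0<..<1}"
  shows "(\<lambda>n. H (F n) x) \<longlonglongrightarrow> 0"
proof (rule LIMSEQ_I)
  fix e :: real assume e: "0 < e"
  have K: "0 \<le> K" using b[of 0] nrm_nonneg[of "F 0"] by linarith
  define L where "L = 2 * c * sqrt mass * K"
  have L: "0 \<le> L" unfolding L_def using c_pos mass_nonneg K by simp
  \<comment> \<open>The first entry keeps the window inside the interval, the second makes the
    Lipschitz variation at most \<open>e / 2\<close>.\<close>
  define d where "d = min ((1 - x) / 2) (e / (2 * (L + 1)))"
  have d: "0 < d" "x + d < 1"
  proof -
    have "0 < (1 - x) / 2" "0 < e / (2 * (L + 1))" using x e L by auto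
    then show "0 < d" by (simp add: d_def)
    have "d \<le> (1 - x) / 2" unfolding d_def by (rule min.cobounded1)
    then show "x + d < 1" using x by auto
  qed
  have Ld: "L * d \<le> e / 2"
  proof -
    have "L * d \<le> (L + 1) * d" using d by simp
    also have "\<dots> \<le> (L + 1) * (e / (2 * (L + 1)))" using L by (intro mult_left_mono) (auto simp: d_def)
    also have "\<dots> = e / 2" using L by (simp add: field_simps)
    finally show ?thesis .
  qed
  define \<phi> where "\<phi> = (indicator {x..x + d} :: real \<Rightarrow> real)"
  have \<phi>B: "\<phi> \<in> Bd" unfolding \<phi>_def by (rule BdI[of _ 1]) (auto simp: indicator_def)
  define m where "m = ip \<phi> \<phi>"
  have mint: "m = (LINT y|M. \<phi> y)"
    unfolding m_def ip_def by (intro Bochner_Integration.integral_cong) (auto simp: \<phi>_def indicator_def)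
  have m: "0 < m"
  proof (rule ccontr)
    assume "\<not> 0 < m"
    then have "ip \<phi> \<phi> = 0" using ip_nonneg[of \<phi>] by (simp add: m_def)
    then have "AE y in M. \<phi> y = 0" by (rule ip_zero_AE[OF \<phi>B])
    then have "AE y in M. y \<in> {x<..<x + d} \<longrightarrow> (1::real) = 0"
      by eventually_elim (auto simp: \<phi>_def indicator_def)
    then have "(1::real) = 0"
      by (rule AE_zero_imp_zero[where f = "\<lambda>x. 1" and x = "x + d / 2", rotated]) (use d x in auto)
    then show False by simp
  qed
  have "0 < e / 2 * m / (nrm \<phi> + 1)" using e m by (simp add: add_nonneg_pos)
  with lim have "\<forall>\<^sub>F n in sequentially. nrm (H (F n)) < e / 2 * m / (nrm \<phi> + 1)" by (rule order_tendstoD(2))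
  then obtain N where N: "\<And>n. n \<ge> N \<Longrightarrow> nrm (H (F n)) < e / 2 * m / (nrm \<phi> + 1)"
    unfolding eventually_sequentially by blast
  have "norm (H (F n) x - 0) < e" if n: "n \<ge> N" for n
  proof -
    define u where "u = H (F n)"
    have uB: "u \<in> Bd" unfolding u_def using F by blast
    have "u x * m = ip u \<phi> + (LINT y|M. (u x - u y) * \<phi> y)"
    proof -
      have "(LINT y|M. (u x - u y) * \<phi> y) = (LINT y|M. u x * \<phi> y - u y * \<phi> y)" by (simp add: left_diff_distrib)
      also have "\<dots> = u x * m - ip u \<phi>"
        unfolding mint ip_def using uB \<phi>B by (subst Bochner_Integration.integral_diff) auto
      finally show ?thesis by simp
    qed
    moreover have "\<bar>ip u \<phi>\<bar> < e / 2 * m"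
    proof -
      have "\<bar>ip u \<phi>\<bar> \<le> nrm u * nrm \<phi>" by (rule ip_le_nrm[OF uB \<phi>B])
      also have "\<dots> \<le> nrm u * (nrm \<phi> + 1)" by (intro mult_left_mono) auto
      also have "\<dots> < e / 2 * m / (nrm \<phi> + 1) * (nrm \<phi> + 1)"
        using N[OF n] by (intro mult_strict_right_mono) (auto simp: u_def add_nonneg_pos)
      also have "\<dots> = e / 2 * m" 
      proof -
        have "nrm \<phi> + 1 \<noteq> 0" using nrm_nonneg[of \<phi>] by linarith
        then show ?thesis by (simp only: nonzero_eq_divide_eq times_divide_eq_left nonzero_mult_div_cancel_right not_False_eq_True)
      qed
      finally show ?thesis .
    qed
    moreover have "\<bar>LINT y|M. (u x - u y) * \<phi> y\<bar> \<le> (LINT y|M. L * d * \<phi> y)"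
    proof (rule order_trans[OF integral_abs_bound integral_mono])
      fix y assume "y \<in> space M"
      have "\<bar>u x - u y\<bar> \<le> L * d" if "y \<in> {x..x + d}"
      proof -
        have "\<bar>u x - u y\<bar> \<le> 2 * c * sqrt mass * nrm (F n) * \<bar>x - y\<bar>"
          unfolding u_def nrm_def by (rule H_Lipschitz[OF F])
        also have "\<dots> \<le> L * d"
        proof (rule mult_mono)
          show "2 * c * sqrt mass * nrm (F n) \<le> L" unfolding L_def
            using b[of n] c_pos mass_nonneg by (intro mult_left_mono) auto
          show "\<bar>x - y\<bar> \<le> d" using that by auto
        qed (use L in auto)
        finally show ?thesis .
      qed
      then show "\<bar>(u x - u y) * \<phi> y\<bar> \<le> L * d * \<phi> y" by (auto simp: \<phi>_def indicator_def)
    qed (use uB \<phi>B in \<open>auto intro!: integrable_abs\<close>)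
    moreover have "(LINT y|M. L * d * \<phi> y) \<le> e / 2 * m"
      using Ld m by (simp add: mint[symmetric])
    ultimately have "\<bar>u x * m\<bar> < e * m" by linarith
    then show ?thesis using m by (simp add: abs_mult u_def)
  qed
  then show "\<exists>N. \<forall>n\<ge>N. norm (H (F n) x - 0) < e" by blast
qed

text \<open>The residuals \<open>F n\<close> beyond level \<open>1 / (n + 1)\<close> have transforms
  tending to 0, so their moments, and their inner products with a polynomial close to
  \<open>f\<close>, tend to 0. As \<open>F n\<close> is orthogonal to the part removed, its squared
  norm is \<open>ip (F n) f\<close>. All larger finite sets are covered so that chosen indices can
  be adjoined.\<close>

lemma completeness:
  assumes f: "approximable f" and e: "0 < e"
  obtains S where "finite S" "S \<subseteq> spec" "\<And>T. finite T \<Longrightarrow> S \<subseteq> T \<Longrightarrow> T \<subseteq> spec \<Longrightarrow>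
    ip (residual T efun f) (residual T efun f) < e"
proof -
  have fB: "f \<in> Bd" using f by (simp add: approximable_def)
  define t where "t n = inverse (real (Suc n))" for n
  have t: "0 < t n" for n by (simp add: t_def)
  define F where "F n = residual (level (t n)) efun f" for n
  have on: "orthonormal_on (level (t n)) efun" for n by (rule efun_orthonormal[OF level_sub])
  have FB: "F n \<in> Bd" for n unfolding F_def using on fB by blast
  have Fb: "nrm (F n) \<le> nrm f" for n
    unfolding nrm_def F_def residual_sq[OF on fB finite_level[OF t]]
    by (intro real_sqrt_le_mono) (simp add: sum_nonneg)
  have HF: "nrm (H (F n)) \<le> sqrt (t n) * nrm f" for n
  proof -
    have "ip (H (F n)) (H (F n)) \<le> t n * ip (F n) (F n)"
      unfolding F_def by (rule H_bound_above_level[OF t])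
        (use on fB ip_residual_basis[OF on fB finite_level[OF t]] in auto)
    then have "nrm (H (F n)) \<le> sqrt (t n) * nrm (F n)"
      unfolding nrm_def using real_sqrt_le_mono by (fastforce simp: real_sqrt_mult)
    also have "\<dots> \<le> sqrt (t n) * nrm f" using t[of n] Fb by (intro mult_left_mono) auto
    finally show ?thesis .
  qed
  have tlim: "t \<longlonglongrightarrow> 0" unfolding t_def by (rule LIMSEQ_inverse_real_of_nat)
  have HHF: "(\<lambda>n. nrm (H (F n))) \<longlonglongrightarrow> 0"
  proof (rule Lim_null_comparison)
    show "\<forall>\<^sub>F n in sequentially. norm (nrm (H (F n))) \<le> sqrt (t n) * nrm f" using HF by simp
    show "(\<lambda>n. sqrt (t n) * nrm f) \<longlonglongrightarrow> 0"
      using tendsto_mult_left_zero[of "\<lambda>n. sqrt (t n)" sequentially "nrm f"] tendsto_real_sqrt[OF tlim] by simp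
  qed
  have mom: "(\<lambda>n. ip (F n) (\<lambda>y. y ^ k)) \<longlonglongrightarrow> 0" for k
    by (rule moments_tendsto_zero[OF FB Fb H_pointwise_of_nrm[OF FB Fb HHF]])
  define d where "d = e / (2 * (nrm f + 1))"
  have nf: "0 < nrm f + 1" by (simp add: add_nonneg_pos)
  have d: "0 < d" unfolding d_def using e nf by simp
  obtain a m where am: "nrm (\<lambda>x. f x - (\<Sum>k\<le>(m::nat). a k * x ^ k)) < d"
    using f d unfolding approximable_def by blast
  define q where "q = (\<lambda>x::real. \<Sum>k\<le>m. a k * x ^ k)"
  have qB: "q \<in> Bd" unfolding q_def by (intro Bd_sum Bd_cmult Bd_power Bd_id)
  have "(\<lambda>n. \<Sum>k\<le>m. a k * ip (F n) (\<lambda>y. y ^ k)) \<longlonglongrightarrow> (\<Sum>k\<le>m. a k * 0)"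
    by (intro tendsto_sum tendsto_mult tendsto_const mom)
  moreover have "ip (F n) q = (\<Sum>k\<le>m. a k * ip (F n) (\<lambda>y. y ^ k))" for n
    unfolding q_def using FB[of n]
    by (subst ip_sum_right, (intro Bd_cmult Bd_power Bd_id | assumption)+) (simp only: ip_scale_right)
  ultimately have "(\<lambda>n. ip (F n) q) \<longlonglongrightarrow> 0" by simp
  then have "\<forall>\<^sub>F n in sequentially. ip (F n) q < e / 2" using e by (intro order_tendstoD(2)) auto
  then obtain n where n: "ip (F n) q < e / 2" by (meson eventually_sequentially order_refl)
  have Fn: "ip (F n) (F n) = ip f f - (\<Sum>\<kappa>\<in>level (t n). (ip f (efun \<kappa>))\<^sup>2)"
    unfolding F_def by (rule residual_sq[OF on fB finite_level[OF t]])
  also have "\<dots> = ip (F n) f"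
    unfolding F_def ip_residual[OF on fB fB] by (simp add: power2_eq_square)
  also have "\<dots> = ip (F n) q + ip (F n) (\<lambda>x. f x - q x)"
    using FB fB qB by (simp add: ip_diff_right)
  also have "\<dots> < e / 2 + (nrm f + 1) * d"
  proof -
    have "ip (F n) (\<lambda>x. f x - q x) \<le> nrm (F n) * nrm (\<lambda>x. f x - q x)"
      using ip_le_nrm[of "F n" "\<lambda>x. f x - q x"] FB fB qB by simp
    also have "\<dots> \<le> (nrm f + 1) * d"
      using Fb[of n] am by (intro mult_mono) (auto simp: q_def)
    finally show ?thesis using n by linarith
  qed
  also have "\<dots> = e" unfolding d_def using nf by (simp add: field_simps)
  finally have less: "ip f f - (\<Sum>\<kappa>\<in>level (t n). (ip f (efun \<kappa>))\<^sup>2) < e" using Fn by simp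
  show ?thesis
  proof (rule that[of "level (t n)"])
    fix T assume T: "finite T" "level (t n) \<subseteq> T" "T \<subseteq> spec"
    have "(\<Sum>\<kappa>\<in>level (t n). (ip f (efun \<kappa>))\<^sup>2) \<le> (\<Sum>\<kappa>\<in>T. (ip f (efun \<kappa>))\<^sup>2)"
      using T by (intro sum_mono2) auto
    then show "ip (residual T efun f) (residual T efun f) < e"
      unfolding residual_sq[OF efun_orthonormal[OF T(3)] fB T(1)] using less by linarith
  qed (use finite_level[OF t] level_sub in auto)
qed

end

section \<open>The Wronskian of consecutive eigenfunctions\<close>

lemma constant_sign:
  fixes f :: "real \<Rightarrow> real"
  assumes "continuous_on UNIV f" "a < b" "\<And>x. x \<in> {a<..<b} \<Longrightarrow> f x \<noteq> 0"
  obtains s where "s\<^sup>2 = 1" "\<And>x. x \<in> {a<..<b} \<Longrightarrow> 0 < s * f x"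
proof -
  define s where "s = sgn (f ((a + b) / 2))"
  have m: "(a + b) / 2 \<in> {a<..<b}" using assms(2) by auto
  have s2: "s\<^sup>2 = 1" unfolding s_def using assms(3)[OF m] by (simp add: sgn_if)
  have "0 < s * f x" if x: "x \<in> {a<..<b}" for x
  proof (rule ccontr)
    assume "\<not> 0 < s * f x"
    then have neg: "s * f x \<le> 0" by simp
    have pos: "0 < s * f ((a + b) / 2)" unfolding s_def using assms(3)[OF m] by (simp add: sgn_if)
    have con: "connected ((\<lambda>x. s * f x) ` {a<..<b})"
      by (intro connected_continuous_image continuous_intros continuous_on_subset[OF assms(1)]) auto
    have "0 \<in> (\<lambda>x. s * f x) ` {a<..<b}"
      by (rule connectedD_interval[OF con, of "s * f x" "s * f ((a + b) / 2)"]) (use x m neg pos in auto)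
    then obtain y where "y \<in> {a<..<b}" "s * f y = 0" by auto
    then show False using assms(3) s2 by auto
  qed
  then show ?thesis using that s2 by blast
qed

context hartley begin

lemma approximable_continuous:
  assumes "continuous_on UNIV f" shows "approximable f"
  unfolding approximable_def
proof (intro conjI allI impI)
  show fB: "f \<in> Bd" by (rule Bd_cont[OF assms])
  fix e :: real assume e: "0 < e"
  define d where "d = e / (sqrt mass + 1)"
  have sm: "0 < sqrt mass + 1" using mass_nonneg by (simp add: add_nonneg_pos)
  have d: "0 < d" using e sm by (simp add: d_def)
  obtain g where g: "real_polynomial_function g" "\<And>x. x \<in> {-1..1} \<Longrightarrow> \<bar>f x - g x\<bar> < d"
    using Stone_Weierstrass_real_polynomial_function[OF compact_Icc continuous_on_subset[OF assms subset_UNIV] d] by blast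
  obtain a n where an: "g = (\<lambda>x. \<Sum>k\<le>n. a k * x ^ k)"
    using g(1) real_polynomial_function_iff_sum by blast
  have gB: "g \<in> Bd" unfolding an by (intro Bd_sum Bd_cmult Bd_power Bd_id)
  have "ip (\<lambda>x. f x - g x) (\<lambda>x. f x - g x) \<le> d\<^sup>2 * mass"
    by (rule ip_le_sup) (use fB gB g(2) in \<open>auto intro: less_imp_le\<close>)
  then have "nrm (\<lambda>x. f x - g x) \<le> sqrt (d\<^sup>2 * mass)" unfolding nrm_def by (rule real_sqrt_le_mono)
  also have "\<dots> = d * sqrt mass" using d by (simp add: real_sqrt_mult)
  also have "\<dots> < d * (sqrt mass + 1)" using d by simp
  also have "\<dots> = e" using sm by (simp add: d_def)
  finally have "nrm (\<lambda>x. f x - (\<Sum>k\<le>n. a k * x ^ k)) < e" unfolding an .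
  then show "\<exists>a n. nrm (\<lambda>x. f x - (\<Sum>k\<le>(n::nat). a k * x ^ k)) < e" by (intro exI)
qed

lemma approximable_closure:
  assumes f: "f \<in> Bd" and g: "\<And>n. approximable (g n)" and lim: "(\<lambda>n. nrm (\<lambda>x. f x - g n x)) \<longlonglongrightarrow> 0"
  shows "approximable f"
  unfolding approximable_def
proof (intro conjI allI impI)
  show "f \<in> Bd" by (rule f)
  fix e :: real assume e: "0 < e"
  have "\<forall>\<^sub>F n in sequentially. nrm (\<lambda>x. f x - g n x) < e / 2" using lim e by (intro order_tendstoD(2)) auto
  then obtain n where n: "nrm (\<lambda>x. f x - g n x) < e / 2" unfolding eventually_sequentially by blast
  obtain a m where am: "nrm (\<lambda>x. g n x - (\<Sum>k\<le>(m::nat). a k * x ^ k)) < e / 2"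
    using g[of n] e unfolding approximable_def by (meson half_gt_zero)
  have "nrm (\<lambda>x. f x - (\<Sum>k\<le>m. a k * x ^ k)) \<le> nrm (\<lambda>x. f x - g n x) + nrm (\<lambda>x. g n x - (\<Sum>k\<le>m. a k * x ^ k))"
    by (rule nrm_diff_triangle[OF f])
       (use g[of n] in \<open>auto simp: approximable_def intro!: Bd_sum Bd_cmult Bd_power Bd_id\<close>)
  then show "\<exists>a n. nrm (\<lambda>x. f x - (\<Sum>k\<le>(n::nat). a k * x ^ k)) < e" using n am by (intro exI[of _ a] exI[of _ m]) linarith
qed

lemma approximable_cutoff:
  assumes v: "continuous_on UNIV v" shows "approximable (\<lambda>x. v x * indicator {a..} x)"
proof -
  \<comment> \<open>Continuous ramps rising from 0 at \<open>a - 1 / (n + 1)\<close> to 1 at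
    \<open>a\<close>; they agree with the indicator from \<open>a\<close> on.\<close>
  define \<rho> where "\<rho> n x = max 0 (min 1 (1 + real (Suc n) * (x - a)))" for n x
  have cont: "continuous_on UNIV (\<lambda>x. v x * \<rho> n x)" for n
    unfolding \<rho>_def by (intro continuous_intros v)
  have vB: "v \<in> Bd" by (rule Bd_cont[OF v])
  obtain K where K: "0 \<le> K" "\<And>x. x \<in> {-1..1} \<Longrightarrow> \<bar>v x\<bar> \<le> K" using Bd_bound[OF vB] by blast
  define d where "d n x = v x * indicator {a..} x - v x * \<rho> n x" for n x
  have dB: "d n \<in> Bd" for n unfolding d_def using vB Bd_cont[OF cont] by auto
  have "(\<lambda>n. LINT x|M. d n x * d n x) \<longlonglongrightarrow> (LINT x|M. 0)"
  proof (rule integral_dominated_convergence[where w = "\<lambda>x. K * K"])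
    show "(\<lambda>x. d n x * d n x) \<in> borel_measurable M" for n
      by (intro borel_measurable_wmeas Bd_measurable Bd_mult dB)
    show "AE x in M. norm (d n x * d n x) \<le> K * K" for n
    proof (rule AE_I2)
      fix x assume "x \<in> space M"
      then have x: "x \<in> {-1..1}" by simp
      have "\<bar>d n x\<bar> = \<bar>v x\<bar> * \<bar>indicator {a..} x - \<rho> n x\<bar>"
        unfolding d_def by (simp add: abs_mult flip: right_diff_distrib)
      also have "\<dots> \<le> K * 1" using K(2)[OF x] K(1)
        by (intro mult_mono) (auto simp: \<rho>_def indicator_def)
      finally have "\<bar>d n x\<bar> \<le> K" by simp
      then show "norm (d n x * d n x) \<le> K * K" unfolding norm_mult by (intro mult_mono) auto
    qed
    show "AE x in M. (\<lambda>n. d n x * d n x) \<longlonglongrightarrow> 0"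
    proof (rule AE_I2)
      fix x
      show "(\<lambda>n. d n x * d n x) \<longlonglongrightarrow> 0"
      proof (cases "a \<le> x")
        case True
        then have "d n x = 0" for n by (simp add: d_def \<rho>_def)
        then show ?thesis by simp
      next
        case False
        obtain N where N: "1 / (a - x) < real N" using reals_Archimedean2 by blast
        have "d n x * d n x = 0" if "n \<ge> N" for n
        proof -
          have "1 / (a - x) < real (Suc n)" using N that by linarith
          then have "1 < real (Suc n) * (a - x)" using False by (simp add: field_simps)
          then have "1 + real (Suc n) * (x - a) < 0" by (simp add: algebra_simps)
          then show ?thesis using False by (simp add: d_def \<rho>_def)
        qed
        then have "\<forall>\<^sub>F n in sequentially. d n x * d n x = 0" unfolding eventually_sequentially by blast
        then show ?thesis by (rule tendsto_eventually)
      qed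
    qed
  qed auto
  then have "(\<lambda>n. nrm (d n)) \<longlonglongrightarrow> 0"
    unfolding nrm_def ip_def using tendsto_real_sqrt[of _ "LINT x|M. 0"] by simp
  then show ?thesis
    unfolding d_def
    by (rule approximable_closure[rotated 2, of _ "\<lambda>n x. v x * \<rho> n x"])
       (rule Bd_cutoff[OF vB], rule approximable_continuous[OF cont])
qed

text \<open>By completeness for \<open>a\<close> the products sum to \<open>ip a b = 0\<close>;
  being nonnegative, each of them vanishes.\<close>

lemma Parseval_terms_zero:
  assumes a: "approximable a" and b: "b \<in> Bd" and ab: "ip a b = 0"
    and nn: "\<And>\<eta>. \<eta> \<in> spec \<Longrightarrow> 0 \<le> ip a (efun \<eta>) * ip b (efun \<eta>)" and \<eta>: "\<eta> \<in> spec"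
  shows "ip a (efun \<eta>) * ip b (efun \<eta>) = 0"
proof -
  have aB: "a \<in> Bd" using a by (simp add: approximable_def)
  have "ip a (efun \<eta>) * ip b (efun \<eta>) \<le> 0 + e" if e: "0 < e" for e
  proof -
    define d where "d = e / (nrm b + 1)"
    have nb: "0 < nrm b + 1" by (simp add: add_nonneg_pos)
    have d: "0 < d" unfolding d_def using e nb by simp
    obtain S where S: "finite S" "S \<subseteq> spec" "\<And>T. finite T \<Longrightarrow> S \<subseteq> T \<Longrightarrow> T \<subseteq> spec \<Longrightarrow>
      ip (residual T efun a) (residual T efun a) < d\<^sup>2"
      using completeness[OF a, of "d\<^sup>2"] d by (metis zero_less_power)
    define T where "T = insert \<eta> S"
    have T: "finite T" "T \<subseteq> spec" "S \<subseteq> T" using S \<eta> by (auto simp: T_def)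
    note on = efun_orthonormal[OF T(2)]
    have "nrm (residual T efun a) \<le> d"
      unfolding nrm_def using S(3)[OF T(1) T(3) T(2)] d by (intro real_le_lsqrt) auto
    moreover have "\<bar>ip (residual T efun a) b\<bar> \<le> nrm (residual T efun a) * nrm b"
      using on aB b by (intro ip_le_nrm) auto
    ultimately have "\<bar>ip (residual T efun a) b\<bar> \<le> d * (nrm b + 1)"
      using d by (smt (verit) mult_mono nrm_nonneg)
    then have "\<bar>ip (residual T efun a) b\<bar> \<le> e" using nb by (simp add: d_def)
    moreover have "ip (residual T efun a) b = - (\<Sum>i\<in>T. ip a (efun i) * ip b (efun i))"
      using ip_residual[OF on aB b] ab by simp
    moreover have "ip a (efun \<eta>) * ip b (efun \<eta>) \<le> (\<Sum>i\<in>T. ip a (efun i) * ip b (efun i))"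
      using T nn by (intro member_le_sum) (auto simp: T_def)
    ultimately show ?thesis by linarith
  qed
  then have "ip a (efun \<eta>) * ip b (efun \<eta>) \<le> 0" by (rule field_le_epsilon)
  then show ?thesis using nn[OF \<eta>] by linarith
qed

lemma single_coefficient:
  assumes a: "approximable a" and \<kappa>: "\<kappa> \<in> spec" and z: "\<And>\<eta>. \<eta> \<in> spec \<Longrightarrow> \<eta> \<noteq> \<kappa> \<Longrightarrow> ip a (efun \<eta>) = 0"
  shows "ip (\<lambda>x. a x - ip a (efun \<kappa>) * efun \<kappa> x) (\<lambda>x. a x - ip a (efun \<kappa>) * efun \<kappa> x) = 0"
proof -
  have "ip (\<lambda>x. a x - ip a (efun \<kappa>) * efun \<kappa> x) (\<lambda>x. a x - ip a (efun \<kappa>) * efun \<kappa> x) \<le> 0 + e" if e: "0 < e" for e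
  proof -
    obtain S where S: "finite S" "S \<subseteq> spec" "\<And>T. finite T \<Longrightarrow> S \<subseteq> T \<Longrightarrow> T \<subseteq> spec \<Longrightarrow>
      ip (residual T efun a) (residual T efun a) < e"
      using completeness[OF a e] by metis
    define T where "T = insert \<kappa> S"
    have T: "finite T" "T \<subseteq> spec" "S \<subseteq> T" using S \<kappa> by (auto simp: T_def)
    have "residual T efun a x = a x - ip a (efun \<kappa>) * efun \<kappa> x" for x
    proof -
      have "(\<Sum>i\<in>T. ip a (efun i) * efun i x) = (\<Sum>i\<in>T. if i = \<kappa> then ip a (efun \<kappa>) * efun \<kappa> x else 0)"
        using T z by (intro sum.cong) auto
      then show ?thesis using T(1) by (simp add: residual_def T_def)
    qed
    then have "residual T efun a = (\<lambda>x. a x - ip a (efun \<kappa>) * efun \<kappa> x)" by auto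
    then show ?thesis using S(3)[OF T(1) T(3) T(2)] by simp
  qed
  then have "ip (\<lambda>x. a x - ip a (efun \<kappa>) * efun \<kappa> x) (\<lambda>x. a x - ip a (efun \<kappa>) * efun \<kappa> x) \<le> 0"
    by (rule field_le_epsilon)
  then show ?thesis using ip_nonneg[of "\<lambda>x. a x - ip a (efun \<kappa>) * efun \<kappa> x"] by linarith
qed

lemma efun_interval_nonzero:
  assumes \<kappa>: "\<kappa> \<in> spec" and lr: "-1 \<le> l" "l < r" "r \<le> 1"
  obtains l' r' where "l \<le> l'" "l' < r'" "r' \<le> r" "\<And>x. x \<in> {l'<..<r'} \<Longrightarrow> efun \<kappa> x \<noteq> 0"
proof -
  note j = efun[OF \<kappa>]
  obtain z where z: "efun \<kappa> z \<noteq> 0" using jeig_nonzero[OF j] .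
  then have "H (\<lambda>x. 1 / ev \<kappa> * efun \<kappa> x) z \<noteq> 0" unfolding jeigD(6)[OF j, symmetric] .
  from interval_nonzero[OF jeigD(7)[OF j] this lr] that
  show ?thesis unfolding jeigD(6)[OF j, symmetric] by blast
qed

text \<open>An eigenfunction has no interval of zeros. Left of \<open>x0\<close> the cut-off term is
  absent, which forces \<open>k = 0\<close>; right of \<open>x0\<close> this leaves
  \<open>t = 0\<close>.\<close>

lemma cutoff_not_multiple:
  assumes \<kappa>: "\<kappa> \<in> spec" and x0: "x0 \<in> {-1<..<1}"
    and null: "ip (\<lambda>x. t * efun \<kappa> x * indicator {x0..} x - k * efun \<kappa> x) (\<lambda>x. t * efun \<kappa> x * indicator {x0..} x - k * efun \<kappa> x) = 0"
  shows "t = 0"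
proof -
  have vB: "efun \<kappa> \<in> Bd" and vC: "continuous_on UNIV (efun \<kappa>)"
    using jeigD[OF efun[OF \<kappa>]] C2_cont(1) by auto
  have ae: "AE x in M. t * efun \<kappa> x * indicator {x0..} x - k * efun \<kappa> x = 0"
    by (rule ip_zero_AE[OF _ null]) (use vB in auto)
  have "k = 0"
  proof -
    obtain l r where lr: "-1 \<le> l" "l < r" "r \<le> x0" "\<And>x. x \<in> {l<..<r} \<Longrightarrow> efun \<kappa> x \<noteq> 0"
      using efun_interval_nonzero[OF \<kappa>, of "-1" x0] x0 by auto
    have "AE x in M. x \<in> {l<..<r} \<longrightarrow> k * efun \<kappa> x = 0"
      using ae by eventually_elim (use lr in \<open>auto simp: indicator_def\<close>)
    then have "k * efun \<kappa> ((l + r) / 2) = 0"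
      by (rule AE_zero_imp_zero[rotated]) (use vC lr x0 in \<open>auto intro!: continuous_intros\<close>)
    then show ?thesis using lr(4)[of "(l + r) / 2"] lr(2) by auto
  qed
  obtain l r where lr: "x0 \<le> l" "l < r" "r \<le> 1" "\<And>x. x \<in> {l<..<r} \<Longrightarrow> efun \<kappa> x \<noteq> 0"
    using efun_interval_nonzero[OF \<kappa>, of x0 1] x0 by auto
  have "AE x in M. x \<in> {l<..<r} \<longrightarrow> t * efun \<kappa> x = 0"
    using ae by eventually_elim (use lr \<open>k = 0\<close> in \<open>auto simp: indicator_def\<close>)
  then have "t * efun \<kappa> ((l + r) / 2) = 0"
    by (rule AE_zero_imp_zero[rotated]) (use vC lr x0 in \<open>auto intro!: continuous_intros\<close>)
  then show ?thesis using lr(4)[of "(l + r) / 2"] lr(2) by auto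
qed

lemma ip_cutoff_efun:
  assumes u: "jeig u \<kappa> \<nu>" and v: "jeig v \<eta> \<mu>" and x0: "x0 \<in> {-1..1}"
  shows "(\<kappa> - \<eta>) * ip (\<lambda>x. u x * indicator {x0..} x) v = - (p x0 * wronskian u v x0)"
proof -
  have "(\<kappa> - \<eta>) * ip (\<lambda>x. u x * indicator {x0..} x) v = (LINT x|M. (Lop u x * v x - u x * Lop v x) * indicator {x0..} x)"
    unfolding ip_def jeigD(4)[OF u] jeigD(4)[OF v]
    by (subst integral_mult_right_zero[symmetric]) (simp add: algebra_simps)
  then show ?thesis using Green[OF jeigD(8)[OF u] jeigD(8)[OF v] x0] by simp
qed

text \<open>Adjacency makes \<open>(\<kappa>' - \<eta>) (\<kappa> - \<eta>)\<close> nonnegative on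
  the spectrum, so the relation between the coefficients of \<open>a\<close> and \<open>b\<close>
  makes all their products nonnegative. These sum to \<open>ip a b = 0\<close>, so all vanish:
  \<open>a\<close> keeps only its component along \<open>v\<close>, and \<open>b\<close> only the
  one along \<open>u\<close>. A nonzero cut-off cannot be such a multiple.\<close>

lemma wronskian_nonzero:
  assumes \<kappa>: "\<kappa> \<in> spec" and \<kappa>': "\<kappa>' \<in> spec" and less: "\<kappa> < \<kappa>'"
    and adj: "\<And>\<eta>. \<eta> \<in> spec \<Longrightarrow> \<eta> \<le> \<kappa> \<or> \<kappa>' \<le> \<eta>" and x0: "x0 \<in> {-1<..<1}"
  shows "wronskian (efun \<kappa>) (efun \<kappa>') x0 \<noteq> 0"
proof
  assume W0: "wronskian (efun \<kappa>) (efun \<kappa>') x0 = 0"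
  define u where "u = efun \<kappa>"
  define v where "v = efun \<kappa>'"
  have ju: "jeig u \<kappa> (ev \<kappa>)" and jv: "jeig v \<kappa>' (ev \<kappa>')" using efun \<kappa> \<kappa>' by (auto simp: u_def v_def)
  note uB = jeigD(1)[OF ju] and vB = jeigD(1)[OF jv]
  have x0': "x0 \<in> {-1..1}" using x0 by auto
  \<comment> \<open>A vanishing Wronskian means that the pairs of value and derivative at
    \<open>x0\<close> are linearly dependent.\<close>
  have "\<exists>s t. (s \<noteq> 0 \<or> t \<noteq> 0) \<and> s * u x0 = t * v x0 \<and> s * deriv u x0 = t * deriv v x0"
  proof (cases "u x0 = 0 \<and> deriv u x0 = 0")
    case True then show ?thesis by (intro exI[of _ 1] exI[of _ 0]) simp
  next
    case False
    then show ?thesis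
    proof (cases "u x0 = 0")
      case True
      with False W0 show ?thesis
        by (intro exI[of _ "deriv v x0"] exI[of _ "deriv u x0"]) (simp add: wronskian_def u_def v_def)
    next
      case False
      with W0 show ?thesis
        by (intro exI[of _ "v x0"] exI[of _ "u x0"]) (simp add: wronskian_def u_def v_def algebra_simps)
    qed
  qed
  then obtain s t where st: "s \<noteq> 0 \<or> t \<noteq> 0" "s * u x0 = t * v x0" "s * deriv u x0 = t * deriv v x0" by blast
  define a where "a = (\<lambda>x. t * v x * indicator {x0..} x)"
  define b where "b = (\<lambda>x. s * u x * indicator {x0..} x)"
  have aA: "approximable a" unfolding a_def
    by (rule approximable_cutoff) (use jeigD(8)[OF jv] C2_cont(1) in \<open>auto intro!: continuous_intros\<close>)
  have bA: "approximable b" unfolding b_def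
    by (rule approximable_cutoff) (use jeigD(8)[OF ju] C2_cont(1) in \<open>auto intro!: continuous_intros\<close>)
  have aB: "a \<in> Bd" and bB: "b \<in> Bd" using aA bA by (auto simp: approximable_def)
  have a_ip: "ip a f = t * ip (\<lambda>x. v x * indicator {x0..} x) f" for f
    by (simp add: a_def mult.assoc)
  have b_ip: "ip b f = s * ip (\<lambda>x. u x * indicator {x0..} x) f" for f
    by (simp add: b_def mult.assoc)
  have key: "(\<kappa>' - \<eta>) * ip a (efun \<eta>) = (\<kappa> - \<eta>) * ip b (efun \<eta>)" if "\<eta> \<in> spec" for \<eta>
  proof -
    have "(\<kappa>' - \<eta>) * ip a (efun \<eta>) = - (p x0 * (t * wronskian v (efun \<eta>) x0))"
      unfolding a_ip using ip_cutoff_efun[OF jv efun[OF that] x0'] by (simp add: mult.left_commute)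
    \<comment> \<open>A Wronskian at \<open>x0\<close> sees only the value and first derivative
      there, and these agree for \<open>t v\<close> and \<open>s u\<close>.\<close>
    also have "t * wronskian v (efun \<eta>) x0 = s * wronskian u (efun \<eta>) x0"
      using st(2,3) by (simp add: wronskian_def right_diff_distrib flip: mult.assoc)
    also have "- (p x0 * (s * wronskian u (efun \<eta>) x0)) = (\<kappa> - \<eta>) * ip b (efun \<eta>)"
      unfolding b_ip using ip_cutoff_efun[OF ju efun[OF that] x0'] by (simp add: mult.left_commute)
    finally show ?thesis .
  qed
  have nn: "0 \<le> ip a (efun \<eta>) * ip b (efun \<eta>)" if \<eta>: "\<eta> \<in> spec" for \<eta>
  proof -
    consider "\<eta> = \<kappa>" | "\<eta> = \<kappa>'" | "0 < (\<kappa>' - \<eta>) * (\<kappa> - \<eta>)"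
      using adj[OF \<eta>] less by (smt (verit) mult_neg_neg mult_pos_pos)
    then show ?thesis
    proof cases
      case 1 then show ?thesis using key[OF \<eta>] less by simp
    next
      case 2 then show ?thesis using key[OF \<eta>] less by simp
    next
      case 3
      have "((\<kappa>' - \<eta>) * (\<kappa> - \<eta>)) * (ip a (efun \<eta>) * ip b (efun \<eta>)) = ((\<kappa>' - \<eta>) * ip a (efun \<eta>)) * ((\<kappa> - \<eta>) * ip b (efun \<eta>))"
        by (simp add: mult_ac)
      also have "\<dots> = ((\<kappa> - \<eta>) * ip b (efun \<eta>))\<^sup>2" by (simp add: key[OF \<eta>] power2_eq_square)
      finally have "0 \<le> ((\<kappa>' - \<eta>) * (\<kappa> - \<eta>)) * (ip a (efun \<eta>) * ip b (efun \<eta>))" by simp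
      then show ?thesis using 3 by (simp add: zero_le_mult_iff)
    qed
  qed
  have ab: "ip a b = 0"
  proof -
    \<comment> \<open>The boundary term of Green's identity for \<open>u\<close> and
      \<open>v\<close> at \<open>x0\<close> is 0 by assumption, and \<kappa> differs from
      \<kappa>'.\<close>
    have "ip (\<lambda>x. v x * indicator {x0..} x) u = 0"
      using ip_cutoff_efun[OF ju jv x0'] ip_cutoff_efun[OF jv ju x0'] W0 less
      by (simp add: wronskian_def u_def v_def mult.commute)
    moreover have "ip a b = t * s * ip (\<lambda>x. v x * indicator {x0..} x) u"
      unfolding a_def b_def ip_def
      by (subst integral_mult_right_zero[symmetric])
         (intro Bochner_Integration.integral_cong, auto simp: indicator_def)
    ultimately show ?thesis by simp
  qed
  have prod0: "ip a (efun \<eta>) = 0 \<or> ip b (efun \<eta>) = 0" if "\<eta> \<in> spec" for \<eta>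
    using Parseval_terms_zero[OF aA bB ab nn that] by auto
  have a0: "ip a (efun \<eta>) = 0" if "\<eta> \<in> spec" "\<eta> \<noteq> \<kappa>'" for \<eta>
    using prod0[OF that(1)] key[OF that(1)] that(2) by auto
  have b0: "ip b (efun \<eta>) = 0" if "\<eta> \<in> spec" "\<eta> \<noteq> \<kappa>" for \<eta>
    using prod0[OF that(1)] key[OF that(1)] that(2) by auto
  have "t = 0"
    using cutoff_not_multiple[OF \<kappa>' x0, of t "ip a (efun \<kappa>')"] single_coefficient[OF aA \<kappa>' a0]
    by (simp add: a_def v_def)
  moreover have "s = 0"
    using cutoff_not_multiple[OF \<kappa> x0, of s "ip b (efun \<kappa>)"] single_coefficient[OF bA \<kappa> b0]
    by (simp add: b_def u_def)
  ultimately show False using st(1) by simp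
qed

end

section \<open>Simplicity of the eigenvalues\<close>

lemma nonneg_on_closed_interval:
  fixes f :: "real \<Rightarrow> real"
  assumes "continuous_on UNIV f" "a < b" "\<And>x. x \<in> {a<..<b} \<Longrightarrow> 0 < f x" "x \<in> {a..b}"
  shows "0 \<le> f x"
proof -
  have "x \<in> closure {a<..<b}" using assms by simp
  moreover have "closure {a<..<b} \<subseteq> {x. 0 \<le> f x}"
  proof (rule closure_minimal)
    show "closed {x. 0 \<le> f x}" using assms(1) by (intro closed_Collect_le) auto
  qed (use assms(3) in \<open>auto intro: less_imp_le\<close>)
  ultimately show ?thesis by auto
qed

lemma deriv_nonneg_left_end:
  fixes f :: "real \<Rightarrow> real"
  assumes "(f has_real_derivative D) (at a)" "f a = 0" "a < b" "\<And>x. x \<in> {a<..<b} \<Longrightarrow> 0 < f x"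
  shows "0 \<le> D"
proof (rule ccontr)
  assume "\<not> 0 \<le> D"
  then obtain d where d: "d > 0" "\<And>h. 0 < h \<Longrightarrow> h < d \<Longrightarrow> f (a + h) < f a"
    using DERIV_neg_dec_right[OF assms(1)] by auto
  define h where "h = min (d / 2) ((b - a) / 2)"
  have h: "0 < h" "h < d" "a + h < b" unfolding h_def using d assms(3) by (auto simp: min_def field_simps)
  show False using d(2)[OF h(1,2)] assms(4)[of "a + h"] assms(2) h by auto
qed

lemma deriv_nonpos_right_end:
  fixes f :: "real \<Rightarrow> real"
  assumes "(f has_real_derivative D) (at b)" "f b = 0" "a < b" "\<And>x. x \<in> {a<..<b} \<Longrightarrow> 0 < f x"
  shows "D \<le> 0"
proof -
  have "((\<lambda>x. f (- x)) has_real_derivative - D) (at (- b))"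
    using assms(1) by (simp add: DERIV_mirror)
  then have "0 \<le> - D"
    by (rule deriv_nonneg_left_end[where b = "- a"]) (use assms in auto)
  then show ?thesis by simp
qed

context hartley begin

text \<open>If \<open>v\<close> had no zero, \<open>p\<close> times the Wronskian, with signs
  normalised, would be strictly decreasing, yet at most 0 at the left end and at least 0 at the
  right end. An end at -1 or 1 contributes 0 through \<open>p\<close>, a zero of \<open>u\<close>
  through the sign of \<open>u'\<close>.\<close>

lemma Sturm_interval:
  assumes u: "jeig u \<kappa> \<nu>" and v: "jeig v \<kappa>' \<nu>'" and less: "\<kappa> < \<kappa>'"
    and ab: "-1 \<le> a" "a < b" "b \<le> 1" and ua: "a = -1 \<or> u a = 0" and ub: "b = 1 \<or> u b = 0"
    and nz: "\<And>x. x \<in> {a<..<b} \<Longrightarrow> u x \<noteq> 0"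
  shows "\<exists>x\<in>{a<..<b}. v x = 0"
proof (rule ccontr)
  assume "\<not> ?thesis"
  then have vz: "\<And>x. x \<in> {a<..<b} \<Longrightarrow> v x \<noteq> 0" by auto
  have uC: "u \<in> C2" and vC: "v \<in> C2" using jeigD(8) u v by auto
  obtain s where s: "s\<^sup>2 = 1" "\<And>x. x \<in> {a<..<b} \<Longrightarrow> 0 < s * u x"
    using constant_sign[OF C2_cont(1)[OF uC] ab(2) nz] by blast
  obtain r where r: "r\<^sup>2 = 1" "\<And>x. x \<in> {a<..<b} \<Longrightarrow> 0 < r * v x"
    using constant_sign[OF C2_cont(1)[OF vC] ab(2) vz] by blast
  define w where "w x = s * r * (p x * wronskian u v x)" for x
  have dec: "w b < w a"
  proof (rule DERIV_neg_imp_decreasing_open[OF ab(2)])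
    fix x assume x: "a < x" "x < b"
    then have x': "x \<in> {-1<..<1}" "x \<in> {a<..<b}" using ab by auto
    have "(w has_real_derivative s * r * ((Lop u x * v x - u x * Lop v x) * \<omega> x)) (at x)"
      unfolding w_def[abs_def] by (rule DERIV_cmult[OF wronskian_derivative[OF uC vC x'(1)]])
    moreover have "s * r * ((Lop u x * v x - u x * Lop v x) * \<omega> x) = - ((\<kappa>' - \<kappa>) * ((s * u x) * (r * v x)) * \<omega> x)"
      unfolding jeigD(4)[OF u] jeigD(4)[OF v] by (simp add: algebra_simps)
    moreover have "0 < (\<kappa>' - \<kappa>) * ((s * u x) * (r * v x)) * \<omega> x"
      using less by (intro mult_pos_pos[OF mult_pos_pos[OF _ mult_pos_pos[OF s(2)[OF x'(2)] r(2)[OF x'(2)]]] omega_w_pos[OF x'(1)]]) simp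
    ultimately show "\<exists>y. (w has_real_derivative y) (at x) \<and> y < 0" by (metis neg_less_0_iff_less)
  next
    show "continuous_on {a..b} w"
      unfolding w_def using ab
      by (intro continuous_intros wronskian_continuous uC vC continuous_on_subset[OF p_continuous]) auto
  qed
  have rc: "continuous_on UNIV (\<lambda>x. r * v x)" by (intro continuous_intros C2_cont vC)
  have ds: "((\<lambda>x. s * u x) has_real_derivative s * deriv u x) (at x)" for x
    by (intro DERIV_cmult C2_deriv uC)
  \<comment> \<open>The term \<open>u v'\<close> drops out, either with \<open>u\<close> or with
    \<open>p\<close>.\<close>
  have wend: "w x = - (p x * (s * deriv u x) * (r * v x))" if "p x = 0 \<or> u x = 0" for x
    using that by (auto simp: w_def wronskian_def)
  have "w a \<le> 0"
  proof (cases "a = -1")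
    case True then show ?thesis by (simp add: w_def)
  next
    case False
    then have ua0: "u a = 0" using ua by auto
    have "0 \<le> s * deriv u a"
      by (rule deriv_nonneg_left_end[OF ds _ ab(2)]) (use ua0 s in auto)
    moreover have "0 \<le> r * v a"
      by (rule nonneg_on_closed_interval[OF rc ab(2)]) (use r ab in auto)
    ultimately have "0 \<le> p a * (s * deriv u a) * (r * v a)" by (intro mult_nonneg_nonneg[OF mult_nonneg_nonneg[OF p_nonneg]])
    then show ?thesis using wend[of a] ua0 by simp
  qed
  moreover have "0 \<le> w b"
  proof (cases "b = 1")
    case True then show ?thesis by (simp add: w_def)
  next
    case False
    then have ub0: "u b = 0" using ub by auto
    have "s * deriv u b \<le> 0"
      by (rule deriv_nonpos_right_end[OF ds _ ab(2)]) (use ub0 s in auto)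
    moreover have "0 \<le> r * v b"
      by (rule nonneg_on_closed_interval[OF rc ab(2)]) (use r ab in auto)
    ultimately have "p b * (s * deriv u b) * (r * v b) \<le> 0"
      by (intro mult_nonpos_nonneg[OF mult_nonneg_nonpos[OF p_nonneg]])
    then show ?thesis using wend[of b] ub0 by simp
  qed
  ultimately show False using dec by linarith
qed

definition zeros :: "real \<Rightarrow> real set" where "zeros \<kappa> = {x \<in> {-1<..<1}. efun \<kappa> x = 0}"

lemma finite_zeros:
  assumes \<kappa>: "\<kappa> \<in> spec" shows "finite (zeros \<kappa>)"
proof (rule ccontr)
  assume inf: "infinite (zeros \<kappa>)"
  note j = efun[OF \<kappa>]
  obtain z where z: "efun \<kappa> z \<noteq> 0" using jeig_nonzero[OF j] .
  have "zeros \<kappa> \<subseteq> {x \<in> {-1..1}. H (\<lambda>x. 1 / ev \<kappa> * efun \<kappa> x) x = 0}"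
    unfolding jeigD(6)[OF j, symmetric] zeros_def by auto
  then have "infinite {x \<in> {-1..1}. H (\<lambda>x. 1 / ev \<kappa> * efun \<kappa> x) x = 0}" using inf infinite_super by blast
  then have "H (\<lambda>x. 1 / ev \<kappa> * efun \<kappa> x) z = 0" by (rule H_zeros[OF jeigD(7)[OF j]])
  then show False using z unfolding jeigD(6)[OF j, symmetric] by simp
qed

text \<open>The zeros of the first eigenfunction cut (-1, 1) into one more interval than there are
  zeros, and each of these contains a zero of the second.\<close>

lemma card_zeros_less:
  assumes \<kappa>: "\<kappa> \<in> spec" and \<kappa>': "\<kappa>' \<in> spec" and less: "\<kappa> < \<kappa>'"
  shows "card (zeros \<kappa>) < card (zeros \<kappa>')"
proof -
  \<comment> \<open>The intervals are indexed by their left ends, hence -1 is adjoined.\<close>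
  define A where "A = insert (-1) (zeros \<kappa>)"
  define nxt where "nxt a = Min {b \<in> insert 1 (zeros \<kappa>). a < b}" for a
  have fin: "finite {b \<in> insert 1 (zeros \<kappa>). a < b}" for a using finite_zeros[OF \<kappa>] by simp
  have A1: "a \<in> {-1..<1}" if "a \<in> A" for a using that by (auto simp: A_def zeros_def)
  have nx: "nxt a \<in> insert 1 (zeros \<kappa>)" "a < nxt a" if "a \<in> A" for a
  proof -
    have "{b \<in> insert 1 (zeros \<kappa>). a < b} \<noteq> {}" using A1[OF that] by auto
    from Min_in[OF fin this] show "nxt a \<in> insert 1 (zeros \<kappa>)" "a < nxt a" by (auto simp: nxt_def)
  qed
  have nle: "nxt a \<le> b" if "b \<in> insert 1 (zeros \<kappa>)" "a < b" for a b
    unfolding nxt_def using that by (intro Min_le fin) auto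
  have ex: "\<exists>x\<in>{a<..<nxt a}. efun \<kappa>' x = 0" if a: "a \<in> A" for a
  proof (rule Sturm_interval[OF efun[OF \<kappa>] efun[OF \<kappa>'] less])
    show "-1 \<le> a" using A1[OF a] by simp
    show "a < nxt a" by (rule nx[OF a])
    show "nxt a \<le> 1" using nle[of 1 a] A1[OF a] by simp
    show "a = -1 \<or> efun \<kappa> a = 0" using a by (auto simp: A_def zeros_def)
    show "nxt a = 1 \<or> efun \<kappa> (nxt a) = 0" using nx(1)[OF a] by (auto simp: zeros_def)
    fix x assume x: "x \<in> {a<..<nxt a}"
    show "efun \<kappa> x \<noteq> 0"
    proof
      assume "efun \<kappa> x = 0"
      moreover have "x < 1" using x nle[of 1 a] A1[OF a] by auto
      ultimately have "x \<in> zeros \<kappa>" using x A1[OF a] by (auto simp: zeros_def)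
      then show False using nle[of x a] x by auto
    qed
  qed
  define \<zeta> where "\<zeta> a = (SOME x. x \<in> {a<..<nxt a} \<and> efun \<kappa>' x = 0)" for a
  have \<zeta>: "\<zeta> a \<in> {a<..<nxt a}" "efun \<kappa>' (\<zeta> a) = 0" if "a \<in> A" for a
  proof -
    have "\<zeta> a \<in> {a<..<nxt a} \<and> efun \<kappa>' (\<zeta> a) = 0"
      unfolding \<zeta>_def by (rule someI_ex) (use ex[OF that] in blast)
    then show "\<zeta> a \<in> {a<..<nxt a}" "efun \<kappa>' (\<zeta> a) = 0" by auto
  qed
  have lt: "\<zeta> a < \<zeta> a'" if "a \<in> A" "a' \<in> A" "a < a'" for a a'
  proof -
    have "a' \<in> insert 1 (zeros \<kappa>)" using that A1[OF that(1)] by (auto simp: A_def)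
    then have "nxt a \<le> a'" using nle that by auto
    then show ?thesis using \<zeta>(1)[OF that(1)] \<zeta>(1)[OF that(2)] by auto
  qed
  have "inj_on \<zeta> A"
  proof (rule inj_onI)
    fix a a' assume "a \<in> A" "a' \<in> A" "\<zeta> a = \<zeta> a'"
    then show "a = a'" using lt[of a a'] lt[of a' a] by (cases a a' rule: linorder_cases) auto
  qed
  moreover have "\<zeta> ` A \<subseteq> zeros \<kappa>'"
  proof
    fix y assume "y \<in> \<zeta> ` A"
    then obtain a where a: "a \<in> A" "y = \<zeta> a" by blast
    have "nxt a \<le> 1" using nle[of 1 a] A1[OF a(1)] by simp
    then show "y \<in> zeros \<kappa>'" using \<zeta>[OF a(1)] A1[OF a(1)] a(2) by (auto simp: zeros_def)
  qed
  ultimately have "card A \<le> card (zeros \<kappa>')" using finite_zeros[OF \<kappa>'] by (rule card_inj_on_le)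
  moreover have "card A = Suc (card (zeros \<kappa>))"
    unfolding A_def using finite_zeros[OF \<kappa>] by (subst card_insert_disjoint) (auto simp: zeros_def)
  ultimately show ?thesis by simp
qed

text \<open>The number of zeros is a natural number that strictly increases with \<kappa>.
  Finiteness is what makes consecutive eigenvalues available.\<close>

lemma finite_below:
  assumes "\<kappa> \<in> spec" shows "finite {\<eta> \<in> spec. \<eta> < \<kappa>}"
proof -
  have inj: "inj_on (\<lambda>\<eta>. card (zeros \<eta>)) {\<eta> \<in> spec. \<eta> < \<kappa>}"
  proof (rule inj_onI)
    fix a b assume "a \<in> {\<eta> \<in> spec. \<eta> < \<kappa>}" "b \<in> {\<eta> \<in> spec. \<eta> < \<kappa>}" "card (zeros a) = card (zeros b)"
    then show "a = b" using card_zeros_less[of a b] card_zeros_less[of b a] by (cases a b rule: linorder_cases) auto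
  qed
  have "(\<lambda>\<eta>. card (zeros \<eta>)) ` {\<eta> \<in> spec. \<eta> < \<kappa>} \<subseteq> {..<card (zeros \<kappa>)}"
    using card_zeros_less assms by auto
  then show ?thesis using inj_on_finite[OF inj] by blast
qed

text \<open>Differentiating \<open>u = H u / \<nu>\<close> produces \<open>H (y u)\<close> at
  \<open>- x\<close>; the parity of \<open>v\<close> absorbs the reflection, and symmetry moves
  \<open>H\<close> onto \<open>v\<close>. Both \<open>P\<close> and \<open>R\<close> are thereby
  expressed through the one number \<open>\<langle>x u, v\<rangle>\<close>.\<close>

lemma ip_deriv:
  assumes u: "jeig u \<kappa> \<nu>" and v: "jeig v \<kappa>' \<nu>'" and par: "\<And>x. v (- x) = \<epsilon> * v x"
  shows "\<nu> * ip (deriv u) v = c * \<epsilon> * \<nu>' * ip (\<lambda>x. x * u x) v"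
proof -
  note uB = jeigD(1)[OF u] and vB = jeigD(1)[OF v] and gB = jeigD(7)[OF u]
  have "deriv u = deriv (H (\<lambda>x. 1 / \<nu> * u x))" using jeigD(6)[OF u] by simp
  also have "\<dots> = (\<lambda>x. c * H (\<lambda>y. y * (1 / \<nu> * u y)) (- x))" by (rule H_C2(2)[OF gB])
  also have "(\<lambda>y. y * (1 / \<nu> * u y)) = (\<lambda>y. 1 / \<nu> * (y * u y))" by (simp add: mult_ac)
  finally have d: "deriv u = (\<lambda>x. c / \<nu> * H (\<lambda>y. y * u y) (- x))" by (simp only: H_scale) simp
  have yB: "(\<lambda>y. y * u y) \<in> Bd" by (rule Bd_mult[OF Bd_id uB])
  have "ip (deriv u) v = c / \<nu> * ip (\<lambda>x. H (\<lambda>y. y * u y) (- x)) v" unfolding d by (rule ip_scale_left)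
  also have "ip (\<lambda>x. H (\<lambda>y. y * u y) (- x)) v = ip (H (\<lambda>y. y * u y)) (\<lambda>x. \<epsilon> * v x)"
    using ip_reflect[of "H (\<lambda>y. y * u y)" v] yB vB by (simp add: par H_Bd)
  also have "\<dots> = \<epsilon> * ip (H (\<lambda>y. y * u y)) v" by (rule ip_scale_right)
  also have "ip (H (\<lambda>y. y * u y)) v = ip (\<lambda>y. y * u y) (H v)" by (rule H_symmetric[OF yB vB])
  also have "\<dots> = ip (\<lambda>y. y * u y) (\<lambda>x. \<nu>' * v x)" by (rule ip_cong) (auto simp: jeigD(3)[OF v])
  also have "\<dots> = \<nu>' * ip (\<lambda>y. y * u y) v" by (rule ip_scale_right)
  finally show ?thesis using jeigD(2)[OF u] by simp
qed

lemma omega_derivative: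
  assumes "x \<in> {-1<..<1}" shows "(\<omega> has_real_derivative (- 2 * \<alpha> * x * \<omega> x / (1 - x\<^sup>2))) (at x)"
proof -
  have x: "0 < 1 - x\<^sup>2" using square_less_1[OF assms] by simp
  have "((\<lambda>x. (1 - x\<^sup>2) powr \<alpha>) has_real_derivative ((1 - x\<^sup>2) powr \<alpha> * (0 * ln (1 - x\<^sup>2) + (- 2 * x) * \<alpha> / (1 - x\<^sup>2)))) (at x)"
    using x by (intro DERIV_powr) (auto intro!: derivative_eq_intros)
  moreover have "(1 - x\<^sup>2) powr \<alpha> * (0 * ln (1 - x\<^sup>2) + (- 2 * x) * \<alpha> / (1 - x\<^sup>2)) = - 2 * \<alpha> * x * \<omega> x / (1 - x\<^sup>2)"
    by (simp add: omega_w_def)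
  moreover have "\<omega> = (\<lambda>x. (1 - x\<^sup>2) powr \<alpha>)" by (auto simp: omega_w_def)
  ultimately show ?thesis by (simp add: mult_ac)
qed

lemma omega_continuous: "continuous_on {-1..1} \<omega>"
proof -
  have "\<omega> = (\<lambda>x. (1 - x\<^sup>2) powr \<alpha>)" by (auto simp: omega_w_def)
  moreover have "continuous_on {-1..1} (\<lambda>x::real. (1 - x\<^sup>2) powr \<alpha>)"
    using alpha_pos by (intro continuous_on_powr' continuous_intros) (auto simp: abs_square_le_1)
  ultimately show ?thesis by simp
qed

lemma omega_boundary: "\<omega> 1 = 0" "\<omega> (-1) = 0"
  by (simp_all add: omega_w_def)

text \<open>After a second integration by parts the derivative falls on
  \<open>x / (1 - x\<^sup>2)\<close>, which is increasing, so the integrand becomes a positive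
  multiple of the Wronskian. Since \<alpha> is positive, \<omega> vanishes at the ends and the
  boundary terms disappear.\<close>

lemma sum_ip_deriv_sign:
  assumes u: "jeig u \<kappa> \<nu>" and v: "jeig v \<kappa>' \<nu>'" and less: "\<kappa> < \<kappa>'"
    and W: "\<And>x. x \<in> {-1<..<1} \<Longrightarrow> 0 < \<sigma> * wronskian u v x"
  shows "0 < \<sigma> * (ip (deriv v) u + ip (deriv u) v)"
proof -
  have uC: "u \<in> C2" and vC: "v \<in> C2" using jeigD(8) u v by auto
  note cont = C2_cont[OF uC] C2_cont[OF vC] wronskian_continuous[OF uC vC]
  define K where "K = 2 * \<alpha> / (\<kappa>' - \<kappa>)"
  have K: "0 < K" unfolding K_def using alpha_pos less by simp
  define \<Phi> where "\<Phi> x = \<omega> x * (u x * v x - K * (x * wronskian u v x))" for x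
  define \<pi> where "\<pi> x = K * (1 + x\<^sup>2) / (1 - x\<^sup>2)\<^sup>2 * (p x * wronskian u v x)" for x
  define S where "S = ip (deriv v) u + ip (deriv u) v"
  define f where "f x = deriv v x * u x + deriv u x * v x" for x
  have fB: "f \<in> Bd" unfolding f_def using uC vC by auto
  have S: "S = (LINT x|M. f x)"
    unfolding S_def f_def ip_def using uC vC by (subst Bochner_Integration.integral_add) auto
  \<comment> \<open>\<open>\<Phi>\<close> comes from integrating \<open>(u v)' \<omega>\<close> by parts and replacing \<open>u v \<omega>\<close> by \<open>- (p W)' / (\<kappa>' - \<kappa>)\<close>.\<close>
  have d: "(\<Phi> has_real_derivative (f x * \<omega> x - \<pi> x)) (at x)" if x: "x \<in> {-1<..<1}" for x
  proof -
    define q where "q = 1 - x\<^sup>2"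
    have q: "0 < q" unfolding q_def using square_less_1[OF x] by simp
    define w where "w x = p x * wronskian u v x" for x
    have dw: "(w has_real_derivative (- (\<kappa>' - \<kappa>) * (u x * v x) * \<omega> x)) (at x)"
      unfolding w_def[abs_def] using wronskian_derivative[OF uC vC x]
      unfolding jeigD(4)[OF u] jeigD(4)[OF v] by (rule DERIV_cong) (simp add: algebra_simps)
    have dr: "((\<lambda>x. x / (1 - x\<^sup>2)) has_real_derivative (1 + x\<^sup>2) / q\<^sup>2) (at x)"
      using q unfolding q_def
      by (auto intro!: derivative_eq_intros simp: power2_eq_square algebra_simps)
    have "((\<lambda>x. \<omega> x * (u x * v x) - K * (x / (1 - x\<^sup>2) * w x)) has_real_derivative
      (\<omega> x * (u x * deriv v x + deriv u x * v x) + (- 2 * \<alpha> * x * \<omega> x / (1 - x\<^sup>2)) * (u x * v x)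
      - K * (x / (1 - x\<^sup>2) * (- (\<kappa>' - \<kappa>) * (u x * v x) * \<omega> x) + (1 + x\<^sup>2) / q\<^sup>2 * w x))) (at x)"
      by (intro DERIV_diff DERIV_mult' DERIV_cmult omega_derivative[OF x] dw dr C2_deriv uC vC)
    moreover have "\<omega> x * (u x * deriv v x + deriv u x * v x) + (- 2 * \<alpha> * x * \<omega> x / (1 - x\<^sup>2)) * (u x * v x)
      - K * (x / (1 - x\<^sup>2) * (- (\<kappa>' - \<kappa>) * (u x * v x) * \<omega> x) + (1 + x\<^sup>2) / q\<^sup>2 * w x)
      = f x * \<omega> x - \<pi> x"
    proof -
      have "K * (\<kappa>' - \<kappa>) = 2 * \<alpha>" using less by (simp add: K_def)
      moreover have "K * (y * (- (\<kappa>' - \<kappa>) * z * o')) = - (K * (\<kappa>' - \<kappa>)) * y * o' * z" for y z o' :: real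
        by (simp add: algebra_simps)
      ultimately have "K * (x / (1 - x\<^sup>2) * (- (\<kappa>' - \<kappa>) * (u x * v x) * \<omega> x)) = - 2 * \<alpha> * x * \<omega> x / (1 - x\<^sup>2) * (u x * v x)"
        by simp
      then show ?thesis by (simp add: f_def \<pi>_def w_def q_def distrib_left algebra_simps)
    qed
    moreover have "((\<lambda>x. \<omega> x * (u x * v x) - K * (x / (1 - x\<^sup>2) * w x)) has_real_derivative D) (at x)
       \<longleftrightarrow> (\<Phi> has_real_derivative D) (at x)" for D
    proof (rule DERIV_cong_ev[OF refl _ refl])
      have "\<forall>\<^sub>F y in nhds x. y \<in> {-1<..<1}" using x by (intro eventually_nhds_in_open) auto
      then show "\<forall>\<^sub>F y in nhds x. \<omega> y * (u y * v y) - K * (y / (1 - y\<^sup>2) * w y) = \<Phi> y"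
      proof eventually_elim
        case (elim y)
        have "p y = (1 - y\<^sup>2) * \<omega> y" using p_eq[of y] elim by auto
        moreover have "1 - y\<^sup>2 \<noteq> 0" using square_less_1[OF elim] by simp
        ultimately show ?case by (simp add: \<Phi>_def w_def right_diff_distrib)
      qed
    qed
    ultimately show ?thesis by simp
  qed
  have "((\<lambda>x. f x * \<omega> x - \<pi> x) has_integral (\<Phi> 1 - \<Phi> (-1))) {-1..1}"
  proof (rule fundamental_theorem_of_calculus_interior)
    show "continuous_on {-1..1} \<Phi>" unfolding \<Phi>_def by (intro continuous_intros omega_continuous cont)
  qed (use d in \<open>auto simp: has_real_derivative_iff_has_vector_derivative\<close>)
  \<comment> \<open>\<open>\<pi>\<close> may be unbounded near the ends; it is integrable as a
    difference of integrable functions.\<close>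
  then have "((\<lambda>x. f x * \<omega> x - (f x * \<omega> x - \<pi> x)) has_integral (S - (\<Phi> 1 - \<Phi> (-1)))) {-1..1}"
    unfolding S by (rule has_integral_diff[OF wmeas_has_integral[OF fB]])
  then have "(\<pi> has_integral S) {-1..1}" by (simp add: \<Phi>_def omega_boundary)
  then have I: "((\<lambda>x. \<sigma> * \<pi> x) has_integral (\<sigma> * S)) {-1..1}" by (rule has_integral_mult_right)
  have pos: "0 < \<sigma> * \<pi> x" if x: "x \<in> {-1<..<1}" for x
  proof -
    have "\<sigma> * \<pi> x = (K * (1 + x\<^sup>2) / (1 - x\<^sup>2)\<^sup>2 * p x) * (\<sigma> * wronskian u v x)" by (simp add: \<pi>_def mult_ac)
    also have "0 < \<dots>"
    proof (rule mult_pos_pos[OF _ W[OF x]])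
      show "0 < K * (1 + x\<^sup>2) / (1 - x\<^sup>2)\<^sup>2 * p x"
        using K p_pos[OF x] square_less_1[OF x]
        by (intro mult_pos_pos divide_pos_pos) (auto simp: add_pos_nonneg)
    qed
    finally show ?thesis .
  qed
  have nn: "0 \<le> \<sigma> * \<pi> x" if x: "x \<in> {-1..1}" for x
  proof (cases "x \<in> {-1<..<1}")
    case True then show ?thesis using pos by force
  next
    case False
    then have "x = 1 \<or> x = -1" using x by auto
    then show ?thesis by (auto simp: \<pi>_def)
  qed
  \<comment> \<open>Strict positivity is read off from the middle of the interval, where the
    integrand is continuous and has a positive minimum.\<close>
  have cont\<pi>: "continuous_on {-1/2..1/2} (\<lambda>x. \<sigma> * \<pi> x)"
  proof -
    have "(1 - x\<^sup>2)\<^sup>2 \<noteq> 0" if "x \<in> {-1/2..1/2}" for x :: real using square_less_1[of x] that by auto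
    then show ?thesis unfolding \<pi>_def
      by (intro continuous_intros cont continuous_on_subset[OF p_continuous]) auto
  qed
  obtain x1 where x1: "x1 \<in> {-1/2..1/2}" "\<And>y. y \<in> {-1/2..1/2} \<Longrightarrow> \<sigma> * \<pi> x1 \<le> \<sigma> * \<pi> y"
    using continuous_attains_inf[OF compact_Icc _ cont\<pi>] by auto
  have "0 < \<sigma> * \<pi> x1" using pos[of x1] x1(1) by auto
  also have "\<dots> = integral {-1/2..1/2::real} (\<lambda>x. \<sigma> * \<pi> x1)" by simp
  also have "\<dots> \<le> integral {-1/2..1/2::real} (\<lambda>x. \<sigma> * \<pi> x)"
    by (intro integral_le integrable_continuous_real cont\<pi> continuous_intros x1(2))
  also have "\<dots> \<le> integral {-1..1} (\<lambda>x. \<sigma> * \<pi> x)"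
    by (rule integral_subset_le[OF _ integrable_continuous_real[OF cont\<pi>] has_integral_integrable[OF I]]) (use nn in auto)
  also have "\<dots> = \<sigma> * S" using I by (rule integral_unique)
  finally show ?thesis by (simp add: S_def)
qed

lemma ev_less_adjacent:
  assumes \<kappa>: "\<kappa> \<in> spec" and \<kappa>': "\<kappa>' \<in> spec" and less: "\<kappa> < \<kappa>'"
    and adj: "\<And>\<eta>. \<eta> \<in> spec \<Longrightarrow> \<eta> \<le> \<kappa> \<or> \<kappa>' \<le> \<eta>"
  shows "(ev \<kappa>')\<^sup>2 < (ev \<kappa>)\<^sup>2"
proof -
  define u where "u = efun \<kappa>"
  define v where "v = efun \<kappa>'"
  define \<nu> where "\<nu> = ev \<kappa>"
  define \<nu>' where "\<nu>' = ev \<kappa>'"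
  have ju: "jeig u \<kappa> \<nu>" and jv: "jeig v \<kappa>' \<nu>'" using efun \<kappa> \<kappa>' by (auto simp: u_def v_def \<nu>_def \<nu>'_def)
  have uC: "u \<in> C2" and vC: "v \<in> C2" using jeigD(8) ju jv by auto
  have Wn: "wronskian u v x \<noteq> 0" if "x \<in> {-1<..<1}" for x
    unfolding u_def v_def by (rule wronskian_nonzero[OF \<kappa> \<kappa>' less adj that])
  obtain \<sigma> where \<sigma>: "\<sigma>\<^sup>2 = 1" "\<And>x. x \<in> {-1<..<1} \<Longrightarrow> 0 < \<sigma> * wronskian u v x"
    by (rule constant_sign[OF wronskian_continuous[OF uC vC] _ Wn, of "-1" 1]) auto
  define P where "P = ip (deriv u) v"
  define R where "R = ip (deriv v) u"
  have "0 < (LINT x|M. \<sigma> * wronskian u v x)"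
    by (rule integral_wmeas_pos) (use \<sigma> in \<open>auto intro!: continuous_intros wronskian_continuous uC vC\<close>)
  also have "\<dots> = \<sigma> * (R - P)"
  proof -
    have "(LINT x|M. wronskian u v x) = R - P"
      unfolding wronskian_def R_def P_def ip_def using uC vC
      by (subst Bochner_Integration.integral_diff) (auto simp: mult.commute)
    then show ?thesis by simp
  qed
  finally have 1: "0 < \<sigma> * (R - P)" .
  have 2: "0 < \<sigma> * (R + P)"
    using sum_ip_deriv_sign[OF ju jv less \<sigma>(2)] by (simp add: R_def P_def)
  have "0 < (\<sigma> * (R - P)) * (\<sigma> * (R + P))" using 1 2 by (rule mult_pos_pos)
  also have "\<dots> = \<sigma>\<^sup>2 * (R\<^sup>2 - P\<^sup>2)" by (simp add: power2_eq_square algebra_simps)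
  finally have RP: "P\<^sup>2 < R\<^sup>2" using \<sigma>(1) by simp
  define X where "X = ip (\<lambda>x. x * u x) v"
  have X': "ip (\<lambda>x. x * v x) u = X" unfolding X_def ip_def by (simp add: mult_ac)
  obtain \<epsilon> where e: "\<epsilon>\<^sup>2 = 1" "\<And>x. v (- x) = \<epsilon> * v x" using jeig_parity[OF jv] by blast
  obtain \<epsilon>' where e': "\<epsilon>'\<^sup>2 = 1" "\<And>x. u (- x) = \<epsilon>' * u x" using jeig_parity[OF ju] by blast
  \<comment> \<open>The parity signs square to 1, so squaring leaves two relations with the same
    \<open>(c * X)\<^sup>2\<close>; in effect
    \<open>P\<^sup>2 / R\<^sup>2 = \<nu>'\<^sup>4 / \<nu>\<^sup>4\<close>.\<close>
  have "\<nu> * P = c * \<epsilon> * \<nu>' * X" unfolding P_def X_def by (rule ip_deriv[OF ju jv e(2)])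
  then have "(\<nu> * P)\<^sup>2 = (c * \<epsilon> * \<nu>' * X)\<^sup>2" by simp
  then have 3: "\<nu>\<^sup>2 * P\<^sup>2 = \<nu>'\<^sup>2 * (c * X)\<^sup>2" by (simp add: power_mult_distrib e(1) mult_ac)
  have "\<nu>' * R = c * \<epsilon>' * \<nu> * X" using ip_deriv[OF jv ju e'(2)] unfolding R_def X' .
  then have "(\<nu>' * R)\<^sup>2 = (c * \<epsilon>' * \<nu> * X)\<^sup>2" by simp
  then have 4: "\<nu>'\<^sup>2 * R\<^sup>2 = \<nu>\<^sup>2 * (c * X)\<^sup>2" by (simp add: power_mult_distrib e'(1) mult_ac)
  have n: "0 < \<nu>\<^sup>2" "0 < \<nu>'\<^sup>2" using jeigD(2)[OF ju] jeigD(2)[OF jv] by auto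
  show ?thesis
  proof (rule ccontr)
    assume "\<not> ?thesis"
    then have le: "\<nu>\<^sup>2 \<le> \<nu>'\<^sup>2" by (simp add: \<nu>_def \<nu>'_def)
    have "\<nu>'\<^sup>2 * R\<^sup>2 \<le> \<nu>'\<^sup>2 * (c * X)\<^sup>2" unfolding 4 by (rule mult_right_mono[OF le]) simp
    also have "\<dots> = \<nu>\<^sup>2 * P\<^sup>2" using 3 by simp
    also have "\<dots> \<le> \<nu>'\<^sup>2 * P\<^sup>2" by (rule mult_right_mono[OF le]) simp
    finally have "R\<^sup>2 \<le> P\<^sup>2" using n by simp
    then show False using RP by simp
  qed
qed

text \<open>Adjacent steps are chained: the induction counts the eigenvalues from \<kappa> up to,
  but excluding, \<kappa>', and removes the predecessor of \<kappa>'.\<close>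

theorem ev_strictly_decreasing:
  assumes "\<kappa> \<in> spec" "\<kappa>' \<in> spec" "\<kappa> < \<kappa>'"
  shows "(ev \<kappa>')\<^sup>2 < (ev \<kappa>)\<^sup>2"
  using assms
proof (induction "card {\<eta> \<in> spec. \<kappa> \<le> \<eta> \<and> \<eta> < \<kappa>'}" arbitrary: \<kappa>' rule: less_induct)
  case less
  define A where "A \<kappa>' = {\<eta> \<in> spec. \<kappa> \<le> \<eta> \<and> \<eta> < \<kappa>'}" for \<kappa>'
  have fin: "finite (A \<kappa>')" using finite_below[OF less.prems(2)] by (rule finite_subset[rotated]) (auto simp: A_def)
  have ne: "A \<kappa>' \<noteq> {}" using less.prems by (auto simp: A_def)
  define m where "m = Max (A \<kappa>')"
  have m: "m \<in> A \<kappa>'" unfolding m_def by (rule Max_in[OF fin ne])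
  have ml: "\<eta> \<le> m" if "\<eta> \<in> A \<kappa>'" for \<eta> unfolding m_def by (rule Max_ge[OF fin that])
  have step: "(ev \<kappa>')\<^sup>2 < (ev m)\<^sup>2"
  proof (rule ev_less_adjacent)
    show "\<eta> \<le> m \<or> \<kappa>' \<le> \<eta>" if "\<eta> \<in> spec" for \<eta>
      using ml[of \<eta>] that m by (fastforce simp: A_def)
  qed (use m less.prems in \<open>auto simp: A_def\<close>)
  show ?case
  proof (cases "m = \<kappa>")
    case True then show ?thesis using step by simp
  next
    case False
    then have km: "\<kappa> < m" using m by (auto simp: A_def)
    have "A m \<subset> A \<kappa>'" using m by (auto simp: A_def)
    then have "card (A m) < card (A \<kappa>')" by (rule psubset_card_mono[OF fin])
    then have "(ev m)\<^sup>2 < (ev \<kappa>)\<^sup>2" using less.hyps[of m] m km less.prems(1) by (simp add: A_def)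
    then show ?thesis using step by simp
  qed
qed

lemma ev_sq_inj: "inj_on (\<lambda>\<kappa>. (ev \<kappa>)\<^sup>2) spec"
proof (rule inj_onI)
  fix a b assume "a \<in> spec" "b \<in> spec" "(ev a)\<^sup>2 = (ev b)\<^sup>2"
  then show "a = b" using ev_strictly_decreasing[of a b] ev_strictly_decreasing[of b a]
    by (cases a b rule: linorder_cases) auto
qed

end

section \<open>The operator norm\<close>

text \<open>The product is \<open>cos ((t - u) s) + sin ((t + u) s)\<close>; the characteristic
  function of the normal law integrates the cosine to a Gaussian and the sine to 0.\<close>

lemma std_normal_cas_cas:
  "(LINT s|std_normal_distribution. cas (t * s) * cas (u * s)) = exp (- ((t - u)\<^sup>2) / 2)"
proof -
  interpret N: real_distribution std_normal_distribution by (rule real_dist_normal_dist)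
  have int: "integrable std_normal_distribution (\<lambda>s. iexp (k * s))" for k
    by (rule N.integrable_const_bound[where B = 1]) (auto intro!: AE_I2)
  have e: "(LINT s|std_normal_distribution. iexp (k * s)) = of_real (exp (- (k\<^sup>2) / 2))" for k
    using fun_cong[OF char_std_normal_distribution, of k] by (simp add: char_def)
  have c: "(LINT s|std_normal_distribution. cos (k * s)) = exp (- (k\<^sup>2) / 2)" for k
  proof -
    have "Re (LINT s|std_normal_distribution. iexp (k * s)) = exp (- (k\<^sup>2) / 2)" by (simp only: e Re_complex_of_real)
    then show ?thesis using integral_Re[OF int[of k]] by (simp add: Re_exp)
  qed
  have s: "(LINT s|std_normal_distribution. sin (k * s)) = 0" for k
  proof -
    have "Im (LINT s|std_normal_distribution. iexp (k * s)) = 0" by (simp only: e Im_complex_of_real)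
    then show ?thesis using integral_Im[OF int[of k]] by (simp add: Im_exp)
  qed
  have ic: "integrable std_normal_distribution (\<lambda>s. cos (k * s))"
    and isn: "integrable std_normal_distribution (\<lambda>s. sin (k * s))" for k
    by (rule N.integrable_const_bound[where B = 1]; auto intro!: AE_I2)+
  have "cas (t * s) * cas (u * s) = cos ((t - u) * s) + sin ((t + u) * s)" for s
    unfolding cas_def by (simp add: left_diff_distrib distrib_right cos_diff sin_add algebra_simps)
  then have "(LINT s|std_normal_distribution. cas (t * s) * cas (u * s))
    = (LINT s|std_normal_distribution. cos ((t - u) * s)) + (LINT s|std_normal_distribution. sin ((t + u) * s))"
    using ic isn by (simp add: Bochner_Integration.integral_add)
  then show ?thesis by (simp add: c s)
qed

context jacobi_weight begin

lemma Fubini_bounded: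
  fixes F :: "real \<Rightarrow> real \<Rightarrow> real"
  assumes N: "finite_measure N" "sets N = sets borel"
    and m: "(\<lambda>(x, y). F x y) \<in> borel_measurable (borel \<Otimes>\<^sub>M borel)"
    and b: "\<And>x y. y \<in> {-1..1} \<Longrightarrow> \<bar>F x y\<bar> \<le> K"
  shows "(LINT x|N. LINT y|M. F x y) = (LINT y|M. LINT x|N. F x y)"
proof -
  interpret N: finite_measure N by (rule N)
  interpret NM: pair_sigma_finite N M ..
  interpret NMf: finite_measure "N \<Otimes>\<^sub>M M" by (rule finite_measure_pair_measure) unfold_locales
  have id: "(\<lambda>x. x) \<in> borel_measurable N" using N(2) by (simp cong: measurable_cong_sets)
  have "(\<lambda>p. (fst p, snd p)) \<in> measurable (N \<Otimes>\<^sub>M M) (borel \<Otimes>\<^sub>M borel)"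
    by (rule measurable_Pair[OF measurable_compose[OF measurable_fst id] measurable_compose[OF measurable_snd id_wmeas]])
  then have "(\<lambda>p. p) \<in> measurable (N \<Otimes>\<^sub>M M) (borel \<Otimes>\<^sub>M borel)" by (simp only: prod.collapse)
  then have "(\<lambda>(x, y). F x y) \<in> borel_measurable (N \<Otimes>\<^sub>M M)" using m by (rule measurable_compose)
  then have "integrable (N \<Otimes>\<^sub>M M) (\<lambda>(x, y). F x y)"
    by (intro NMf.integrable_const_bound[where B = K]) (auto simp: space_pair_measure b intro!: AE_I2)
  from NM.Fubini_integral[OF this] show ?thesis by simp
qed

end

context hartley begin

text \<open>A regularised Plancherel identity: with a Gaussian weight on the frequency side, every
  interchange concerns bounded functions on finite measures.\<close>

lemma Gauss_H_sq:
  assumes f: "f \<in> Bd"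
  shows "(LINT s|std_normal_distribution. (H f s)\<^sup>2)
    = (LINT y|M. LINT z|M. f y * f z * exp (- ((c * y - c * z)\<^sup>2) / 2))"
proof -
  interpret N: real_distribution std_normal_distribution by (rule real_dist_normal_dist)
  have N: "finite_measure std_normal_distribution" "sets std_normal_distribution = sets borel"
    by unfold_locales simp
  obtain K where K: "0 \<le> K" "\<And>x. x \<in> {-1..1} \<Longrightarrow> \<bar>f x\<bar> \<le> K" using Bd_bound[OF f] by blast
  define L where "L = 2 * sqrt mass * nrm f"
  have L: "\<bar>H f s\<bar> \<le> L" for s unfolding L_def by (rule H_pointwise_bound[OF f])
  have L0: "0 \<le> L" using L[of 0] by linarith
  note [measurable] = Bd_measurable[OF f] Bd_measurable[OF H_Bd[OF f]]
  have "(LINT s|std_normal_distribution. (H f s)\<^sup>2) = (LINT s|std_normal_distribution. LINT y|M. cas (c * s * y) * f y * H f s)"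
    by (intro Bochner_Integration.integral_cong refl) (simp add: H_def power2_eq_square)
  also have "\<dots> = (LINT y|M. LINT s|std_normal_distribution. cas (c * s * y) * f y * H f s)"
  proof (rule Fubini_bounded[OF N])
    show "\<bar>cas (c * s * y) * f y * H f s\<bar> \<le> 2 * K * L" if "y \<in> {-1..1}" for s y
      unfolding abs_mult using K L that by (intro mult_mono abs_cas_le) auto
  qed measurable
  also have "\<dots> = (LINT y|M. LINT z|M. f y * f z * exp (- ((c * y - c * z)\<^sup>2) / 2))"
  proof (rule Bochner_Integration.integral_cong[OF refl])
    fix y assume "y \<in> space M"
    then have y: "y \<in> {-1..1}" by simp
    have "(LINT s|std_normal_distribution. cas (c * s * y) * f y * H f s)
      = (LINT s|std_normal_distribution. LINT z|M. (cas (c * s * y) * f y) * (cas (c * s * z) * f z))"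
      unfolding H_def by (intro Bochner_Integration.integral_cong refl) simp
    also have "\<dots> = (LINT z|M. LINT s|std_normal_distribution. (cas (c * s * y) * f y) * (cas (c * s * z) * f z))"
    proof (rule Fubini_bounded[OF N])
      show "\<bar>(cas (c * s * y) * f y) * (cas (c * s * z) * f z)\<bar> \<le> (2 * K) * (2 * K)" if "z \<in> {-1..1}" for s z
        unfolding abs_mult using K y that by (intro mult_mono abs_cas_le) auto
    qed measurable
    also have "\<dots> = (LINT z|M. f y * f z * exp (- ((c * y - c * z)\<^sup>2) / 2))"
    proof (rule Bochner_Integration.integral_cong[OF refl])
      fix z
      have "(LINT s|std_normal_distribution. (cas (c * s * y) * f y) * (cas (c * s * z) * f z))
        = (LINT s|std_normal_distribution. (f y * f z) * (cas ((c * y) * s) * cas ((c * z) * s)))"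
        by (simp add: mult_ac)
      also have "\<dots> = f y * f z * (LINT s|std_normal_distribution. cas ((c * y) * s) * cas ((c * z) * s))"
        by (rule integral_mult_right_zero)
      finally show "(LINT s|std_normal_distribution. (cas (c * s * y) * f y) * (cas (c * s * z) * f z))
        = f y * f z * exp (- ((c * y - c * z)\<^sup>2) / 2)" unfolding std_normal_cas_cas .
    qed
    finally show "(LINT s|std_normal_distribution. cas (c * s * y) * f y * H f s)
      = (LINT z|M. f y * f z * exp (- ((c * y - c * z)\<^sup>2) / 2))" .
  qed
  finally show ?thesis .
qed

text \<open>Replacing the weight by its bound 1 and extending to the line leaves a full Gaussian
  integral.\<close>

lemma Gauss_kernel_mass: "(LINT z|M. exp (- ((c * y - c * z)\<^sup>2) / 2)) \<le> sqrt (2 * pi) / c"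
proof -
  define e where "e z = exp (- ((c * y - c * z)\<^sup>2) / 2)" for z
  have ec: "continuous_on UNIV e" unfolding e_def by (intro continuous_intros) auto
  have em: "e \<in> borel_measurable borel" using ec by (rule borel_measurable_continuous_onI)
  have eq: "e z = sqrt (2 * pi) / c * normal_density y (1 / c) z" for z
  proof -
    have "sqrt (2 * pi * (1 / c)\<^sup>2) = sqrt (2 * pi) / c" using c_pos by (simp add: real_sqrt_mult real_sqrt_divide power_divide)
    moreover have "- (z - y)\<^sup>2 / (2 * (1 / c)\<^sup>2) = - ((c * y - c * z)\<^sup>2) / 2"
      using c_pos by (simp add: power_divide field_simps power2_eq_square)
    ultimately show ?thesis unfolding normal_density_def e_def using c_pos by simp
  qed
  have int: "integrable lborel e" unfolding eq using c_pos by (intro integrable_mult_right) auto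
  have "(LINT z|M. e z) = (LINT z|lborel. indicator {-1..1} z *\<^sub>R (\<omega> z *\<^sub>R e z))"
    by (subst LINT_wmeas[OF em]) (simp add: set_lebesgue_integral_def)
  also have "\<dots> \<le> (LINT z|lborel. e z)"
  proof (rule integral_mono[OF _ int])
    show "integrable lborel (\<lambda>z. indicator {-1..1} z *\<^sub>R (\<omega> z *\<^sub>R e z))"
      using integrable_wmeas_iff[OF em] Bd_integrable[OF Bd_cont[OF ec]] by (simp add: set_integrable_def)
    show "indicator {-1..1} z *\<^sub>R (\<omega> z *\<^sub>R e z) \<le> e z" for z
      using omega_w_le_1[of \<alpha> z] alpha_pos by (auto simp: indicator_def e_def intro: mult_left_le_one_le)
  qed
  also have "\<dots> = sqrt (2 * pi) / c" unfolding eq using c_pos by simp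
  finally show ?thesis unfolding e_def .
qed

text \<open>Schur's test: \<open>f y * f z\<close> is at most half the sum of the squares, and both
  marginals of the symmetric kernel obey \<open>Gauss_kernel_mass\<close>.\<close>

lemma Gauss_form_bound:
  assumes f: "f \<in> Bd"
  shows "(LINT y|M. LINT z|M. f y * f z * exp (- ((c * y - c * z)\<^sup>2) / 2)) \<le> sqrt (2 * pi) / c * ip f f"
proof -
  obtain K where K: "0 \<le> K" "\<And>x. x \<in> {-1..1} \<Longrightarrow> \<bar>f x\<bar> \<le> K" using Bd_bound[OF f] by blast
  note [measurable] = Bd_measurable[OF f]
  define e where "e y z = exp (- ((c * y - c * z)\<^sup>2) / 2)" for y z
  have e: "0 \<le> e y z" "e y z \<le> 1" "e y z = e z y" for y z
    by (auto simp: e_def power2_commute)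
  have em: "(\<lambda>(y, z). e y z) \<in> borel_measurable (borel \<Otimes>\<^sub>M borel)" unfolding e_def by measurable
  note [measurable] = em
  have int1: "integrable (M \<Otimes>\<^sub>M M) (\<lambda>(y, z). f y * f z * e y z)"
  proof (rule pair_wmeas_integrable)
    show "\<bar>f y * f z * e y z\<bar> \<le> K * K * 1" if "y \<in> {-1..1}" "z \<in> {-1..1}" for y z
      unfolding abs_mult using K e that by (intro mult_mono) auto
  qed measurable
  have int2: "integrable (M \<Otimes>\<^sub>M M) (\<lambda>(y, z). (f y)\<^sup>2 * e y z)"
  proof (rule pair_wmeas_integrable)
    show "\<bar>(f y)\<^sup>2 * e y z\<bar> \<le> (K * K) * 1" if "y \<in> {-1..1}" "z \<in> {-1..1}" for y z
      unfolding abs_mult power2_eq_square using K e that by (intro mult_mono) auto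
  qed measurable
  have int3: "integrable (M \<Otimes>\<^sub>M M) (\<lambda>(y, z). (f z)\<^sup>2 * e y z)"
  proof (rule pair_wmeas_integrable)
    show "\<bar>(f z)\<^sup>2 * e y z\<bar> \<le> (K * K) * 1" if "y \<in> {-1..1}" "z \<in> {-1..1}" for y z
      unfolding abs_mult power2_eq_square using K e that by (intro mult_mono) auto
  qed measurable
  have I2: "integral\<^sup>L (M \<Otimes>\<^sub>M M) (\<lambda>(y, z). (f y)\<^sup>2 * e y z) \<le> sqrt (2 * pi) / c * ip f f"
  proof -
    have "integral\<^sup>L (M \<Otimes>\<^sub>M M) (\<lambda>(y, z). (f y)\<^sup>2 * e y z) = (LINT y|M. LINT z|M. (f y)\<^sup>2 * e y z)"
      using MM.integral_fst'[OF int2] by simp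
    also have "\<dots> \<le> (LINT y|M. (f y)\<^sup>2 * (sqrt (2 * pi) / c))"
    proof (rule integral_mono)
      show "integrable M (\<lambda>y. LINT z|M. (f y)\<^sup>2 * e y z)" using MM.integrable_fst'[OF int2] by simp
      show "integrable M (\<lambda>y. (f y)\<^sup>2 * (sqrt (2 * pi) / c))" using f by (intro Bd_integrable Bd_mult Bd_power Bd_const) auto
      show "(LINT z|M. (f y)\<^sup>2 * e y z) \<le> (f y)\<^sup>2 * (sqrt (2 * pi) / c)" for y
        unfolding integral_mult_right_zero e_def by (intro mult_left_mono Gauss_kernel_mass) simp
    qed
    also have "\<dots> = sqrt (2 * pi) / c * ip f f" by (simp add: ip_def power2_eq_square mult.commute)
    finally show ?thesis .
  qed
  have I3: "integral\<^sup>L (M \<Otimes>\<^sub>M M) (\<lambda>(y, z). (f z)\<^sup>2 * e y z) = integral\<^sup>L (M \<Otimes>\<^sub>M M) (\<lambda>(y, z). (f y)\<^sup>2 * e y z)"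
  proof -
    have "integral\<^sup>L (M \<Otimes>\<^sub>M M) (\<lambda>(y, z). (f z)\<^sup>2 * e y z) = (LINT y|M. LINT z|M. (f z)\<^sup>2 * e y z)"
      using MM.integral_fst'[OF int3] by simp
    also have "\<dots> = (LINT z|M. LINT y|M. (f z)\<^sup>2 * e y z)" using MM.Fubini_integral[OF int3] by simp
    also have "\<dots> = (LINT y|M. LINT z|M. (f y)\<^sup>2 * e y z)"
      by (intro Bochner_Integration.integral_cong refl) (metis e(3))
    also have "\<dots> = integral\<^sup>L (M \<Otimes>\<^sub>M M) (\<lambda>(y, z). (f y)\<^sup>2 * e y z)" using MM.integral_fst'[OF int2] by simp
    finally show ?thesis .
  qed
  have "(LINT y|M. LINT z|M. f y * f z * e y z) = integral\<^sup>L (M \<Otimes>\<^sub>M M) (\<lambda>(y, z). f y * f z * e y z)"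
    using MM.integral_fst'[OF int1] by simp
  also have "\<dots> \<le> integral\<^sup>L (M \<Otimes>\<^sub>M M) (\<lambda>p. 1/2 * (\<lambda>(y, z). (f y)\<^sup>2 * e y z) p + 1/2 * (\<lambda>(y, z). (f z)\<^sup>2 * e y z) p)"
  proof (rule integral_mono[OF int1])
    show "integrable (M \<Otimes>\<^sub>M M) (\<lambda>p. 1/2 * (\<lambda>(y, z). (f y)\<^sup>2 * e y z) p + 1/2 * (\<lambda>(y, z). (f z)\<^sup>2 * e y z) p)"
      by (intro Bochner_Integration.integrable_add integrable_mult_right int2 int3)
    fix p :: "real \<times> real"
    obtain y z where p: "p = (y, z)" by (cases p)
    have "0 \<le> (f y - f z)\<^sup>2 * e y z" using e by simp
    then show "(\<lambda>(y, z). f y * f z * e y z) p \<le> 1/2 * (\<lambda>(y, z). (f y)\<^sup>2 * e y z) p + 1/2 * (\<lambda>(y, z). (f z)\<^sup>2 * e y z) p"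
      unfolding p by (simp add: power2_eq_square algebra_simps)
  qed
  also have "\<dots> = 1/2 * integral\<^sup>L (M \<Otimes>\<^sub>M M) (\<lambda>(y, z). (f y)\<^sup>2 * e y z) + 1/2 * integral\<^sup>L (M \<Otimes>\<^sub>M M) (\<lambda>(y, z). (f z)\<^sup>2 * e y z)"
    by (subst Bochner_Integration.integral_add, (intro integrable_mult_right int2 int3)+) (simp only: integral_mult_right_zero)
  also have "\<dots> \<le> sqrt (2 * pi) / c * ip f f" unfolding I3 using I2 by simp
  finally show ?thesis unfolding e_def .
qed

text \<open>The transform with parameter \<open>r\<close> at \<open>c / r * x\<close> is the one
  with parameter \<open>c\<close> at \<open>x\<close>. So [-1, 1] corresponds to a window of radius
  \<open>c / r\<close>, on which the density is smallest at the ends; the weight is at most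
  1.\<close>

lemma Gauss_lower_bound:
  assumes f: "f \<in> Bd" and r: "0 < r"
  shows "c / r * (std_normal_density (c / r) * ip (H f) (H f))
    \<le> (LINT s|std_normal_distribution. (hartley.H \<alpha> r f s)\<^sup>2)"
proof -
  interpret r: hartley \<alpha> r by unfold_locales (rule r)
  have HrB: "r.H f \<in> Bd" by (rule r.H_Bd[OF f])
  have Hr: "r.H f (c / r * x) = H f x" for x unfolding r.H_def H_def using r by simp
  interpret N: real_distribution std_normal_distribution by (rule real_dist_normal_dist)
  have intN: "integrable std_normal_distribution (\<lambda>s. (r.H f s)\<^sup>2)"
  proof (rule N.integrable_const_bound[where B = "(2 * sqrt mass * nrm f)\<^sup>2"])
    show "AE s in std_normal_distribution. norm ((r.H f s)\<^sup>2) \<le> (2 * sqrt mass * nrm f)\<^sup>2"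
    proof (rule AE_I2)
      fix s
      have "\<bar>r.H f s\<bar> \<le> \<bar>2 * sqrt mass * nrm f\<bar>" using r.H_pointwise_bound[OF f, of s] by linarith
      then show "norm ((r.H f s)\<^sup>2) \<le> (2 * sqrt mass * nrm f)\<^sup>2" by (simp add: abs_le_square_iff)
    qed
    show "(\<lambda>s. (r.H f s)\<^sup>2) \<in> borel_measurable std_normal_distribution"
      using Bd_measurable[OF Bd_power[OF HrB]] by simp
  qed
  define g where "g s = std_normal_density s *\<^sub>R (r.H f s)\<^sup>2" for s
  have gint: "integrable lborel g"
    unfolding g_def using intN Bd_measurable[OF Bd_power[OF HrB]] by (subst (asm) integrable_density) auto
  have "(LINT s|std_normal_distribution. (r.H f s)\<^sup>2) = (LINT s|lborel. g s)"
    unfolding g_def using Bd_measurable[OF Bd_power[OF HrB]] by (intro integral_density) auto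
  also have "\<dots> = c / r * (LINT x|lborel. g (c / r * x))"
    using lborel_integral_real_affine[of "c / r" g 0] c_pos r by simp
  finally have eq: "(LINT s|std_normal_distribution. (r.H f s)\<^sup>2) = c / r * (LINT x|lborel. g (c / r * x))" .
  have gint2: "integrable lborel (\<lambda>x. g (c / r * x))"
    using lborel_integrable_real_affine[OF gint, of "c / r" 0] c_pos r by simp
  have hB: "(\<lambda>x. H f x * H f x) \<in> Bd" using f by auto
  have "std_normal_density (c / r) * ip (H f) (H f)
    = (LINT x|lborel. std_normal_density (c / r) * (indicator {-1..1} x *\<^sub>R (\<omega> x *\<^sub>R (H f x * H f x))))"
    unfolding ip_def by (subst LINT_wmeas[OF Bd_measurable[OF hB]]) (simp add: set_lebesgue_integral_def)
  also have "\<dots> \<le> (LINT x|lborel. g (c / r * x))"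
  proof (rule integral_mono[OF _ gint2])
    show "integrable lborel (\<lambda>x. std_normal_density (c / r) * (indicator {-1..1} x *\<^sub>R (\<omega> x *\<^sub>R (H f x * H f x))))"
      using integrable_wmeas_iff[OF Bd_measurable[OF hB]] Bd_integrable[OF hB]
      by (intro integrable_mult_right) (simp add: set_integrable_def)
    fix x
    show "std_normal_density (c / r) * (indicator {-1..1} x *\<^sub>R (\<omega> x *\<^sub>R (H f x * H f x))) \<le> g (c / r * x)"
    proof (cases "x \<in> {-1..1}")
      case True
      have "std_normal_density (c / r) \<le> std_normal_density (c / r * x)"
      proof -
        have "x\<^sup>2 \<le> 1" using True by (auto simp: abs_square_le_1)
        then have "(c / r * x)\<^sup>2 \<le> (c / r)\<^sup>2"
          unfolding power_mult_distrib by (intro mult_left_le) auto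
        then show ?thesis unfolding std_normal_density_def by (intro mult_left_mono) auto
      qed
      moreover have "\<omega> x * (H f x * H f x) \<le> (H f x)\<^sup>2"
        unfolding power2_eq_square using omega_w_le_1[of \<alpha> x] alpha_pos True by (intro mult_left_le_one_le) auto
      ultimately have "std_normal_density (c / r) * (\<omega> x * (H f x * H f x)) \<le> std_normal_density (c / r * x) * (H f x)\<^sup>2"
        by (intro mult_mono) auto
      then show ?thesis using True unfolding g_def Hr by simp
    next
      case False
      then show ?thesis by (simp add: g_def)
    qed
  qed
  finally show ?thesis unfolding eq using c_pos r by (intro mult_left_mono) auto
qed

text \<open>This is \<open>Q \<le> 1\<close>. As \<open>r\<close> grows the window shrinks to 0, the
  density there tends to \<open>1 / sqrt (2 * pi)\<close>, and this factor combined with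
  \<open>sqrt (2 * pi) / r\<close> gives the constant.\<close>

lemma H_norm_bound:
  assumes f: "f \<in> Bd" shows "ip (H f) (H f) \<le> 2 * pi / c * ip f f"
proof -
  have "c * exp (- ((c / real (Suc n))\<^sup>2) / 2) * ip (H f) (H f) \<le> 2 * pi * ip f f" for n
  proof -
    define r where "r = real (Suc n)"
    have r: "0 < r" by (simp add: r_def)
    interpret r: hartley \<alpha> r by unfold_locales (rule r)
    have "c / r * (std_normal_density (c / r) * ip (H f) (H f)) \<le> sqrt (2 * pi) / r * ip f f"
      using Gauss_lower_bound[OF f r] r.Gauss_H_sq[OF f] r.Gauss_form_bound[OF f] by linarith
    then have "c * (std_normal_density (c / r) * ip (H f) (H f)) \<le> sqrt (2 * pi) * ip f f"
      using r by (simp add: field_simps)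
    then have "sqrt (2 * pi) * (c * (std_normal_density (c / r) * ip (H f) (H f))) \<le> sqrt (2 * pi) * (sqrt (2 * pi) * ip f f)"
      by (rule mult_left_mono) simp
    then show ?thesis unfolding r_def[symmetric]
      by (simp add: std_normal_density_def mult.assoc[symmetric])
  qed
  moreover have l: "(\<lambda>n. c / real (Suc n)) \<longlonglongrightarrow> 0" by (rule LIMSEQ_Suc[OF lim_const_over_n])
  then have "(\<lambda>n. c * exp (- ((c / real (Suc n))\<^sup>2) / 2) * ip (H f) (H f)) \<longlonglongrightarrow> c * exp (- (0\<^sup>2) / 2) * ip (H f) (H f)"
    by (intro tendsto_intros) auto
  ultimately have "c * exp (- (0\<^sup>2) / 2) * ip (H f) (H f) \<le> 2 * pi * ip f f"
    by (intro LIMSEQ_le_const2) auto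
  then show ?thesis using c_pos by (simp add: field_simps)
qed

end

section \<open>The Hilbert--Schmidt norm\<close>

context jacobi_weight begin

text \<open>The weight extended by 0, with values in \<open>ennreal\<close>, so that shifts and
  Fatou's lemma apply on the whole line.\<close>

definition we :: "real \<Rightarrow> ennreal" where "we x = ennreal (indicator {-1..1} x * \<omega> x)"

lemma we_measurable [measurable]: "we \<in> borel_measurable borel"
  unfolding we_def by measurable

lemma nn_integral_wmeas:
  assumes [measurable]: "f \<in> borel_measurable borel"
  shows "(\<integral>\<^sup>+x. f x \<partial>M) = (\<integral>\<^sup>+x. we x * f x \<partial>lborel)"
proof -
  have "(\<integral>\<^sup>+x. f x \<partial>M) = (\<integral>\<^sup>+x. ennreal (\<omega> x) * f x \<partial>(restrict_space lborel {-1..1}))"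
    unfolding wmeas_def by (rule nn_integral_density) (auto simp: measurable_restrict_space1)
  also have "\<dots> = (\<integral>\<^sup>+x. ennreal (\<omega> x) * f x * indicator {-1..1} x \<partial>lborel)"
    by (rule nn_integral_restrict_space) auto
  also have "\<dots> = (\<integral>\<^sup>+x. we x * f x \<partial>lborel)"
    by (intro nn_integral_cong) (auto simp: we_def indicator_def)
  finally show ?thesis .
qed

text \<open>
  This is \<open>\<integral> g(t) \<phi>(t / r) dt\<close> for the autocorrelation \<open>\<phi>\<close> of the weight; as \<open>r\<close> grows, Fatou's lemma
  bounds it below by \<open>\<phi>(0) \<integral> g\<close>.
\<close>
definition corr :: "(real \<Rightarrow> real) \<Rightarrow> real \<Rightarrow> ennreal" where
  "corr g r = (\<integral>\<^sup>+t. \<integral>\<^sup>+x. ennreal (g t) * we x * we (x - t / r) \<partial>lborel \<partial>lborel)"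

text \<open>The substitution \<open>t = r (x - y)\<close>. The Gaussian kernel and the kernel of
  \<open>H\<^sup>2\<close> both depend on this combination alone.\<close>

lemma corr_eq:
  assumes [measurable]: "g \<in> borel_measurable borel" and r: "0 < r"
  shows "ennreal r * (\<integral>\<^sup>+x. \<integral>\<^sup>+y. ennreal (g (r * (x - y))) \<partial>M \<partial>M) = corr g r"
proof -
  have inner: "ennreal r * (\<integral>\<^sup>+y. ennreal (g (r * (x - y))) \<partial>M) = (\<integral>\<^sup>+t. ennreal (g t) * we (x - t / r) \<partial>lborel)" for x
  proof -
    have "(\<integral>\<^sup>+t. ennreal (g t) * we (x - t / r) \<partial>lborel)
      = ennreal \<bar>- r\<bar> * (\<integral>\<^sup>+y. ennreal (g (r * x + (- r) * y)) * we (x - (r * x + (- r) * y) / r) \<partial>lborel)"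
      by (rule nn_integral_real_affine) (use r in auto)
    also have "(\<integral>\<^sup>+y. ennreal (g (r * x + (- r) * y)) * we (x - (r * x + (- r) * y) / r) \<partial>lborel) = (\<integral>\<^sup>+y. we y * ennreal (g (r * (x - y))) \<partial>lborel)"
    proof (rule nn_integral_cong)
      fix y
      have "x - (r * x + (- r) * y) / r = y" "r * x + (- r) * y = r * (x - y)" using r by (auto simp: field_simps)
      then show "ennreal (g (r * x + (- r) * y)) * we (x - (r * x + (- r) * y) / r) = we y * ennreal (g (r * (x - y)))"
        by (simp add: mult.commute)
    qed
    also have "\<dots> = (\<integral>\<^sup>+y. ennreal (g (r * (x - y))) \<partial>M)" by (rule nn_integral_wmeas[symmetric]) measurable
    finally show ?thesis using r by simp
  qed
  have m: "(\<lambda>x. \<integral>\<^sup>+y. ennreal (g (r * (x - y))) \<partial>M) \<in> borel_measurable borel"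
    by (subst nn_integral_wmeas) measurable
  have "ennreal r * (\<integral>\<^sup>+x. \<integral>\<^sup>+y. ennreal (g (r * (x - y))) \<partial>M \<partial>M)
    = ennreal r * (\<integral>\<^sup>+x. we x * (\<integral>\<^sup>+y. ennreal (g (r * (x - y))) \<partial>M) \<partial>lborel)"
    by (subst nn_integral_wmeas[OF m]) simp
  also have "\<dots> = (\<integral>\<^sup>+x. ennreal r * (we x * (\<integral>\<^sup>+y. ennreal (g (r * (x - y))) \<partial>M)) \<partial>lborel)"
    using m by (subst nn_integral_cmult) auto
  also have "\<dots> = (\<integral>\<^sup>+x. we x * (\<integral>\<^sup>+t. ennreal (g t) * we (x - t / r) \<partial>lborel) \<partial>lborel)"
    by (simp add: mult.left_commute[of "ennreal r"] inner)
  also have "\<dots> = (\<integral>\<^sup>+x. \<integral>\<^sup>+t. ennreal (g t) * we x * we (x - t / r) \<partial>lborel \<partial>lborel)"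
    by (intro nn_integral_cong, subst nn_integral_cmult[symmetric]) (auto simp: mult_ac)
  also have "\<dots> = corr g r"
    unfolding corr_def by (rule lborel_pair.Fubini') measurable
  finally show ?thesis .
qed

lemma we_tendsto:
  assumes x: "x \<noteq> 1" "x \<noteq> -1" and t: "t \<longlonglongrightarrow> x" shows "(\<lambda>n. we (t n)) \<longlonglongrightarrow> we x"
proof -
  have "isCont (\<lambda>x. indicator {-1..1} x * \<omega> x) x"
  proof (cases "x \<in> {-1<..<1}")
    case True
    have "\<forall>\<^sub>F y in nhds x. y \<in> {-1<..<1}" using True by (intro eventually_nhds_in_open) auto
    then have "\<forall>\<^sub>F y in nhds x. indicator {-1..1} y * \<omega> y = \<omega> y" by eventually_elim (auto simp: indicator_def)
    moreover have "isCont \<omega> x"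
    proof -
      have "\<omega> = (\<lambda>x. (1 - x\<^sup>2) powr \<alpha>)" by (auto simp: omega_w_def)
      moreover have "x\<^sup>2 \<noteq> 1" using x by (simp add: power2_eq_1_iff)
      ultimately show ?thesis by (auto intro!: continuous_intros)
    qed
    ultimately show ?thesis by (subst isCont_cong)
  next
    case False
    then have "x \<in> - {-1..1}" using x by auto
    then have "\<forall>\<^sub>F y in nhds x. y \<in> - {-1..1}" by (intro eventually_nhds_in_open) auto
    then have "\<forall>\<^sub>F y in nhds x. indicator {-1..1} y * \<omega> y = 0" by eventually_elim (auto simp: indicator_def)
    then show ?thesis by (subst isCont_cong[where g = "\<lambda>_. 0"]) auto
  qed
  then have "(\<lambda>n. indicator {-1..1} (t n) * \<omega> (t n)) \<longlonglongrightarrow> indicator {-1..1} x * \<omega> x"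
    by (rule isCont_tendsto_compose[OF _ t])
  then show ?thesis unfolding we_def by (rule tendsto_ennrealI)
qed

text \<open>Fatou in \<open>x\<close>, then in \<open>t\<close>. Integrability of \<open>g\<close>
  is not assumed: for the squared transform of the weight only a lower bound of the integral is
  derived.\<close>

lemma corr_liminf:
  assumes [measurable]: "g \<in> borel_measurable borel" and R: "filterlim R at_top sequentially"
  shows "(\<integral>\<^sup>+t. \<integral>\<^sup>+x. ennreal (g t) * we x * we x \<partial>lborel \<partial>lborel) \<le> liminf (\<lambda>n. corr g (R n))"
proof -
  have inner: "(\<integral>\<^sup>+x. ennreal (g t) * we x * we x \<partial>lborel)
    \<le> liminf (\<lambda>n. \<integral>\<^sup>+x. ennreal (g t) * we x * we (x - t / R n) \<partial>lborel)" for t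
  proof -
    have "AE x in lborel. x \<noteq> (-1::real)" "AE x in lborel. x \<noteq> (1::real)"
      by (rule AE_lborel_singleton)+
    then have "AE x in lborel. ennreal (g t) * we x * we x = liminf (\<lambda>n. ennreal (g t) * we x * we (x - t / R n))"
    proof eventually_elim
      case (elim x)
      have "(\<lambda>n. t / R n) \<longlonglongrightarrow> 0" by (rule tendsto_divide_0[OF tendsto_const filterlim_at_top_imp_at_infinity[OF R]])
      then have "(\<lambda>n. x - t / R n) \<longlonglongrightarrow> x - 0" by (intro tendsto_intros)
      then have "(\<lambda>n. we (x - t / R n)) \<longlonglongrightarrow> we x" using elim by (intro we_tendsto) auto
      then have "(\<lambda>n. ennreal (g t) * we x * we (x - t / R n)) \<longlonglongrightarrow> ennreal (g t) * we x * we x"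
        by (intro tendsto_mult_ennreal tendsto_const) (auto simp: we_def ennreal_mult_eq_top_iff)
      then show ?case by (simp add: lim_imp_Liminf)
    qed
    then have "(\<integral>\<^sup>+x. ennreal (g t) * we x * we x \<partial>lborel) = (\<integral>\<^sup>+x. liminf (\<lambda>n. ennreal (g t) * we x * we (x - t / R n)) \<partial>lborel)"
      by (rule nn_integral_cong_AE)
    also have "\<dots> \<le> liminf (\<lambda>n. \<integral>\<^sup>+x. ennreal (g t) * we x * we (x - t / R n) \<partial>lborel)"
      by (rule nn_integral_liminf) measurable
    finally show ?thesis .
  qed
  have "(\<integral>\<^sup>+t. \<integral>\<^sup>+x. ennreal (g t) * we x * we x \<partial>lborel \<partial>lborel)
    \<le> (\<integral>\<^sup>+t. liminf (\<lambda>n. \<integral>\<^sup>+x. ennreal (g t) * we x * we (x - t / R n) \<partial>lborel) \<partial>lborel)"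
    by (intro nn_integral_mono inner)
  also have "\<dots> \<le> liminf (\<lambda>n. corr g (R n))"
    unfolding corr_def by (rule nn_integral_liminf) measurable
  finally show ?thesis .
qed

text \<open>The measure carries one factor of the weight, so this is the Lebesgue integral of
  \<open>\<omega>\<^sup>2\<close>.\<close>

definition wsq :: real where "wsq = (LINT x|M. \<omega> x)"

lemma omega_Bd: "\<omega> \<in> Bd"
  using omega_w_le_1[of \<alpha>] alpha_pos by (intro BdI[of _ 1]) auto

lemma wsq_nonneg: "0 \<le> wsq"
  unfolding wsq_def by (intro integral_nonneg_AE AE_I2) simp

lemma nn_integral_we_sq: "(\<integral>\<^sup>+x. we x * we x \<partial>lborel) = ennreal wsq"
proof -
  have "(\<integral>\<^sup>+x. we x * we x \<partial>lborel) = (\<integral>\<^sup>+x. we x * ennreal (\<omega> x) \<partial>lborel)"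
    by (intro nn_integral_cong) (auto simp: we_def indicator_def)
  also have "\<dots> = (\<integral>\<^sup>+x. ennreal (\<omega> x) \<partial>M)" by (subst nn_integral_wmeas) auto
  also have "\<dots> = ennreal wsq"
    unfolding wsq_def by (rule nn_integral_eq_integral) (auto intro: omega_Bd)
  finally show ?thesis .
qed

lemma corr_limit:
  assumes [measurable]: "g \<in> borel_measurable borel"
  shows "(\<integral>\<^sup>+t. \<integral>\<^sup>+x. ennreal (g t) * we x * we x \<partial>lborel \<partial>lborel) = (\<integral>\<^sup>+t. ennreal (g t) \<partial>lborel) * ennreal wsq"
proof -
  have "(\<integral>\<^sup>+x. ennreal (g t) * we x * we x \<partial>lborel) = ennreal (g t) * ennreal wsq" for t
    by (subst nn_integral_we_sq[symmetric], subst nn_integral_cmult[symmetric]) (auto simp: mult.assoc)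
  then show ?thesis by (simp add: nn_integral_multc)
qed

lemma nn_integral_wmeas_pair:
  fixes F :: "real \<Rightarrow> real \<Rightarrow> real"
  assumes m: "(\<lambda>(x, y). F x y) \<in> borel_measurable (borel \<Otimes>\<^sub>M borel)"
    and b: "\<And>x y. x \<in> {-1..1} \<Longrightarrow> y \<in> {-1..1} \<Longrightarrow> \<bar>F x y\<bar> \<le> K" and nn: "\<And>x y. 0 \<le> F x y"
  shows "(\<integral>\<^sup>+x. \<integral>\<^sup>+y. ennreal (F x y) \<partial>M \<partial>M) = ennreal (LINT x|M. LINT y|M. F x y)"
proof -
  have FB: "F x \<in> Bd" if "x \<in> {-1..1}" for x
  proof (rule BdI)
    show "F x \<in> borel_measurable borel" using measurable_compose[OF measurable_Pair1'[of x borel borel] m] by simp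
    show "\<bar>F x y\<bar> \<le> K" if "y \<in> {-1..1}" for y using b \<open>x \<in> {-1..1}\<close> that by auto
  qed
  have "(\<integral>\<^sup>+x. \<integral>\<^sup>+y. ennreal (F x y) \<partial>M \<partial>M) = (\<integral>\<^sup>+x. ennreal (LINT y|M. F x y) \<partial>M)"
    by (intro nn_integral_cong nn_integral_eq_integral) (auto intro!: Bd_integrable FB nn simp del: atLeastAtMost_iff)
  also have "\<dots> = ennreal (LINT x|M. LINT y|M. F x y)"
  proof (rule nn_integral_eq_integral)
    show "integrable M (\<lambda>x. LINT y|M. F x y)"
      using MM.integrable_fst'[OF pair_wmeas_integrable[OF m b]] by simp
  qed (auto intro!: AE_I2 integral_nonneg_AE nn)
  finally show ?thesis .
qed

text \<open>The Fourier transform of the even weight, for which \<open>cas\<close> and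
  \<open>cos\<close> give the same value; with \<open>cas\<close> it is the Hartley transform of
  1.\<close>

definition wfourier :: "real \<Rightarrow> real" where "wfourier t = (LINT z|M. cas (t * z))"

lemma wfourier_eq_H: "hartley \<alpha> r \<Longrightarrow> wfourier (r * s) = hartley.H \<alpha> r (\<lambda>_. 1) s"
  unfolding wfourier_def by (simp add: hartley.H_def)

lemma wfourier_bound: "\<bar>wfourier t\<bar> \<le> 2 * mass"
proof -
  have "\<bar>wfourier t\<bar> \<le> (LINT z|M. 2)"
    unfolding wfourier_def
    by (rule order_trans[OF integral_abs_bound integral_mono])
       (auto intro!: integrable_abs Bd_integrable Bd_cont continuous_intros abs_cas_le)
  then show ?thesis by (simp add: mass_def)
qed

lemma wfourier_sq_bound: "(wfourier t)\<^sup>2 \<le> (2 * mass)\<^sup>2"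
  using abs_le_square_iff[of "wfourier t" "2 * mass"] wfourier_bound[of t] mass_nonneg by simp

lemma wfourier_measurable [measurable]: "wfourier \<in> borel_measurable borel"
proof -
  interpret h: hartley \<alpha> 1 by unfold_locales simp
  have "wfourier = h.H (\<lambda>_. 1)" using wfourier_eq_H[of 1] h.hartley_axioms by auto
  then show ?thesis using Bd_measurable[OF h.H_Bd] by simp
qed

lemma integral_sin_wmeas: "(LINT z|M. sin (t * z)) = 0"
proof -
  have "(\<lambda>z. sin (t * z)) \<in> Bd" by (intro Bd_cont continuous_intros)
  from integral_wmeas_reflect[OF this] show ?thesis by simp
qed

lemma wfourier_cos: "wfourier t = (LINT z|M. cos (t * z))"
proof -
  have "(\<lambda>z. cos (t * z)) \<in> Bd" "(\<lambda>z. sin (t * z)) \<in> Bd" by (intro Bd_cont continuous_intros)+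
  then have "wfourier t = (LINT z|M. cos (t * z)) + (LINT z|M. sin (t * z))"
    unfolding wfourier_def cas_def by (intro Bochner_Integration.integral_add) auto
  then show ?thesis by (simp add: integral_sin_wmeas)
qed

text \<open>The Gaussian double integral is a normal average of \<open>wfourier\<^sup>2\<close> at
  scale \<open>r\<close>; after rescaling, the density is replaced by its maximum.\<close>

lemma Gauss_wfourier:
  assumes r: "0 < r"
  shows "corr (\<lambda>t. exp (- (t\<^sup>2) / 2)) r \<le> ennreal (1 / sqrt (2 * pi)) * (\<integral>\<^sup>+t. ennreal ((wfourier t)\<^sup>2) \<partial>lborel)"
proof -
  interpret h: hartley \<alpha> r by unfold_locales (rule r)
  have "(\<integral>\<^sup>+x. \<integral>\<^sup>+y. ennreal (exp (- ((r * (x - y))\<^sup>2) / 2)) \<partial>M \<partial>M)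
    = ennreal (LINT x|M. LINT y|M. exp (- ((r * (x - y))\<^sup>2) / 2))"
  proof (rule nn_integral_wmeas_pair)
    show "(\<lambda>(x, y). exp (- ((r * (x - y))\<^sup>2) / 2)) \<in> borel_measurable (borel \<Otimes>\<^sub>M borel)"
      by measurable
    show "\<bar>exp (- ((r * (x - y))\<^sup>2) / 2)\<bar> \<le> 1" for x y by simp
  qed simp
  also have "(LINT x|M. LINT y|M. exp (- ((r * (x - y))\<^sup>2) / 2)) = (LINT s|std_normal_distribution. (h.H (\<lambda>_. 1) s)\<^sup>2)"
    by (subst h.Gauss_H_sq) (auto simp: right_diff_distrib)
  also have "\<dots> = (LINT s|std_normal_distribution. (wfourier (r * s))\<^sup>2)"
    using wfourier_eq_H[OF h.hartley_axioms] by simp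
  also have "ennreal \<dots> = (\<integral>\<^sup>+s. ennreal ((wfourier (r * s))\<^sup>2) \<partial>std_normal_distribution)"
  proof (rule nn_integral_eq_integral[symmetric])
    interpret N: real_distribution std_normal_distribution by (rule real_dist_normal_dist)
    show "integrable std_normal_distribution (\<lambda>s. (wfourier (r * s))\<^sup>2)"
    proof (rule N.integrable_const_bound[where B = "(2 * mass)\<^sup>2"])
      show "AE s in std_normal_distribution. norm ((wfourier (r * s))\<^sup>2) \<le> (2 * mass)\<^sup>2"
        using wfourier_sq_bound by (intro AE_I2) simp
    qed simp
  qed auto
  also have "\<dots> = (\<integral>\<^sup>+s. ennreal (std_normal_density s) * ennreal ((wfourier (r * s))\<^sup>2) \<partial>lborel)"
    by (rule nn_integral_density) auto
  finally have eq: "(\<integral>\<^sup>+x. \<integral>\<^sup>+y. ennreal (exp (- ((r * (x - y))\<^sup>2) / 2)) \<partial>M \<partial>M)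
    = (\<integral>\<^sup>+s. ennreal (std_normal_density s) * ennreal ((wfourier (r * s))\<^sup>2) \<partial>lborel)" .
  have "corr (\<lambda>t. exp (- (t\<^sup>2) / 2)) r = ennreal r * (\<integral>\<^sup>+x. \<integral>\<^sup>+y. ennreal (exp (- ((r * (x - y))\<^sup>2) / 2)) \<partial>M \<partial>M)"
    by (rule corr_eq[symmetric]) (use r in auto)
  also have "\<dots> = ennreal \<bar>r\<bar> * (\<integral>\<^sup>+s. ennreal (std_normal_density ((0 + r * s) / r)) * ennreal ((wfourier (0 + r * s))\<^sup>2) \<partial>lborel)"
    unfolding eq using r by simp
  also have "\<dots> = (\<integral>\<^sup>+t. ennreal (std_normal_density (t / r)) * ennreal ((wfourier t)\<^sup>2) \<partial>lborel)"
    by (rule nn_integral_real_affine[symmetric]) (use r in auto)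
  also have "\<dots> \<le> (\<integral>\<^sup>+t. ennreal (1 / sqrt (2 * pi)) * ennreal ((wfourier t)\<^sup>2) \<partial>lborel)"
  proof (intro nn_integral_mono mult_right_mono ennreal_leI)
    show "std_normal_density (t / r) \<le> 1 / sqrt (2 * pi)" for t
      unfolding std_normal_density_def by (intro mult_right_le_one_le) auto
  qed simp
  also have "\<dots> = ennreal (1 / sqrt (2 * pi)) * (\<integral>\<^sup>+t. ennreal ((wfourier t)\<^sup>2) \<partial>lborel)"
    by (rule nn_integral_cmult) measurable
  finally show ?thesis .
qed

text \<open>One half of Plancherel's theorem. As the scale grows, the correlation with the Gaussian
  has lower limit at least \<open>sqrt (2 * pi) * wsq\<close>, while \<open>Gauss_wfourier\<close>
  bounds it above independently of the scale.\<close>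

lemma Plancherel_lower: "ennreal (2 * pi * wsq) \<le> (\<integral>\<^sup>+t. ennreal ((wfourier t)\<^sup>2) \<partial>lborel)"
proof -
  define g where "g t = exp (- (t\<^sup>2) / 2)" for t :: real
  have gm [measurable]: "g \<in> borel_measurable borel" unfolding g_def by measurable
  define P where "P = (\<integral>\<^sup>+t. ennreal ((wfourier t)\<^sup>2) \<partial>lborel)"
  have gint: "(\<integral>\<^sup>+t. ennreal (g t) \<partial>lborel) = ennreal (sqrt (2 * pi))"
  proof -
    have eq: "g t = sqrt (2 * pi) * std_normal_density t" for t by (simp add: g_def std_normal_density_def)
    have "(\<integral>\<^sup>+t. ennreal (g t) \<partial>lborel) = ennreal (LINT t|lborel. g t)"
      unfolding eq by (rule nn_integral_eq_integral) auto
    also have "(LINT t|lborel. g t) = sqrt (2 * pi)" unfolding eq by simp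
    finally show ?thesis .
  qed
  have "ennreal (sqrt (2 * pi)) * ennreal wsq \<le> liminf (\<lambda>n. corr g (real (Suc n)))"
    using corr_liminf[OF gm filterlim_compose[OF filterlim_real_sequentially filterlim_Suc]] corr_limit[OF gm] gint
    by simp
  also have "\<dots> \<le> liminf (\<lambda>n. ennreal (1 / sqrt (2 * pi)) * P)"
    unfolding P_def g_def by (intro Liminf_mono always_eventually allI Gauss_wfourier) simp
  also have "\<dots> = ennreal (1 / sqrt (2 * pi)) * P" by (simp add: Liminf_const)
  finally have "ennreal (sqrt (2 * pi)) * (ennreal (sqrt (2 * pi)) * ennreal wsq)
    \<le> ennreal (sqrt (2 * pi)) * (ennreal (1 / sqrt (2 * pi)) * P)" by (rule mult_left_mono) simp
  moreover have "ennreal (sqrt (2 * pi)) * (ennreal (1 / sqrt (2 * pi)) * P) = P"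
    unfolding mult.assoc[symmetric] by (subst ennreal_mult[symmetric]) auto
  moreover have "ennreal (sqrt (2 * pi)) * (ennreal (sqrt (2 * pi)) * ennreal wsq) = ennreal (2 * pi * wsq)"
    unfolding mult.assoc[symmetric] using wsq_nonneg by (subst ennreal_mult[symmetric], simp, simp)+ simp
  ultimately show ?thesis by (simp add: P_def)
qed

text \<open>The squared Hilbert--Schmidt norm of \<open>H\<^sup>2\<close> at parameter
  \<open>r\<close>, whose kernel is identified in \<open>H_cas\<close>.\<close>

definition HS :: "real \<Rightarrow> real" where
  "HS r = (LINT x|M. LINT y|M. (wfourier (r * (x - y)))\<^sup>2)"

lemma corr_HS:
  assumes r: "0 < r" shows "corr (\<lambda>t. (wfourier t)\<^sup>2) r = ennreal (r * HS r)"
proof -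
  have "(\<integral>\<^sup>+x. \<integral>\<^sup>+y. ennreal ((wfourier (r * (x - y)))\<^sup>2) \<partial>M \<partial>M) = ennreal (HS r)"
    unfolding HS_def
  proof (rule nn_integral_wmeas_pair)
    show "\<bar>(wfourier (r * (x - y)))\<^sup>2\<bar> \<le> (2 * mass)\<^sup>2" for x y
      using wfourier_sq_bound by simp
    show "(\<lambda>(x, y). (wfourier (r * (x - y)))\<^sup>2) \<in> borel_measurable (borel \<Otimes>\<^sub>M borel)"
      by measurable
  qed simp
  then show ?thesis
    using corr_eq[of "\<lambda>t. (wfourier t)\<^sup>2" r] r by (simp add: ennreal_mult')
qed

text \<open>\<open>r * HS r\<close> is the correlation of \<open>wfourier\<^sup>2\<close>; its lower
  limit is at least the integral of that function times \<open>wsq\<close>, hence at least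
  \<open>2 * pi * wsq\<^sup>2\<close>. A sequence of exceptions would contradict this.\<close>

lemma HS_asymptotics:
  assumes \<eta>: "0 < \<eta>" shows "\<forall>\<^sub>F r in at_top. 2 * pi * wsq\<^sup>2 - \<eta> \<le> r * HS r"
proof (rule ccontr)
  assume "\<not> ?thesis"
  then have "\<forall>n::nat. \<exists>r\<ge>real (Suc n). r * HS r < 2 * pi * wsq\<^sup>2 - \<eta>"
    unfolding eventually_at_top_linorder by (auto simp: not_le)
  then obtain R where R: "\<And>n. real (Suc n) \<le> R n" "\<And>n. R n * HS (R n) < 2 * pi * wsq\<^sup>2 - \<eta>" by metis
  have Rp: "0 < R n" for n using R(1)[of n] by linarith
  have lim: "filterlim R at_top sequentially"
  proof (rule filterlim_at_top_mono[OF filterlim_real_sequentially])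
    show "\<forall>\<^sub>F n in sequentially. real n \<le> R n" using R(1) by (intro always_eventually allI) (smt (verit) of_nat_Suc)
  qed
  have "ennreal (2 * pi * wsq) * ennreal wsq \<le> (\<integral>\<^sup>+t. ennreal ((wfourier t)\<^sup>2) \<partial>lborel) * ennreal wsq"
    by (intro mult_right_mono Plancherel_lower) simp
  also have "\<dots> \<le> liminf (\<lambda>n. corr (\<lambda>t. (wfourier t)\<^sup>2) (R n))"
    using corr_liminf[OF _ lim, of "\<lambda>t. (wfourier t)\<^sup>2"] corr_limit[of "\<lambda>t. (wfourier t)\<^sup>2"] by simp
  also have "\<dots> \<le> liminf (\<lambda>n. ennreal (2 * pi * wsq\<^sup>2 - \<eta>))"
    unfolding corr_HS[OF Rp] by (intro Liminf_mono always_eventually allI ennreal_leI less_imp_le R(2))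
  also have "\<dots> = ennreal (2 * pi * wsq\<^sup>2 - \<eta>)" by (simp add: Liminf_const)
  finally have "ennreal (2 * pi * wsq\<^sup>2) \<le> ennreal (2 * pi * wsq\<^sup>2 - \<eta>)"
    using wsq_nonneg by (simp add: power2_eq_square ennreal_mult[symmetric] mult.assoc)
  \<comment> \<open>\<open>ennreal\<close> sends negative numbers to 0, so the right-hand side must
    be nonnegative before the comparison returns to the reals.\<close>
  moreover have "0 \<le> R 0 * HS (R 0)"
    unfolding HS_def using Rp[of 0] by (intro mult_nonneg_nonneg integral_nonneg_AE AE_I2) auto
  then have "0 \<le> 2 * pi * wsq\<^sup>2 - \<eta>" using R(2)[of 0] by linarith
  ultimately have "2 * pi * wsq\<^sup>2 \<le> 2 * pi * wsq\<^sup>2 - \<eta>" by (rule ennreal_le_iff[THEN iffD1, rotated])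
  then show False using \<eta> by simp
qed

end

section \<open>Counting eigenvalues\<close>

context hartley begin

text \<open>The kernel of \<open>H\<^sup>2\<close> depends on \<open>x - y\<close> alone: the
  product of two \<open>cas\<close> is a cosine of the difference plus a sine of the sum, and the
  sine integrates to 0.\<close>

lemma H_cas: "H (\<lambda>z. cas (c * x * z)) y = wfourier (c * (x - y))"
proof -
  have B: "(\<lambda>z. cos (c * (x - y) * z)) \<in> Bd" "(\<lambda>z. sin (c * (x + y) * z)) \<in> Bd"
    by (intro Bd_cont continuous_intros)+
  have "H (\<lambda>z. cas (c * x * z)) y = (LINT z|M. cos (c * (x - y) * z) + sin (c * (x + y) * z))"
    unfolding H_def
  proof (intro Bochner_Integration.integral_cong refl)
    fix z
    have "c * (x - y) * z = c * x * z - c * y * z" "c * (x + y) * z = c * x * z + c * y * z"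
      by (simp_all add: algebra_simps)
    then show "cas (c * y * z) * cas (c * x * z) = cos (c * (x - y) * z) + sin (c * (x + y) * z)"
      unfolding cas_def by (simp add: cos_diff sin_add algebra_simps)
  qed
  also have "\<dots> = (LINT z|M. cos (c * (x - y) * z))"
    using B by (simp add: Bochner_Integration.integral_add integral_sin_wmeas)
  finally show ?thesis by (simp add: wfourier_cos)
qed

lemma HS_eq: "HS c = (LINT x|M. ip (H (\<lambda>z. cas (c * x * z))) (H (\<lambda>z. cas (c * x * z))))"
  unfolding HS_def ip_def by (simp add: H_cas power2_eq_square)

text \<open>The slice at \<open>x\<close> of the kernel of \<open>H\<^sup>2\<close> has coefficients
  \<open>\<nu>\<^sup>2 \<psi>(x)\<close>, that of \<open>H\<close> has
  \<open>\<nu> \<psi>(x)\<close>. Subtracting \<open>t\<close> times the Bessel sum of the latter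
  leaves terms that are nonpositive beyond the level, so a finite sum remains, ready to be
  integrated.\<close>

lemma kernel_norm_bound:
  assumes t: "0 < t"
  shows "ip (H (\<lambda>z. cas (c * x * z))) (H (\<lambda>z. cas (c * x * z)))
    \<le> (\<Sum>\<kappa>\<in>level t. ((ev \<kappa>)\<^sup>2 * ((ev \<kappa>)\<^sup>2 - t)) * (efun \<kappa> x)\<^sup>2) + t * mass"
proof -
  define h where "h = (\<lambda>z. cas (c * x * z))"
  have hB: "h \<in> Bd" unfolding h_def by (rule cas_Bd)
  have coef: "ip h (efun \<kappa>) = ev \<kappa> * efun \<kappa> x" if "\<kappa> \<in> spec" for \<kappa>
    using jeigD(3)[OF efun[OF that], of x] by (simp add: h_def H_eq_ip)
  have Hcoef: "ip (H h) (efun \<kappa>) = (ev \<kappa>)\<^sup>2 * efun \<kappa> x" if k: "\<kappa> \<in> spec" for \<kappa>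
  proof -
    have "ip (H h) (efun \<kappa>) = ip h (H (efun \<kappa>))" by (rule H_symmetric[OF hB jeigD(1)[OF efun[OF k]]])
    also have "\<dots> = ip h (\<lambda>y. ev \<kappa> * efun \<kappa> y)" by (rule ip_cong) (auto simp: jeigD(3)[OF efun[OF k]])
    finally show ?thesis using coef[OF k] by (simp add: power2_eq_square)
  qed
  have "ip (H h) (H h) \<le> (\<Sum>\<kappa>\<in>level t. ((ev \<kappa>)\<^sup>2 * ((ev \<kappa>)\<^sup>2 - t)) * (efun \<kappa> x)\<^sup>2) + t * mass + e" if e: "0 < e" for e
  proof -
    obtain S where S: "finite S" "S \<subseteq> spec" "\<And>T. finite T \<Longrightarrow> S \<subseteq> T \<Longrightarrow> T \<subseteq> spec \<Longrightarrow>
      ip (residual T efun (H h)) (residual T efun (H h)) < e"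
      using completeness[OF approximable_continuous[OF H_continuous[OF hB]] e] by metis
    define T where "T = S \<union> level t"
    have T: "finite T" "T \<subseteq> spec" "S \<subseteq> T" using S finite_level[OF t] level_sub by (auto simp: T_def)
    note on = efun_orthonormal[OF T(2)]
    have 1: "ip (H h) (H h) < e + (\<Sum>\<kappa>\<in>T. (ip (H h) (efun \<kappa>))\<^sup>2)"
      using residual_sq[OF on H_Bd[OF hB] T(1)] S(3)[OF T(1) T(3) T(2)] by linarith
    have "(\<Sum>\<kappa>\<in>T. (ip (H h) (efun \<kappa>))\<^sup>2) - t * (\<Sum>\<kappa>\<in>T. (ip h (efun \<kappa>))\<^sup>2)
      = (\<Sum>\<kappa>\<in>T. ((ev \<kappa>)\<^sup>2 * ((ev \<kappa>)\<^sup>2 - t)) * (efun \<kappa> x)\<^sup>2)"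
      unfolding sum_distrib_left sum_subtractf[symmetric]
    proof (rule sum.cong[OF refl])
      fix \<kappa> assume "\<kappa> \<in> T"
      then have k: "\<kappa> \<in> spec" using T(2) by auto
      show "(ip (H h) (efun \<kappa>))\<^sup>2 - t * (ip h (efun \<kappa>))\<^sup>2 = ((ev \<kappa>)\<^sup>2 * ((ev \<kappa>)\<^sup>2 - t)) * (efun \<kappa> x)\<^sup>2"
        unfolding coef[OF k] Hcoef[OF k] by (simp add: power2_eq_square algebra_simps)
    qed
    also have "\<dots> \<le> (\<Sum>\<kappa>\<in>level t. ((ev \<kappa>)\<^sup>2 * ((ev \<kappa>)\<^sup>2 - t)) * (efun \<kappa> x)\<^sup>2)"
    proof -
      have "(\<Sum>\<kappa>\<in>T - level t. ((ev \<kappa>)\<^sup>2 * ((ev \<kappa>)\<^sup>2 - t)) * (efun \<kappa> x)\<^sup>2) \<le> 0"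
      proof (rule sum_nonpos)
        fix \<kappa> assume "\<kappa> \<in> T - level t"
        then have "(ev \<kappa>)\<^sup>2 - t \<le> 0" using T(2) by (auto simp: level_def)
        then show "((ev \<kappa>)\<^sup>2 * ((ev \<kappa>)\<^sup>2 - t)) * (efun \<kappa> x)\<^sup>2 \<le> 0"
          by (intro mult_nonpos_nonneg mult_nonneg_nonpos) auto
      qed
      moreover have "(\<Sum>\<kappa>\<in>T. ((ev \<kappa>)\<^sup>2 * ((ev \<kappa>)\<^sup>2 - t)) * (efun \<kappa> x)\<^sup>2)
        = (\<Sum>\<kappa>\<in>T - level t. ((ev \<kappa>)\<^sup>2 * ((ev \<kappa>)\<^sup>2 - t)) * (efun \<kappa> x)\<^sup>2)
        + (\<Sum>\<kappa>\<in>level t. ((ev \<kappa>)\<^sup>2 * ((ev \<kappa>)\<^sup>2 - t)) * (efun \<kappa> x)\<^sup>2)"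
        using T(1) by (intro sum.subset_diff) (auto simp: T_def)
      ultimately show ?thesis by linarith
    qed
    finally have 2: "(\<Sum>\<kappa>\<in>T. (ip (H h) (efun \<kappa>))\<^sup>2) - t * (\<Sum>\<kappa>\<in>T. (ip h (efun \<kappa>))\<^sup>2)
      \<le> (\<Sum>\<kappa>\<in>level t. ((ev \<kappa>)\<^sup>2 * ((ev \<kappa>)\<^sup>2 - t)) * (efun \<kappa> x)\<^sup>2)" .
    have "(\<Sum>\<kappa>\<in>T. (ip h (efun \<kappa>))\<^sup>2) \<le> mass"
      using Bessel[OF on hB T(1)] ip_cas_cas[of "c * x"] by (simp add: h_def)
    then have "t * (\<Sum>\<kappa>\<in>T. (ip h (efun \<kappa>))\<^sup>2) \<le> t * mass" using t by (intro mult_left_mono) auto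
    then show ?thesis using 1 2 by linarith
  qed
  then show ?thesis unfolding h_def by (rule field_le_epsilon)
qed

text \<open>\<open>kernel_norm_bound\<close> integrated at \<open>t = q * \<delta>\<close>, the
  level that corresponds to the eigenvalue \<delta> of \<open>Q\<close>. Each coefficient is at most
  \<open>q\<^sup>2 * (1 - \<delta>)\<close>, because \<open>(ev \<kappa>)\<^sup>2\<close> lies
  between \<open>q * \<delta>\<close> and the norm bound \<open>q\<close>.\<close>

lemma HS_le_count:
  assumes \<delta>: "0 < \<delta>" "\<delta> < 1"
  shows "(c / (2 * pi))\<^sup>2 * HS c - \<delta> * (c / (2 * pi)) * mass\<^sup>2 \<le> (1 - \<delta>) * card (level (2 * pi * \<delta> / c))"
proof -
  define q where "q = 2 * pi / c"
  have q: "0 < q" unfolding q_def using c_pos by simp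
  define t where "t = q * \<delta>"
  have t: "0 < t" unfolding t_def using q \<delta> by simp
  define a where "a \<kappa> = (ev \<kappa>)\<^sup>2 * ((ev \<kappa>)\<^sup>2 - t)" for \<kappa>
  have eB: "efun \<kappa> \<in> Bd" and e1: "(LINT x|M. (efun \<kappa> x)\<^sup>2) = 1" if "\<kappa> \<in> level t" for \<kappa>
    using jeigD(1,5)[OF efun] level_sub that by (auto simp: ip_def power2_eq_square subset_iff)
  have ak: "a \<kappa> \<le> q\<^sup>2 * (1 - \<delta>)" if k: "\<kappa> \<in> level t" for \<kappa>
  proof -
    have ks: "\<kappa> \<in> spec" using k level_sub by auto
    have "(ev \<kappa>)\<^sup>2 \<le> q"
      using H_norm_bound[OF jeigD(1)[OF efun[OF ks]]] ip_H_efun[OF ks] jeigD(5)[OF efun[OF ks]] by (simp add: q_def)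
    moreover have "t \<le> (ev \<kappa>)\<^sup>2" using k by (simp add: level_def)
    ultimately have "a \<kappa> \<le> q * (q - t)" unfolding a_def using q by (intro mult_mono) auto
    then show ?thesis by (simp add: t_def power2_eq_square algebra_simps)
  qed
  have "HS c \<le> (LINT x|M. (\<Sum>\<kappa>\<in>level t. a \<kappa> * (efun \<kappa> x)\<^sup>2) + t * mass)"
    unfolding HS_eq
  proof (rule integral_mono)
    have "(\<lambda>(x, y). (wfourier (c * (x - y)))\<^sup>2) \<in> borel_measurable (borel \<Otimes>\<^sub>M borel)" by measurable
    then have "integrable (M \<Otimes>\<^sub>M M) (\<lambda>(x, y). (wfourier (c * (x - y)))\<^sup>2)"
      by (rule pair_wmeas_integrable) (use wfourier_sq_bound in auto)
    then have "integrable M (\<lambda>x. LINT y|M. (wfourier (c * (x - y)))\<^sup>2)" using MM.integrable_fst' by fastforce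
    then show "integrable M (\<lambda>x. ip (H (\<lambda>z. cas (c * x * z))) (H (\<lambda>z. cas (c * x * z))))"
      unfolding ip_def H_cas power2_eq_square .
    show "integrable M (\<lambda>x. (\<Sum>\<kappa>\<in>level t. a \<kappa> * (efun \<kappa> x)\<^sup>2) + t * mass)"
      by (intro Bd_integrable Bd_add Bd_sum Bd_cmult Bd_power Bd_const eB)
    show "ip (H (\<lambda>z. cas (c * x * z))) (H (\<lambda>z. cas (c * x * z))) \<le> (\<Sum>\<kappa>\<in>level t. a \<kappa> * (efun \<kappa> x)\<^sup>2) + t * mass" for x
      unfolding a_def by (rule kernel_norm_bound[OF t])
  qed
  also have "\<dots> = (LINT x|M. (\<Sum>\<kappa>\<in>level t. a \<kappa> * (efun \<kappa> x)\<^sup>2)) + t * mass\<^sup>2"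
  proof -
    have "(LINT x|M. t * mass) = t * mass\<^sup>2" by (simp add: mass_def power2_eq_square)
    moreover have "integrable M (\<lambda>x. \<Sum>\<kappa>\<in>level t. a \<kappa> * (efun \<kappa> x)\<^sup>2)"
      by (intro Bd_integrable Bd_sum Bd_cmult Bd_power eB)
    ultimately show ?thesis by (simp add: Bochner_Integration.integral_add)
  qed
  also have "(LINT x|M. (\<Sum>\<kappa>\<in>level t. a \<kappa> * (efun \<kappa> x)\<^sup>2)) = (\<Sum>\<kappa>\<in>level t. a \<kappa>)"
  proof -
    have "(LINT x|M. (\<Sum>\<kappa>\<in>level t. a \<kappa> * (efun \<kappa> x)\<^sup>2)) = (\<Sum>\<kappa>\<in>level t. (LINT x|M. a \<kappa> * (efun \<kappa> x)\<^sup>2))"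
      by (intro Bochner_Integration.integral_sum Bd_integrable Bd_cmult Bd_power eB)
    also have "\<dots> = (\<Sum>\<kappa>\<in>level t. a \<kappa>)" by (intro sum.cong refl) (simp add: e1)
    finally show ?thesis .
  qed
  also have "(\<Sum>\<kappa>\<in>level t. a \<kappa>) \<le> real (card (level t)) * (q\<^sup>2 * (1 - \<delta>))"
    by (intro sum_bounded_above ak)
  finally have "HS c \<le> real (card (level t)) * (q\<^sup>2 * (1 - \<delta>)) + t * mass\<^sup>2" by simp
  then have "(1 / q)\<^sup>2 * HS c \<le> (1 / q)\<^sup>2 * (real (card (level t)) * (q\<^sup>2 * (1 - \<delta>)) + t * mass\<^sup>2)"
    by (rule mult_left_mono) simp
  also have "\<dots> = (1 - \<delta>) * card (level t) + \<delta> * (1 / q) * mass\<^sup>2"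
    using q by (simp add: t_def power2_eq_square field_simps)
  finally have "(1 / q)\<^sup>2 * HS c - \<delta> * (1 / q) * mass\<^sup>2 \<le> (1 - \<delta>) * card (level t)" by linarith
  moreover have "1 / q = c / (2 * pi)" "t = 2 * pi * \<delta> / c" by (simp_all add: q_def t_def)
  ultimately show ?thesis by simp
qed

section \<open>From the complex operator \<open>Q\<close> to the real transform
  \<open>H\<close>\<close>

definition Ctr :: "(real \<Rightarrow> real) \<Rightarrow> real \<Rightarrow> real" where "Ctr f x = (LINT y|M. cos (c * x * y) * f y)"
definition Str :: "(real \<Rightarrow> real) \<Rightarrow> real \<Rightarrow> real" where "Str f x = (LINT y|M. sin (c * x * y) * f y)"

lemma integrable_mult_bounded:
  fixes f :: "real \<Rightarrow> real"
  assumes "integrable M f" "\<phi> \<in> Bd" shows "integrable M (\<lambda>y. \<phi> y * f y)"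
proof -
  obtain K where K: "0 \<le> K" "\<And>x. x \<in> {-1..1} \<Longrightarrow> \<bar>\<phi> x\<bar> \<le> K" using Bd_bound[OF assms(2)] by blast
  show ?thesis
  proof (rule Bochner_Integration.integrable_bound)
    show "integrable M (\<lambda>y. K * f y)" using assms(1) by simp
    show "(\<lambda>y. \<phi> y * f y) \<in> borel_measurable M"
      using borel_measurable_integrable[OF assms(1)] borel_measurable_wmeas[OF Bd_measurable[OF assms(2)]] by measurable
    show "AE y in M. norm (\<phi> y * f y) \<le> norm (K * f y)"
      using K by (intro AE_I2) (auto simp: abs_mult intro!: mult_right_mono)
  qed
qed

text \<open>Eigenfunctions of \<open>Q\<close> are only square integrable and may lie outside
  \<open>Bd\<close>. For integrable \<open>f\<close> the transform is still Lipschitz, so one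
  application leads into \<open>Bd\<close>.\<close>

lemma transform_continuous:
  fixes \<phi> :: "real \<Rightarrow> real"
  assumes f: "integrable M f" and \<phi>: "continuous_on UNIV \<phi>" "\<And>a. \<bar>\<phi> a\<bar> \<le> 1" "\<And>a b. \<bar>\<phi> a - \<phi> b\<bar> \<le> \<bar>a - b\<bar>"
  shows "continuous_on UNIV (\<lambda>x. LINT y|M. \<phi> (c * x * y) * f y)"
proof -
  define L where "L = c * (LINT y|M. \<bar>f y\<bar>)"
  have pB: "(\<lambda>y. \<phi> (c * x * y)) \<in> Bd" for x
    by (intro Bd_cont continuous_on_compose2[OF \<phi>(1)] continuous_intros) auto
  have int: "integrable M (\<lambda>y. \<phi> (c * x * y) * f y)" for x by (rule integrable_mult_bounded[OF f pB])
  have lip: "\<bar>(LINT y|M. \<phi> (c * x * y) * f y) - (LINT y|M. \<phi> (c * x' * y) * f y)\<bar> \<le> L * \<bar>x - x'\<bar>" for x x'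
  proof -
    have "(LINT y|M. \<phi> (c * x * y) * f y) - (LINT y|M. \<phi> (c * x' * y) * f y)
      = (LINT y|M. \<phi> (c * x * y) * f y - \<phi> (c * x' * y) * f y)"
      by (rule Bochner_Integration.integral_diff[symmetric]) (rule int)+
    also have "\<bar>\<dots>\<bar> \<le> (LINT y|M. c * \<bar>x - x'\<bar> * \<bar>f y\<bar>)"
    proof (rule order_trans[OF integral_abs_bound integral_mono])
      show "integrable M (\<lambda>y. \<bar>\<phi> (c * x * y) * f y - \<phi> (c * x' * y) * f y\<bar>)" by (intro integrable_abs Bochner_Integration.integrable_diff int)
      show "integrable M (\<lambda>y. c * \<bar>x - x'\<bar> * \<bar>f y\<bar>)" using f by auto
      fix y assume "y \<in> space M"
      then have y: "\<bar>y\<bar> \<le> 1" by auto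
      have "\<bar>\<phi> (c * x * y) - \<phi> (c * x' * y)\<bar> \<le> \<bar>c * x * y - c * x' * y\<bar>" by (rule \<phi>(3))
      also have "\<dots> = c * \<bar>x - x'\<bar> * \<bar>y\<bar>"
        using c_pos by (simp add: abs_mult flip: right_diff_distrib left_diff_distrib)
      also have "\<dots> \<le> c * \<bar>x - x'\<bar>" using y c_pos by (intro mult_left_le) auto
      finally show "\<bar>\<phi> (c * x * y) * f y - \<phi> (c * x' * y) * f y\<bar> \<le> c * \<bar>x - x'\<bar> * \<bar>f y\<bar>"
        unfolding left_diff_distrib[symmetric] abs_mult by (rule mult_right_mono) simp
    qed
    also have "\<dots> = L * \<bar>x - x'\<bar>" by (simp add: L_def)
    finally show ?thesis .
  qed
  have "(L + 1)-lipschitz_on UNIV (\<lambda>x. LINT y|M. \<phi> (c * x * y) * f y)"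
  proof (rule lipschitz_onI)
    have L: "0 \<le> L" unfolding L_def using c_pos by (intro mult_nonneg_nonneg integral_nonneg_AE AE_I2) auto
    then show "0 \<le> L + 1" by simp
    fix x x' :: real
    show "dist (LINT y|M. \<phi> (c * x * y) * f y) (LINT y|M. \<phi> (c * x' * y) * f y) \<le> (L + 1) * dist x x'"
      using lip[of x x'] by (simp add: dist_real_def distrib_right)
  qed
  then show ?thesis by (rule lipschitz_on_continuous_on)
qed

lemma Ctr_Str_cont:
  assumes "integrable M f" shows "continuous_on UNIV (Ctr f)" "continuous_on UNIV (Str f)"
proof -
  have c: "\<bar>cos a - cos b\<bar> \<le> \<bar>a - b\<bar>" for a b :: real
    using field_differentiable_bound[of UNIV cos "\<lambda>x. - sin x" 1 a b] by (auto intro!: derivative_eq_intros)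
  have s: "\<bar>sin a - sin b\<bar> \<le> \<bar>a - b\<bar>" for a b :: real
    using field_differentiable_bound[of UNIV sin cos 1 a b] by (auto intro!: derivative_eq_intros)
  show "continuous_on UNIV (Ctr f)" unfolding Ctr_def[abs_def]
    by (rule transform_continuous[OF assms]) (auto intro: c continuous_intros)
  show "continuous_on UNIV (Str f)" unfolding Str_def[abs_def]
    by (rule transform_continuous[OF assms]) (auto intro: s continuous_intros)
qed

lemma trig_Bd: "(\<lambda>y. cos (k * y)) \<in> Bd" "(\<lambda>y. sin (k * y)) \<in> Bd"
  by (intro Bd_cont continuous_intros)+

lemma H_eq_Ctr_Str: "integrable M f \<Longrightarrow> H f x = Ctr f x + Str f x"
  unfolding H_def Ctr_def Str_def cas_def distrib_right
  by (intro Bochner_Integration.integral_add integrable_mult_bounded trig_Bd)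

lemma Ctr_odd: "f \<in> Bd \<Longrightarrow> (\<And>y. f (- y) = - f y) \<Longrightarrow> Ctr f x = 0"
  using integral_wmeas_reflect[of "\<lambda>y. cos (c * x * y) * f y"] trig_Bd[of "c * x"] by (simp add: Ctr_def)

lemma Str_even: "f \<in> Bd \<Longrightarrow> (\<And>y. f (- y) = f y) \<Longrightarrow> Str f x = 0"
  using integral_wmeas_reflect[of "\<lambda>y. sin (c * x * y) * f y"] trig_Bd[of "c * x"] by (simp add: Str_def)

text \<open>A sine transform is odd and a cosine transform is even, and the opposite transform
  annihilates each.\<close>

lemma Ctr_Str_mixed:
  assumes "integrable M f" shows "Ctr (Str f) x = 0" "Str (Ctr f) x = 0"
proof -
  show "Ctr (Str f) x = 0"
    by (rule Ctr_odd[OF Bd_cont[OF Ctr_Str_cont(2)[OF assms]]]) (simp add: Str_def)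
  show "Str (Ctr f) x = 0"
    by (rule Str_even[OF Bd_cont[OF Ctr_Str_cont(1)[OF assms]]]) (simp add: Ctr_def)
qed

lemma Ctr_add: "integrable M f \<Longrightarrow> integrable M g \<Longrightarrow> Ctr (\<lambda>x. f x + g x) x = Ctr f x + Ctr g x"
  and Str_add: "integrable M f \<Longrightarrow> integrable M g \<Longrightarrow> Str (\<lambda>x. f x + g x) x = Str f x + Str g x"
  and Ctr_diff: "integrable M f \<Longrightarrow> integrable M g \<Longrightarrow> Ctr (\<lambda>x. f x - g x) x = Ctr f x - Ctr g x"
  unfolding Ctr_def Str_def distrib_left right_diff_distrib
  by (intro Bochner_Integration.integral_add Bochner_Integration.integral_diff integrable_mult_bounded trig_Bd; assumption)+

text \<open>The sum of the two squares is what the adjoint times the complex transform produces on a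
  real function.\<close>

lemma H_H:
  assumes f: "integrable M f" shows "H (H f) x = Ctr (Ctr f) x + Str (Str f) x"
proof -
  have C: "Ctr f \<in> Bd" and S: "Str f \<in> Bd" using Ctr_Str_cont[OF f] by (auto intro: Bd_cont)
  have "H f = (\<lambda>x. Ctr f x + Str f x)" using H_eq_Ctr_Str[OF f] by auto
  then have "H (H f) x = H (Ctr f) x + H (Str f) x" using H_add[OF C S] by simp
  also have "\<dots> = Ctr (Ctr f) x + Str (Str f) x"
    using H_eq_Ctr_Str[OF Bd_integrable[OF C]] H_eq_Ctr_Str[OF Bd_integrable[OF S]] Ctr_Str_mixed[OF f] by simp
  finally show ?thesis .
qed

text \<open>In the second equation the integration variable stands first in the phase, as it does in
  \<open>Fc_adj\<close>.\<close>

lemma Fourier_split: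
  assumes f: "integrable M f" and g: "integrable M g"
    and fm: "f \<in> borel_measurable borel" and gm: "g \<in> borel_measurable borel"
  shows "(LINT y:{-1..1}|lborel. cis (c * x * y) * Complex (f y) (g y) * of_real (omega_w \<alpha> y))
      = Complex (Ctr f x - Str g x) (Str f x + Ctr g x)"
    and "(LINT y:{-1..1}|lborel. cnj (cis (c * y * x)) * Complex (f y) (g y) * of_real (omega_w \<alpha> y))
      = Complex (Ctr f x + Str g x) (Ctr g x - Str f x)"
proof -
  note [measurable] = fm gm
  have int: "integrable M (\<lambda>y. cos (c * x * y) * f y)" "integrable M (\<lambda>y. sin (c * x * y) * f y)"
    "integrable M (\<lambda>y. cos (c * x * y) * g y)" "integrable M (\<lambda>y. sin (c * x * y) * g y)"
    using f g by (auto intro!: integrable_mult_bounded trig_Bd)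
  have key: "(LINT y:{-1..1}|lborel. Complex (u y) (v y) * of_real (omega_w \<alpha> y)) = Complex (LINT y|M. u y) (LINT y|M. v y)"
    if [measurable]: "u \<in> borel_measurable borel" "v \<in> borel_measurable borel" and uv: "integrable M u" "integrable M v" for u v
  proof -
    define w where "w = (\<lambda>y. complex_of_real (u y) + \<i> * complex_of_real (v y))"
    have wm: "w \<in> borel_measurable borel" unfolding w_def by measurable
    have "(LINT y:{-1..1}|lborel. Complex (u y) (v y) * of_real (omega_w \<alpha> y)) = (LINT y:{-1..1}|lborel. \<omega> y *\<^sub>R w y)"
      by (simp add: w_def scaleR_conv_of_real Complex_eq mult.commute)
    also have "\<dots> = (LINT y|M. w y)" by (rule LINT_wmeas[OF wm, symmetric])
    also have "\<dots> = complex_of_real (LINT y|M. u y) + \<i> * complex_of_real (LINT y|M. v y)"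
      unfolding w_def using uv by (subst Bochner_Integration.integral_add) auto
    finally show ?thesis by (simp add: Complex_eq)
  qed
  have "(LINT y:{-1..1}|lborel. cis (c * x * y) * Complex (f y) (g y) * of_real (omega_w \<alpha> y))
    = (LINT y:{-1..1}|lborel. Complex (cos (c * x * y) * f y - sin (c * x * y) * g y) (sin (c * x * y) * f y + cos (c * x * y) * g y) * of_real (omega_w \<alpha> y))"
    by (simp add: cis.ctr complex_mult algebra_simps)
  also have "\<dots> = Complex (LINT y|M. cos (c * x * y) * f y - sin (c * x * y) * g y) (LINT y|M. sin (c * x * y) * f y + cos (c * x * y) * g y)"
    by (rule key) (auto intro!: int)
  also have "\<dots> = Complex (Ctr f x - Str g x) (Str f x + Ctr g x)"
    unfolding Ctr_def Str_def using int by (simp add: Bochner_Integration.integral_add Bochner_Integration.integral_diff)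
  finally show "(LINT y:{-1..1}|lborel. cis (c * x * y) * Complex (f y) (g y) * of_real (omega_w \<alpha> y))
      = Complex (Ctr f x - Str g x) (Str f x + Ctr g x)" .
  have "(LINT y:{-1..1}|lborel. cnj (cis (c * y * x)) * Complex (f y) (g y) * of_real (omega_w \<alpha> y))
    = (LINT y:{-1..1}|lborel. Complex (cos (c * x * y) * f y + sin (c * x * y) * g y) (cos (c * x * y) * g y - sin (c * x * y) * f y) * of_real (omega_w \<alpha> y))"
    by (simp add: cis.ctr complex_mult complex_cnj algebra_simps)
  also have "\<dots> = Complex (LINT y|M. cos (c * x * y) * f y + sin (c * x * y) * g y) (LINT y|M. cos (c * x * y) * g y - sin (c * x * y) * f y)"
    by (rule key) (auto intro!: int)
  also have "\<dots> = Complex (Ctr f x + Str g x) (Ctr g x - Str f x)"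
    unfolding Ctr_def Str_def using int by (simp add: Bochner_Integration.integral_add Bochner_Integration.integral_diff)
  finally show "(LINT y:{-1..1}|lborel. cnj (cis (c * y * x)) * Complex (f y) (g y) * of_real (omega_w \<alpha> y))
      = Complex (Ctr f x + Str g x) (Ctr g x - Str f x)" .
qed

lemma Qc_eq:
  assumes f: "integrable M f" and g: "integrable M g"
    and fm: "f \<in> borel_measurable borel" and gm: "g \<in> borel_measurable borel"
  shows "Qc c \<alpha> (\<lambda>y. Complex (f y) (g y)) x = of_real (c / (2 * pi)) * Complex (H (H f) x) (H (H g) x)"
proof -
  define u where "u = (\<lambda>x. Ctr f x - Str g x)"
  define v where "v = (\<lambda>x. Str f x + Ctr g x)"
  have B: "Ctr f \<in> Bd" "Str f \<in> Bd" "Ctr g \<in> Bd" "Str g \<in> Bd"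
    using Ctr_Str_cont f g by (auto intro: Bd_cont)
  have uB: "u \<in> Bd" and vB: "v \<in> Bd" unfolding u_def v_def using B by auto
  have F: "Fc c \<alpha> (\<lambda>y. Complex (f y) (g y)) = (\<lambda>x. Complex (u x) (v x))"
    unfolding Fc_def u_def v_def using Fourier_split(1)[OF f g fm gm] by auto
  have "Fc_adj c \<alpha> (\<lambda>x. Complex (u x) (v x)) x = Complex (Ctr u x + Str v x) (Ctr v x - Str u x)"
    unfolding Fc_adj_def using Fourier_split(2)[of u v x] uB vB by (auto intro: Bd_measurable)
  also have "Ctr u x + Str v x = H (H f) x"
    unfolding u_def v_def using B
    by (simp add: Ctr_diff Str_add Ctr_Str_mixed[OF f] Ctr_Str_mixed[OF g] H_H[OF f])
  also have "Ctr v x - Str u x = H (H g) x"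
  proof -
    have "Str u x = Str (\<lambda>x. - 1 * Str g x + Ctr f x) x" by (simp add: u_def)
    also have "\<dots> = Str (\<lambda>x. - 1 * Str g x) x + Str (Ctr f) x" using B by (intro Str_add) auto
    also have "Str (\<lambda>x. - 1 * Str g x) x = - Str (Str g) x" by (simp add: Str_def)
    finally have "Str u x = - Str (Str g) x" by (simp add: Ctr_Str_mixed[OF f])
    moreover have "Ctr v x = Ctr (Ctr g) x"
      unfolding v_def using B by (simp add: Ctr_add Ctr_Str_mixed[OF f])
    ultimately show ?thesis by (simp add: H_H[OF g])
  qed
  finally show ?thesis unfolding Qc_def F by simp
qed

end

section \<open>Eigenvalues of \<open>Q\<close> and their eigenfunctions\<close>

context hartley begin

lemma eigenvalue_of_spec:
  assumes \<kappa>: "\<kappa> \<in> spec" shows "is_eigenvalue_Q c \<alpha> (c / (2 * pi) * (ev \<kappa>)\<^sup>2)"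
proof -
  note j = efun[OF \<kappa>]
  define \<psi> where "\<psi> = efun \<kappa>"
  have \<psi>B: "\<psi> \<in> Bd" and \<psi>C: "continuous_on UNIV \<psi>" and \<psi>1: "ip \<psi> \<psi> = 1"
    using jeigD[OF j] C2_cont(1) by (auto simp: \<psi>_def)
  have \<psi>m [measurable]: "\<psi> \<in> borel_measurable borel" using Bd_measurable[OF \<psi>B] .
  define g where "g = (\<lambda>y. Complex (\<psi> y) 0)"
  have gm: "g \<in> borel_measurable borel"
  proof -
    have "g = (\<lambda>y. complex_of_real (\<psi> y))" by (auto simp: g_def complex_eq_iff)
    then show ?thesis by simp
  qed
  have "g \<in> L2w \<alpha>"
  proof -
    have "integrable M (\<lambda>y. (\<psi> y)\<^sup>2)" using \<psi>B by (intro Bd_integrable Bd_power)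
    then have "set_integrable lborel {-1..1} (\<lambda>y. \<omega> y *\<^sub>R (\<psi> y)\<^sup>2)" by (subst (asm) integrable_wmeas_iff) auto
    then show ?thesis using gm by (simp add: L2w_def g_def complex_norm mult.commute)
  qed
  moreover have "\<not> (AE x in lborel. x \<in> {-1..1} \<longrightarrow> g x = 0)"
  proof
    assume "AE x in lborel. x \<in> {-1..1} \<longrightarrow> g x = 0"
    then have "AE x in lborel. x \<in> {-1..1} \<longrightarrow> \<psi> x * \<psi> x = 0" by eventually_elim (auto simp: g_def complex_eq_iff)
    then have "AE x in M. \<psi> x * \<psi> x = 0" by (subst AE_wmeas_iff) auto
    then have "ip \<psi> \<psi> = 0" unfolding ip_def by (rule integral_eq_zero_AE)
    then show False using \<psi>1 by simp
  qed
  moreover have "Qc c \<alpha> g x = of_real (c / (2 * pi) * (ev \<kappa>)\<^sup>2) * g x" for x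
  proof -
    have "H \<psi> = (\<lambda>x. ev \<kappa> * \<psi> x)" using jeigD(3)[OF j] by (auto simp: \<psi>_def)
    then have HH: "H (H \<psi>) x = (ev \<kappa>)\<^sup>2 * \<psi> x" by (simp add: H_scale power2_eq_square)
    have H0: "H (\<lambda>_. 0) = (\<lambda>_. 0)" by (auto simp: H_def)
    have "Qc c \<alpha> g x = of_real (c / (2 * pi)) * Complex (H (H \<psi>) x) (H (H (\<lambda>_. 0)) x)"
      unfolding g_def by (rule Qc_eq) (use \<psi>B in auto)
    then show ?thesis unfolding HH H0 by (simp add: g_def complex_eq_iff)
  qed
  ultimately show ?thesis unfolding is_eigenvalue_Q_def by blast
qed

text \<open>\<open>Q\<close> acts separately on real and imaginary parts, so one of them is a real
  eigenfunction. Replacing it by its image under \<open>Q / lam\<close> changes it on a null set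
  only, and makes it bounded with an equation valid at every point.\<close>

lemma eigenfunction_of_eigenvalue:
  assumes e: "is_eigenvalue_Q c \<alpha> lam" and lam: "0 < lam"
  obtains f where "f \<in> Bd" "ip f f = 1" "\<And>x. H (H f) x = 2 * pi / c * lam * f x"
proof -
  obtain g where g: "g \<in> L2w \<alpha>" and nz: "\<not> (AE x in lborel. x \<in> {-1..1} \<longrightarrow> g x = 0)"
    and ae: "AE x in lborel. x \<in> {-1..1} \<longrightarrow> Qc c \<alpha> g x = of_real lam * g x"
    using e by (auto simp: is_eigenvalue_Q_def)
  have gm [measurable]: "g \<in> borel_measurable borel" using g by (simp add: L2w_def)
  have sq: "integrable M (\<lambda>y. (cmod (g y))\<^sup>2)"
    using g by (subst integrable_wmeas_iff) (auto simp: L2w_def mult.commute)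
  have int: "integrable M (\<lambda>y. Re (g y))" "integrable M (\<lambda>y. Im (g y))"
  proof -
    \<comment> \<open>Square integrability on a finite measure gives integrability through
      \<open>t \<le> 1 + t\<^sup>2\<close>.\<close>
    have b: "integrable M (\<lambda>y. 1 + (cmod (g y))\<^sup>2)" using sq by simp
    have le: "t \<le> 1 + t\<^sup>2" for t :: real
      using zero_le_power2[of "t - 1/2"] by (simp add: power2_eq_square algebra_simps)
    have "\<bar>Re z\<bar> \<le> \<bar>1 + (cmod z)\<^sup>2\<bar>" "\<bar>Im z\<bar> \<le> \<bar>1 + (cmod z)\<^sup>2\<bar>" for z
      using le[of "cmod z"] abs_Re_le_cmod[of z] abs_Im_le_cmod[of z] by linarith+
    then show "integrable M (\<lambda>y. Re (g y))" "integrable M (\<lambda>y. Im (g y))"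
      by (auto intro!: Bochner_Integration.integrable_bound[OF b] borel_measurable_wmeas)
  qed
  define q where "q = c / (2 * pi)"
  have q: "0 < q" unfolding q_def using c_pos by simp
  have Q: "Qc c \<alpha> g x = of_real q * Complex (H (H (\<lambda>y. Re (g y))) x) (H (H (\<lambda>y. Im (g y))) x)" for x
    using Qc_eq[OF int, of x] by (simp add: q_def)
  note witness = that
  have fun_case: thesis
    if f: "integrable M f" and fm [measurable]: "f \<in> borel_measurable borel"
      and fe: "AE x in lborel. x \<in> {-1..1} \<longrightarrow> q * H (H f) x = lam * f x"
      and fz: "\<not> (AE x in lborel. x \<in> {-1..1} \<longrightarrow> f x = 0)" for f
  proof -
    define F where "F = (\<lambda>x. q / lam * H (H f) x)"
    have HfB: "H f \<in> Bd"
    proof -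
      have "H f = (\<lambda>x. Ctr f x + Str f x)" using H_eq_Ctr_Str[OF f] by auto
      then show ?thesis using Ctr_Str_cont[OF f] by (auto intro!: Bd_cont continuous_intros)
    qed
    have FB: "F \<in> Bd" unfolding F_def by (rule Bd_cmult[OF H_Bd[OF HfB]])
    have fF: "AE x in lborel. x \<in> {-1..1} \<longrightarrow> f x = F x"
      using fe by eventually_elim (use lam in \<open>auto simp: F_def field_simps\<close>)
    have fFM: "AE x in M. f x = F x"
      using fF Bd_measurable[OF FB] by (subst AE_wmeas_iff) auto
    have Hf: "H f x = H F x" for x
      unfolding H_def
    proof (rule integral_cong_AE)
      show "AE y in M. cas (c * x * y) * f y = cas (c * x * y) * F y" using fFM by eventually_elim simp
    qed (use Bd_measurable[OF FB] in \<open>auto intro!: borel_measurable_wmeas\<close>)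
    have HHF: "H (H F) x = 2 * pi / c * lam * F x" for x
    proof -
      have "H F = H f" using Hf by auto
      then show ?thesis using c_pos lam by (simp add: F_def q_def)
    qed
    have "ip F F \<noteq> 0"
    proof
      assume "ip F F = 0"
      then have "AE x in M. F x = 0" by (rule ip_zero_AE[OF FB])
      then have "AE x in M. f x = 0" using fFM by eventually_elim simp
      then have "AE x in lborel. x \<in> {-1..1} \<longrightarrow> f x = 0" by (subst (asm) AE_wmeas_iff) auto
      then show False using fz by simp
    qed
    then have pos: "0 < ip F F" using ip_nonneg[of F] by linarith
    define s where "s = 1 / sqrt (ip F F)"
    have s: "s * (s * ip F F) = 1" using pos by (simp add: s_def flip: power2_eq_square mult.assoc)
    show thesis
    proof (rule witness)
      show "(\<lambda>x. s * F x) \<in> Bd" using FB by (rule Bd_cmult)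
      show "ip (\<lambda>x. s * F x) (\<lambda>x. s * F x) = 1" using s by simp
      have "H (\<lambda>x. s * F x) = (\<lambda>x. s * H F x)" by (auto simp: H_scale)
      then show "H (H (\<lambda>x. s * F x)) x = 2 * pi / c * lam * (s * F x)" for x
        by (simp add: H_scale HHF)
    qed
  qed
  show thesis
  proof (cases "AE x in lborel. x \<in> {-1..1} \<longrightarrow> Re (g x) = 0")
    case False
    show thesis
    proof (rule fun_case[OF int(1) _ _ False])
      show "AE x in lborel. x \<in> {-1..1} \<longrightarrow> q * H (H (\<lambda>y. Re (g y))) x = lam * Re (g x)"
        using ae by eventually_elim (auto simp: Q complex_eq_iff)
    qed measurable
  next
    case True
    have "\<not> (AE x in lborel. x \<in> {-1..1} \<longrightarrow> Im (g x) = 0)"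
    proof
      assume "AE x in lborel. x \<in> {-1..1} \<longrightarrow> Im (g x) = 0"
      with True have "AE x in lborel. x \<in> {-1..1} \<longrightarrow> g x = 0"
        by eventually_elim (auto simp: complex_eq_iff)
      then show False using nz by simp
    qed
    then show thesis
    proof (rule fun_case[OF int(2), rotated 2])
      show "AE x in lborel. x \<in> {-1..1} \<longrightarrow> q * H (H (\<lambda>y. Im (g y))) x = lam * Im (g x)"
        using ae by eventually_elim (auto simp: Q complex_eq_iff)
    qed measurable
  qed
qed

text \<open>One eigenfunction per value gives an orthonormal system, by symmetry of
  \<open>H\<^sup>2\<close>, and each member contributes at least
  \<open>2 * pi / c * \<delta>\<close> to the trace. Finite subsets come first because finiteness of
  the whole set is deduced from them.\<close>

lemma eigenvalue_count_finite_bound: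
  assumes \<delta>: "0 < \<delta>" and S: "S \<subseteq> {lam. is_eigenvalue_Q c \<alpha> lam \<and> \<delta> \<le> lam}" "finite S"
  shows "real (card S) \<le> 1 / \<delta> * (c / (2 * pi)) * mass\<^sup>2"
proof -
  have "\<forall>lam\<in>S. \<exists>f. f \<in> Bd \<and> ip f f = 1 \<and> (\<forall>x. H (H f) x = 2 * pi / c * lam * f x)"
  proof
    fix lam assume "lam \<in> S"
    then have "is_eigenvalue_Q c \<alpha> lam" "0 < lam" using S \<delta> by auto
    then obtain f where "f \<in> Bd" "ip f f = 1" "\<And>x. H (H f) x = 2 * pi / c * lam * f x"
      using eigenfunction_of_eigenvalue by blast
    then show "\<exists>f. f \<in> Bd \<and> ip f f = 1 \<and> (\<forall>x. H (H f) x = 2 * pi / c * lam * f x)" by blast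
  qed
  then obtain e where e: "\<And>lam. lam \<in> S \<Longrightarrow> e lam \<in> Bd" "\<And>lam. lam \<in> S \<Longrightarrow> ip (e lam) (e lam) = 1"
    "\<And>lam x. lam \<in> S \<Longrightarrow> H (H (e lam)) x = 2 * pi / c * lam * e lam x" by metis
  have HHip: "ip (H (H (e l))) f = 2 * pi / c * l * ip (e l) f" if "l \<in> S" for l f
  proof -
    have "H (H (e l)) = (\<lambda>x. 2 * pi / c * l * e l x)" using e(3)[OF that] by auto
    then show ?thesis by (simp only: ip_scale_left)
  qed
  have on: "orthonormal_on S e"
    unfolding orthonormal_on_def
  proof (intro conjI ballI)
    fix i j assume i: "i \<in> S" and j: "j \<in> S"
    show "ip (e i) (e j) = (if i = j then 1 else 0)"
    proof (cases "i = j")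
      case True then show ?thesis using e(2) i by simp
    next
      case False
      have "2 * pi / c * i * ip (e i) (e j) = ip (H (H (e i))) (e j)" using HHip[OF i] by simp
      also have "\<dots> = ip (e i) (H (H (e j)))" using e(1) i j by (simp add: H_symmetric)
      also have "\<dots> = 2 * pi / c * j * ip (e i) (e j)" using HHip[OF j, of "e i"] by (simp only: ip_sym[of "e i"])
      finally show ?thesis using False c_pos by simp
    qed
  qed (use e(1) in auto)
  have "real (card S) * (2 * pi / c * \<delta>) = (\<Sum>l\<in>S. 2 * pi / c * \<delta>)" by simp
  also have "\<dots> \<le> (\<Sum>l\<in>S. ip (H (e l)) (H (e l)))"
  proof (rule sum_mono)
    fix l assume l: "l \<in> S"
    have "ip (H (e l)) (H (e l)) = 2 * pi / c * l"
      using HHip[OF l, of "e l"] e(1,2)[OF l] by (subst H_symmetric[symmetric]) auto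
    moreover have "2 * pi / c * \<delta> \<le> 2 * pi / c * l" using S l c_pos by (intro mult_left_mono) auto
    ultimately show "2 * pi / c * \<delta> \<le> ip (H (e l)) (H (e l))" by simp
  qed
  also have "\<dots> \<le> mass\<^sup>2" by (rule trace_bound[OF on S(2)])
  finally show ?thesis using c_pos \<delta> by (simp add: field_simps)
qed

text \<open>\<open>M_count\<close> is a \<open>card\<close>, which would be 0 on an infinite set;
  the uniform bound on finite subsets rules this out.\<close>

lemma finite_eigenvalues:
  assumes \<delta>: "0 < \<delta>" shows "finite {lam. is_eigenvalue_Q c \<alpha> lam \<and> \<delta> \<le> lam}"
proof (rule finite_if_finite_subsets_card_bdd[THEN conjunct1])
  fix G assume "G \<subseteq> {lam. is_eigenvalue_Q c \<alpha> lam \<and> \<delta> \<le> lam}" "finite G"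
  then have "real (card G) \<le> 1 / \<delta> * (c / (2 * pi)) * mass\<^sup>2" by (rule eigenvalue_count_finite_bound[OF \<delta>])
  then show "card G \<le> nat \<lfloor>1 / \<delta> * (c / (2 * pi)) * mass\<^sup>2\<rfloor>" by (simp add: le_nat_floor)
qed

lemma M_count_upper: "0 < \<delta> \<Longrightarrow> real (M_count c \<alpha> \<delta>) \<le> 1 / \<delta> * (c / (2 * pi)) * mass\<^sup>2"
  unfolding M_count_def by (rule eigenvalue_count_finite_bound[OF _ subset_refl finite_eigenvalues])

text \<open>Here strict monotonicity enters: different \<kappa> give different eigenvalues of
  \<open>Q\<close>, so none is lost when distinct values are counted.\<close>

lemma level_le_M_count:
  assumes \<delta>: "0 < \<delta>" shows "card (level (2 * pi * \<delta> / c)) \<le> M_count c \<alpha> \<delta>"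
  unfolding M_count_def
proof (rule card_inj_on_le[OF _ _ finite_eigenvalues[OF \<delta>]])
  show "inj_on (\<lambda>\<kappa>. c / (2 * pi) * (ev \<kappa>)\<^sup>2) (level (2 * pi * \<delta> / c))"
    using ev_sq_inj level_sub c_pos by (auto simp: inj_on_def subset_iff)
  show "(\<lambda>\<kappa>. c / (2 * pi) * (ev \<kappa>)\<^sup>2) ` level (2 * pi * \<delta> / c) \<subseteq> {lam. is_eigenvalue_Q c \<alpha> lam \<and> \<delta> \<le> lam}"
  proof safe
    fix \<kappa> assume k: "\<kappa> \<in> level (2 * pi * \<delta> / c)"
    then have "\<kappa> \<in> spec" using level_sub by blast
    then show "is_eigenvalue_Q c \<alpha> (c / (2 * pi) * (ev \<kappa>)\<^sup>2)" by (rule eigenvalue_of_spec)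
    have "c / (2 * pi) * (2 * pi * \<delta> / c) \<le> c / (2 * pi) * (ev \<kappa>)\<^sup>2"
      using k c_pos by (intro mult_left_mono) (auto simp: level_def)
    then show "\<delta> \<le> c / (2 * pi) * (ev \<kappa>)\<^sup>2" using c_pos by simp
  qed
qed

lemma M_count_lower:
  assumes \<delta>: "0 < \<delta>" "\<delta> < 1"
  shows "(c / (2 * pi))\<^sup>2 * HS c - \<delta> * (c / (2 * pi)) * mass\<^sup>2 \<le> (1 - \<delta>) * real (M_count c \<alpha> \<delta>)"
proof -
  have "(1 - \<delta>) * real (card (level (2 * pi * \<delta> / c))) \<le> (1 - \<delta>) * real (M_count c \<alpha> \<delta>)"
    using level_le_M_count[OF \<delta>(1)] \<delta>(2) by (intro mult_left_mono) auto
  then show ?thesis using HS_le_count[OF \<delta>] by linarith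
qed

end

section \<open>The integrals of the weight and its square as beta values\<close>

lemma Beta_symmetric_integral:
  assumes a: "-1 < (a::real)"
  shows "((\<lambda>x. (1 - x\<^sup>2) powr a) has_integral 2 powr (2 * a + 1) * Beta (a + 1) (a + 1)) {-1..1}"
proof -
  have "((\<lambda>t. t powr ((a + 1) - 1) * (1 - t) powr ((a + 1) - 1)) has_integral Beta (a + 1) (a + 1)) {0..1}"
    using a by (intro has_integral_Beta_real) auto
  then have "((\<lambda>t. t powr a * (1 - t) powr a) has_integral Beta (a + 1) (a + 1)) (cbox 0 1)" by simp
  from has_integral_affinity[OF this, of "1 / 2" "1 / 2"]
  have "((\<lambda>x. (1 / 2 * x + 1 / 2) powr a * (1 - (1 / 2 * x + 1 / 2)) powr a) has_integral 2 * Beta (a + 1) (a + 1)) ((\<lambda>x. 2 * x - 1) ` {0..1})"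
    by simp
  moreover have "(\<lambda>x. 2 * x - 1) ` {0..1} = {-1..1::real}"
    using image_affinity_atLeastAtMost_diff[of 2 1 0 1] by simp
  ultimately have "((\<lambda>x. (1 / 2 * x + 1 / 2) powr a * (1 - (1 / 2 * x + 1 / 2)) powr a) has_integral 2 * Beta (a + 1) (a + 1)) {-1..1}" by simp
  then have "((\<lambda>x. 2 powr (2 * a) * ((1 / 2 * x + 1 / 2) powr a * (1 - (1 / 2 * x + 1 / 2)) powr a)) has_integral 2 powr (2 * a) * (2 * Beta (a + 1) (a + 1))) {-1..1}"
    by (rule has_integral_mult_right)
  moreover have "2 powr (2 * a) * (2 * Beta (a + 1) (a + 1)) = 2 powr (2 * a + 1) * Beta (a + 1) (a + 1)"
    by (simp add: powr_add)
  ultimately have "((\<lambda>x. 2 powr (2 * a) * ((1 / 2 * x + 1 / 2) powr a * (1 - (1 / 2 * x + 1 / 2)) powr a)) has_integral 2 powr (2 * a + 1) * Beta (a + 1) (a + 1)) {-1..1}"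
    by simp
  then show ?thesis
  proof (rule has_integral_eq[rotated])
    fix x :: real assume x: "x \<in> {-1..1}"
    \<comment> \<open>For \<open>t = (x + 1) / 2\<close> one has
      \<open>4 t (1 - t) = 1 - x\<^sup>2\<close>; the factor \<open>4 powr a\<close> is absorbed
      into the base.\<close>
    have "2 powr (2 * a) * ((1 / 2 * x + 1 / 2) powr a * (1 - (1 / 2 * x + 1 / 2)) powr a)
      = (4 powr a) * (((1 / 2 * x + 1 / 2) * (1 - (1 / 2 * x + 1 / 2))) powr a)"
      using x by (subst powr_mult) (auto simp: powr_powr[of 2 2 a, symmetric])
    also have "\<dots> = (4 * ((1 / 2 * x + 1 / 2) * (1 - (1 / 2 * x + 1 / 2)))) powr a"
      using x by (subst powr_mult) auto
    also have "4 * ((1 / 2 * x + 1 / 2) * (1 - (1 / 2 * x + 1 / 2))) = 1 - x\<^sup>2" by (simp add: power2_eq_square algebra_simps)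
    finally show "2 powr (2 * a) * ((1 / 2 * x + 1 / 2) powr a * (1 - (1 / 2 * x + 1 / 2)) powr a) = (1 - x\<^sup>2) powr a" .
  qed
qed

context jacobi_weight begin

lemma mass_eq: "mass = 2 powr (2 * \<alpha> + 1) * Beta (\<alpha> + 1) (\<alpha> + 1)"
proof -
  have "((\<lambda>x. 1 * \<omega> x) has_integral mass) {-1..1}" unfolding mass_def by (rule wmeas_has_integral) auto
  then have "((\<lambda>x. (1 - x\<^sup>2) powr \<alpha>) has_integral mass) {-1..1}" by (simp add: omega_w_def)
  then show ?thesis by (rule has_integral_unique) (rule Beta_symmetric_integral, use alpha_pos in simp)
qed

lemma wsq_eq: "wsq = 2 powr (4 * \<alpha> + 1) * Beta (2 * \<alpha> + 1) (2 * \<alpha> + 1)"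
proof -
  have "((\<lambda>x. \<omega> x * \<omega> x) has_integral wsq) {-1..1}" unfolding wsq_def by (rule wmeas_has_integral[OF omega_Bd])
  then have "((\<lambda>x. (1 - x\<^sup>2) powr (2 * \<alpha>)) has_integral wsq) {-1..1}" by (simp add: omega_w_def powr_add[symmetric])
  moreover have "((\<lambda>x. (1 - x\<^sup>2) powr (2 * \<alpha>)) has_integral 2 powr (4 * \<alpha> + 1) * Beta (2 * \<alpha> + 1) (2 * \<alpha> + 1)) {-1..1}"
    using Beta_symmetric_integral[of "2 * \<alpha>"] alpha_pos by simp
  ultimately show ?thesis by (rule has_integral_unique)
qed

end

theorem theorem3:
  fixes \<alpha> \<delta> :: real
  assumes "\<alpha> > 0" and "0 < \<delta>" and "\<delta> < 1"
  defines "A \<equiv> 2 powr (2 * \<alpha> + 1) * Beta (\<alpha> + 1) (\<alpha> + 1)"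
      and "\<gamma> \<equiv> 2 powr (4 * \<alpha>) * (Beta (2 * \<alpha> + 1) (2 * \<alpha> + 1) / Beta (\<alpha> + 1) (\<alpha> + 1))\<^sup>2"
  shows "(\<exists>h :: real \<Rightarrow> real. h \<in> o[at_top](\<lambda>c. c) \<and>
            (\<forall>\<^sub>F c in at_top. (\<gamma> - \<delta>) / (1 - \<delta>) * (c / (2 * pi)) * A\<^sup>2 + h c
                                \<le> real (M_count c \<alpha> \<delta>)))
       \<and> (\<forall>c > 0. real (M_count c \<alpha> \<delta>) \<le> 1 / \<delta> * (c / (2 * pi)) * A\<^sup>2)"
proof -
  interpret jacobi_weight \<alpha> by unfold_locales (rule assms(1))
  have A: "A = mass" unfolding A_def mass_eq ..
  have Bpos: "0 < Beta (\<alpha> + 1) (\<alpha> + 1)" using assms(1) by (simp add: Beta_def Gamma_real_pos)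
  \<comment> \<open>\<gamma> is the squared quotient of the integrals of
    \<open>\<omega>\<^sup>2\<close> and \<omega>, so this product is the constant of the
    Hilbert--Schmidt asymptotics.\<close>
  have \<gamma>A: "\<gamma> * A\<^sup>2 = wsq\<^sup>2"
  proof -
    have "\<gamma> * A\<^sup>2 = 2 powr (4 * \<alpha>) * (2 powr (2 * \<alpha> + 1))\<^sup>2 * (Beta (2 * \<alpha> + 1) (2 * \<alpha> + 1))\<^sup>2"
      unfolding \<gamma>_def A_def using Bpos by (simp add: power_mult_distrib power_divide)
    also have "2 powr (4 * \<alpha>) * (2 powr (2 * \<alpha> + 1))\<^sup>2 = (2 powr (4 * \<alpha> + 1))\<^sup>2"
      by (simp add: power2_eq_square powr_add[symmetric])
    finally show ?thesis unfolding wsq_eq by (simp add: power_mult_distrib)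
  qed
  define main where "main c = (\<gamma> - \<delta>) / (1 - \<delta>) * (c / (2 * pi)) * A\<^sup>2" for c
  \<comment> \<open>The exact shortfall, cut off at 0: the inequality holds by construction, and the
    content is that \<open>h\<close> is \<open>o(c)\<close>.\<close>
  define h where "h c = min 0 (real (M_count c \<alpha> \<delta>) - main c)" for c
  have "h \<in> o[at_top](\<lambda>c. c)"
  proof (rule landau_o.smallI)
    fix e :: real assume e: "0 < e"
    \<comment> \<open>Chosen so that \<open>c / (4 * pi\<^sup>2) * \<eta>\<close> equals
      \<open>(1 - \<delta>) * (e * c)\<close>.\<close>
    define \<eta> where "\<eta> = e * (4 * pi\<^sup>2) * (1 - \<delta>)"
    have \<eta>: "0 < \<eta>" unfolding \<eta>_def using e assms(3) by simp
    show "\<forall>\<^sub>F c in at_top. norm (h c) \<le> e * norm c"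
      using HS_asymptotics[OF \<eta>] eventually_gt_at_top[of 0]
    proof eventually_elim
      case (elim c)
      then have c: "0 < c" by simp
      interpret hartley \<alpha> c by unfold_locales (rule c)
      have "(1 - \<delta>) * (main c - e * c) = c / (4 * pi\<^sup>2) * (2 * pi * wsq\<^sup>2 - \<eta>) - \<delta> * (c / (2 * pi)) * mass\<^sup>2"
      proof -
        have "(1 - \<delta>) * main c = (\<gamma> - \<delta>) * (c / (2 * pi)) * A\<^sup>2" unfolding main_def using assms(3) by simp
        also have "\<dots> = c / (2 * pi) * wsq\<^sup>2 - \<delta> * (c / (2 * pi)) * mass\<^sup>2"
        proof -
          have "(a - b) * k * m = k * (a * m) - b * k * m" for a b k m :: real by (simp add: algebra_simps)
          then show ?thesis unfolding \<gamma>A[symmetric] A .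
        qed
        also have "c / (2 * pi) * wsq\<^sup>2 = c / (4 * pi\<^sup>2) * (2 * pi * wsq\<^sup>2)" by (simp add: power2_eq_square)
        finally have 1: "(1 - \<delta>) * main c = c / (4 * pi\<^sup>2) * (2 * pi * wsq\<^sup>2) - \<delta> * (c / (2 * pi)) * mass\<^sup>2" .
        have 2: "(1 - \<delta>) * (e * c) = c / (4 * pi\<^sup>2) * \<eta>" unfolding \<eta>_def by simp
        show ?thesis unfolding right_diff_distrib[of "1 - \<delta>"] right_diff_distrib[of "c / (4 * pi\<^sup>2)"] 1 2 by simp
      qed
      also have "\<dots> \<le> c / (4 * pi\<^sup>2) * (c * HS c) - \<delta> * (c / (2 * pi)) * mass\<^sup>2"
        using elim c by (intro diff_right_mono mult_left_mono) auto
      also have "c / (4 * pi\<^sup>2) * (c * HS c) = (c / (2 * pi))\<^sup>2 * HS c" by (simp add: power2_eq_square)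
      also have "(c / (2 * pi))\<^sup>2 * HS c - \<delta> * (c / (2 * pi)) * mass\<^sup>2 \<le> (1 - \<delta>) * real (M_count c \<alpha> \<delta>)"
        by (rule M_count_lower[OF assms(2,3)])
      finally have "main c - e * c \<le> real (M_count c \<alpha> \<delta>)" using assms(3) by simp
      moreover have "0 \<le> e * c" using e c by simp
      ultimately show "norm (h c) \<le> e * norm c" unfolding h_def using c by (simp add: min_def)
    qed
  qed
  moreover have "\<forall>\<^sub>F c in at_top. main c + h c \<le> real (M_count c \<alpha> \<delta>)"
    by (rule always_eventually) (auto simp: h_def)
  moreover have "real (M_count c \<alpha> \<delta>) \<le> 1 / \<delta> * (c / (2 * pi)) * A\<^sup>2" if c: "0 < c" for c
  proof -
    interpret hartley \<alpha> c by unfold_locales (rule c)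
    show ?thesis unfolding A by (rule M_count_upper[OF assms(2)])
  qed
  ultimately show ?thesis unfolding main_def by blast
qed

end
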